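(* Let $r_1,r_2\in(0,1)$ and $a_1,a_2\in(1,\infty)$. For $i=1,2$ let $l_i:\mathbb{R}\to\mathbb{R}$ be Lebesgue measurable and integrable with $\int_{\mathbb{R}}l_i(y)\,dy=1$, $\int_{\mathbb{R}}l_i(y)e^{\lambda y}\,dy<\infty$ for all $\lambda\in\mathbb{R}$, and $l_i(y)=l_i(-y)\ge 0$ for all $y\in\mathbb{R}$. Then there exist $c\in\mathbb{R}$ and a pair $(\phi,\psi)\in\mathcal{C}_{[\theta,\mathbf{1}]}$ satisfying \[ \begin{cases} \phi (t+c)=1-\int_{\mathbb{R}}(1-\phi (y))e^{r_{1}(\phi (y)-a_{1}\psi(y))}l_{1}(t-y)\,dy,\\ \psi(t+c)=\int_{\mathbb{R}} \psi (y)e^{r_{2}(1-a_2-\psi (y)+a_{2}\phi (y))}l_{2}(t-y)\,dy, \qquad t\in\mathbb{R}, \end{cases} \] and \[ \lim_{t\to -\infty}(\phi(t),\psi(t))=(0,0),\qquad \lim_{t\to \infty}(\phi(t),\psi(t))=(1,1), \] such that $(\phi,\psi)$ is monotone increasing. In particular $U_n(x)=\phi(x+cn)$, $V_n(x)=\psi(x+cn)$ is a bistable traveling wave solution of the recursion system \[ \begin{cases} U_{n+1}(x)=1-\int_{\mathbb{R}}(1-U_{n}(y))e^{r_{1}(U_{n}(y)-a_{1}V_{n}(y))}l_{1}(x-y)\,dy,\\ V_{n+1}(x)=\int_{\mathbb{R}}V_{n}(y)e^{r_{2}(1-a_2-V_{n}(y)+a_{2}U_{n}(y))}l_{2}(x-y)\,dy,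 \end{cases}\qquad x\in\mathbb{R},\ n\in\mathbb{N}, \] connecting $(0,0)$ and $(1,1)$.
   Context: $\mathcal{C}=C(\mathbb{R},\mathbb{R}^2)$ denotes the space of uniformly continuous and bounded functions $\mathbb{R}\to\mathbb{R}^2$, with the compact-open topology (convergence uniform on compact subsets) and the componentwise pointwise partial order. For $A\le B$ in $\mathbb{R}^2$, $\mathcal{C}_{[A,B]}=\{U\in\mathcal{C}: A\le U(x)\le B \text{ for all } x\in\mathbb{R}\}$. $\theta=(0,0)$ and $\mathbf{1}=(1,1)$. This system arises from the Ricker-type competition recursion $U_{n+1}(x)=\int U_n(y)e^{r_1(1-U_n(y)-a_1V_n(y))}l_1(x-y)dy$, $V_{n+1}(x)=\int V_n(y)e^{r_2(1-V_n(y)-a_2U_n(y))}l_2(x-y)dy$ via the substitution $U\mapsto 1-U$. *)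

theory Defs
  imports "HOL-Analysis.Analysis"
begin

definition in_C01 :: "(real \<Rightarrow> real) \<Rightarrow> bool" where
  "in_C01 f \<longleftrightarrow> uniformly_continuous_on UNIV f \<and> bounded (range f) \<and> (\<forall>x. 0 \<le> f x \<and> f x \<le> 1)"

end

theory Submission
  imports Defs "HOL-Probability.Helly_Selection" "HOL-Probability.Distributions"
begin

text \<open>
  The recursion operator is monotone and its constant fixed points in the unit square are the stable
  states \<open>(0, 0)\<close>, \<open>(1, 1)\<close> and the unstable states \<open>(1, 0)\<close> and a coexistence state. First mix a small
  Gaussian into the kernels and prescribe the state \<open>(0, 0)\<close> to the left of \<open>-k\<close> and \<open>(1, 1)\<close> to the right
  of \<open>k\<close>. For every speed this window problem has a unique monotone solution (monotone iteration and
  sliding), depending continuously and antitonically on the speed; hence some speed \<open>c_k\<close>, bounded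
  independently of \<open>k\<close>, makes the sum of the components at \<open>0\<close> equal to a value \<open>\<theta>\<close> which is attained at no
  fixed point. By Helly's theorem the window fronts converge to a nonconstant monotone wave of the
  original equation as \<open>k \<rightarrow> \<infinity>\<close>, and its limits at \<open>\<plusminus>\<infinity>\<close> are fixed points.

  Intermediate limits are excluded by a sign argument: as the kernels are symmetric, a monotone
  supersolution of the equation with speed \<open>0\<close> that emanates from an unstable state is constant, so a
  wave from an intermediate state up to \<open>(1, 1)\<close> has positive speed, and by symmetry a wave from
  \<open>(0, 0)\<close> up to an intermediate state has negative speed. Since all limits of translates of the window
  fronts share the same speed, both cannot occur.
\<close>

section \<open>Fronts and diffuse kernels\<close>

text \<open>The Gaussian is mixed in because the given kernels may have bounded or disconnected
  support, and then convolving need not make a comparison strict, which is what uniqueness of window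
  solutions rests on. The prescribed values 0 and 1 make a window solution a supersolution right of
  \<open>-k\<close> and a subsolution left of \<open>k\<close>; these one-sided inequalities survive
  recentring near an edge, where the equation itself may be lost. The bound on the speeds comes from
  constant states near the two stable corners which the map moves strictly towards their corner,
  with a margin exceeding the kernel tails. The sign argument needs no spreading speeds: a symmetric
  kernel with a first moment has mean zero, so by Jensen convolution cannot lower the integral of a
  monotone function over a left half-line (relative to its limit), while near an unstable state a
  weighted sum of the reactions strictly raises it; a supersolution leaves no room for both. Helly's
  theorem gives convergence at continuity points only; as the kernels have no atoms, one application
  of the operator upgrades it to convergence everywhere.\<close>

definition front :: "(real \<Rightarrow> real) \<Rightarrow> bool" where
  "front f \<longleftrightarrow> mono f \<and> (\<forall>t. 0 \<le> f t \<and> f t \<le> 1)"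

lemma frontI: "\<lbrakk>mono f; \<And>t. 0 \<le> f t; \<And>t. f t \<le> 1\<rbrakk> \<Longrightarrow> front f"
  by (auto simp: front_def)

lemma front_mono: "front f \<Longrightarrow> mono f"
  and front_monoD: "front f \<Longrightarrow> x \<le> y \<Longrightarrow> f x \<le> f y"
  and front_nonneg: "front f \<Longrightarrow> 0 \<le> f t"
  and front_le_1: "front f \<Longrightarrow> f t \<le> 1"
  by (auto simp: front_def mono_def)

lemma front_measurable: "front f \<Longrightarrow> f \<in> borel_measurable borel"
  by (simp add: front_def borel_measurable_mono)

lemma front_shift: "front f \<Longrightarrow> front (\<lambda>t. f (t + x))"
  by (auto simp: front_def mono_def)

lemma front_reflect: "front f \<Longrightarrow> front (\<lambda>t. 1 - f (- t))"
  by (auto simp: front_def mono_def)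

section \<open>Convergence of monotone functions at continuity points and Helly selection\<close>

lemma ex_isCont_between:
  fixes f g :: "real \<Rightarrow> real"
  assumes "mono f" "mono g" "a < b"
  obtains x where "a < x" "x < b" "isCont f x" "isCont g x"
proof -
  have "countable ({x. \<not> isCont f x} \<union> {x. \<not> isCont g x})"
    using mono_ctble_discont[OF assms(1)] mono_ctble_discont[OF assms(2)] by (rule countable_Un)
  moreover have "uncountable {a<..<b}" using assms by (simp add: uncountable_open_interval)
  ultimately have "\<not> {a<..<b} \<subseteq> {x. \<not> isCont f x} \<union> {x. \<not> isCont g x}"
    using countable_subset by blast
  then obtain x where "x \<in> {a<..<b}" "x \<notin> {x. \<not> isCont f x} \<union> {x. \<not> isCont g x}"
    by blast
  then show thesis using that by auto
qed

text \<open>Monotonicity squeezes \<open>fn n (xn n)\<close> between the values at two continuity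
  points \<open>a\<close> and \<open>b\<close> on either side of \<open>x\<close>, where
  \<open>f\<close> is close to \<open>f x\<close>. Moving points arise because the speeds vary with
  \<open>n\<close>.\<close>

lemma mono_limit_moving_point:
  fixes f :: "real \<Rightarrow> real"
  assumes mn: "\<And>n. mono (fn n)" and m: "mono f"
    and lim: "\<And>x. isCont f x \<Longrightarrow> (\<lambda>n. fn n x) \<longlonglongrightarrow> f x"
    and x: "xn \<longlonglongrightarrow> x" "isCont f x"
  shows "(\<lambda>n. fn n (xn n)) \<longlonglongrightarrow> f x"
proof (rule LIMSEQ_I)
  fix e :: real assume e: "0 < e"
  obtain d where d: "d > 0" "\<And>y. \<bar>y - x\<bar> < d \<Longrightarrow> \<bar>f y - f x\<bar> < e/2"
    using x(2)[unfolded continuous_at_eps_delta, rule_format, of "e/2"] e by (auto simp: dist_real_def)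
  obtain a where a: "x - d < a" "a < x" "isCont f a"
    using ex_isCont_between[OF m m, of "x - d" x] d by auto
  obtain b where b: "x < b" "b < x + d" "isCont f b"
    using ex_isCont_between[OF m m, of x "x + d"] d by auto
  have "\<forall>\<^sub>F n in sequentially. a < xn n" "\<forall>\<^sub>F n in sequentially. xn n < b"
    using order_tendstoD x(1) a b by blast+
  moreover have "\<forall>\<^sub>F n in sequentially. \<bar>fn n a - f a\<bar> < e/2"
    using tendstoD[OF lim[OF a(3)], of "e/2"] e by (simp add: dist_real_def)
  moreover have "\<forall>\<^sub>F n in sequentially. \<bar>fn n b - f b\<bar> < e/2"
    using tendstoD[OF lim[OF b(3)], of "e/2"] e by (simp add: dist_real_def)
  ultimately have "\<forall>\<^sub>F n in sequentially. norm (fn n (xn n) - f x) < e"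
  proof eventually_elim
    case (elim n)
    have "fn n a \<le> fn n (xn n)" "fn n (xn n) \<le> fn n b"
      using mn[of n] elim by (auto simp: mono_def)
    moreover have "\<bar>f a - f x\<bar> < e/2" "\<bar>f b - f x\<bar> < e/2"
      using d(2)[of a] d(2)[of b] a b by auto
    ultimately show ?case using elim unfolding real_norm_def by linarith
  qed
  then show "\<exists>no. \<forall>n\<ge>no. norm (fn n (xn n) - f x) < e"
    by (simp add: eventually_sequentially)
qed

text \<open>\<open>Helly_selection\<close> speaks of right-continuous functions and a front need not
  be one, so it is applied to the right limits \<open>g n\<close>. Convergence carries over to
  \<open>fn\<close> because \<open>g n (x - 1 / Suc n)\<close> and \<open>g n x\<close> enclose
  \<open>fn n x\<close> and both tend to \<open>f x\<close> at a continuity point.\<close>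

lemma Helly_selection_front:
  assumes fn: "\<And>n. front (fn n)"
  obtains s f where "strict_mono (s::nat\<Rightarrow>nat)" "front f" "\<And>x. continuous (at_right x) f"
    "\<And>x. isCont f x \<Longrightarrow> (\<lambda>n. fn (s n) x) \<longlonglongrightarrow> f x"
proof -
  define g where "g n x = Inf (fn n ` {x<..})" for n x
  have bdd: "bdd_below (fn n ` {x<..})" for n x
    using front_nonneg[OF fn] by (auto intro!: bdd_belowI)
  have g_le: "g n x \<le> fn n y" if "x < y" for n x y
    unfolding g_def using bdd that by (intro cInf_lower) auto
  have le_g: "z \<le> g n x" if "\<And>y. x < y \<Longrightarrow> z \<le> fn n y" for n x z
    unfolding g_def using that by (intro cInf_greatest) auto
  have fg: "fn n x \<le> g n x" for n x
    by (rule le_g) (simp add: front_monoD[OF fn])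
  have gm: "mono (g n)" for n
    by (rule monoI, rule le_g, rule g_le) simp
  have gb: "\<bar>g n x\<bar> \<le> 1" for n x
  proof -
    have "0 \<le> g n x" by (rule le_g) (rule front_nonneg[OF fn])
    moreover have "g n x \<le> 1" using g_le[of x "x+1" n] front_le_1[OF fn, of n "x+1"] by simp
    ultimately show ?thesis by simp
  qed
  have gc: "continuous (at_right x) (g n)" for n x
    unfolding continuous_within
  proof (rule order_tendstoI)
    fix a assume "a < g n x"
    then show "\<forall>\<^sub>F y in at_right x. a < g n y"
      using monoD[OF gm, of x _ n]
      by (intro eventually_at_rightI[of x "x+1"]) (auto intro: order.strict_trans2)
  next
    fix a assume "g n x < a"
    then obtain y where y: "x < y" "fn n y < a"
      unfolding g_def using bdd by (subst (asm) cInf_less_iff) auto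
    have "g n z < a" if "z < y" for z using g_le[OF that, of n] y(2) by simp
    then show "\<forall>\<^sub>F z in at_right x. g n z < a"
      using y by (auto simp: eventually_at_right_field)
  qed
  obtain s f where s: "strict_mono (s::nat\<Rightarrow>nat)" and f: "\<And>x. continuous (at_right x) f" "mono f"
    "\<And>x. \<bar>f x\<bar> \<le> 1" and lim: "\<And>x. isCont f x \<Longrightarrow> (\<lambda>n. g (s n) x) \<longlonglongrightarrow> f x"
    using Helly_selection[of g 1, OF gc gm gb] by (elim exE conjE) (rule that, auto)
  have flim: "(\<lambda>n. fn (s n) x) \<longlonglongrightarrow> f x" if c: "isCont f x" for x
  proof (rule tendsto_sandwich)
    show "(\<lambda>n. g (s n) (x - 1 / Suc n)) \<longlonglongrightarrow> f x"
    proof (rule mono_limit_moving_point[OF gm f(2) lim _ c])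
      show "(\<lambda>n. x - 1 / Suc n) \<longlonglongrightarrow> x"
        using tendsto_diff[OF tendsto_const[of x] LIMSEQ_inverse_real_of_nat] by (simp add: inverse_eq_divide)
    qed
    show "(\<lambda>n. g (s n) x) \<longlonglongrightarrow> f x" by (rule lim[OF c])
  qed (auto intro!: always_eventually g_le fg)
  have "0 \<le> f x" for x
  proof -
    obtain y where y: "x - 1 < y" "y < x" "isCont f y"
      using ex_isCont_between[OF f(2) f(2), of "x - 1" x] by auto
    have "0 \<le> f y" using flim[OF y(3)] by (rule LIMSEQ_le_const) (auto intro: front_nonneg fn)
    also have "f y \<le> f x" using f(2) y by (simp add: mono_def)
    finally show ?thesis .
  qed
  then have "front f" using f by (auto simp: front_def abs_le_iff)
  then show thesis by (rule that[OF s _ f(1) flim])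
qed

lemma Helly_selection_front_pair:
  assumes fn: "\<And>n. front (fn n)" and gn: "\<And>n. front (gn n)"
  obtains s f g where "strict_mono (s::nat\<Rightarrow>nat)" "front f" "front g"
    "\<And>x. continuous (at_right x) f" "\<And>x. continuous (at_right x) g"
    "\<And>x. isCont f x \<Longrightarrow> (\<lambda>n. fn (s n) x) \<longlonglongrightarrow> f x"
    "\<And>x. isCont g x \<Longrightarrow> (\<lambda>n. gn (s n) x) \<longlonglongrightarrow> g x"
proof -
  obtain s f where s: "strict_mono (s::nat\<Rightarrow>nat)" "front f" "\<And>x. continuous (at_right x) f"
    "\<And>x. isCont f x \<Longrightarrow> (\<lambda>n. fn (s n) x) \<longlonglongrightarrow> f x"
    by (rule Helly_selection_front[of fn, OF fn]) (rule that)
  obtain r g where r: "strict_mono (r::nat\<Rightarrow>nat)" "front g" "\<And>x. continuous (at_right x) g"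
    "\<And>x. isCont g x \<Longrightarrow> (\<lambda>n. gn (s (r n)) x) \<longlonglongrightarrow> g x"
    by (rule Helly_selection_front[of "\<lambda>n. gn (s n)", OF gn]) (rule that)
  show thesis
  proof (rule that[of "s \<circ> r" f g])
    show "strict_mono (s \<circ> r)" using s(1) r(1) by (rule strict_mono_o)
    show "(\<lambda>n. fn ((s \<circ> r) n) x) \<longlonglongrightarrow> f x" if "isCont f x" for x
      using LIMSEQ_subseq_LIMSEQ[OF s(4)[OF that] r(1)] by (simp add: o_def)
    show "(\<lambda>n. gn ((s \<circ> r) n) x) \<longlonglongrightarrow> g x" if "isCont g x" for x
      using r(4)[OF that] by simp
  qed (fact s r)+
qed

text \<open>Positivity off the axes serves the sliding argument: where one pair of fronts vanishes
  and the other is positive in both components, the reaction terms differ strictly as well.\<close>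

definition reaction :: "(real \<Rightarrow> real \<Rightarrow> real) \<Rightarrow> bool" where
  "reaction F \<longleftrightarrow> continuous_on UNIV (\<lambda>(u, v). F u v) \<and>
     (\<forall>u v u' v'. 0 \<le> u \<and> u \<le> u' \<and> u' \<le> 1 \<and> 0 \<le> v \<and> v \<le> v' \<and> v' \<le> 1 \<longrightarrow> F u v \<le> F u' v') \<and>
     F 0 0 = 0 \<and> F 1 1 = 1 \<and> (\<forall>u v. 0 < u \<and> u \<le> 1 \<and> 0 < v \<and> v \<le> 1 \<longrightarrow> 0 < F u v)"

lemma reaction_mono:
  "\<lbrakk>reaction F; 0 \<le> u; u \<le> u'; u' \<le> 1; 0 \<le> v; v \<le> v'; v' \<le> 1\<rbrakk> \<Longrightarrow> F u v \<le> F u' v'"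
  unfolding reaction_def by blast

lemma reaction_tendsto:
  assumes "reaction F" "(f \<longlongrightarrow> u) X" "(g \<longlongrightarrow> v) X"
  shows "((\<lambda>n. F (f n) (g n)) \<longlongrightarrow> F u v) X"
proof -
  have "isCont (\<lambda>(u, v). F u v) (u, v)"
    using assms(1) by (simp add: reaction_def continuous_on_eq_continuous_at)
  from isCont_tendsto_compose[OF this tendsto_Pair[OF assms(2,3)]] show ?thesis by simp
qed

lemma front_reaction:
  assumes "reaction F" "front f" "front g"
  shows "front (\<lambda>t. F (f t) (g t))"
proof -
  have z: "F 0 0 = 0" "F 1 1 = 1" using assms by (auto simp: reaction_def)
  show ?thesis
  proof (rule frontI)
    show "mono (\<lambda>t. F (f t) (g t))"
      using assms(2,3) by (auto simp: front_def mono_def intro!: reaction_mono[OF assms(1)])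
    show "0 \<le> F (f t) (g t)" for t
      using reaction_mono[OF assms(1), of 0 "f t" 0 "g t"] z assms(2,3) by (simp add: front_nonneg front_le_1)
    show "F (f t) (g t) \<le> 1" for t
      using reaction_mono[OF assms(1), of "f t" 1 "g t" 1] z assms(2,3) by (simp add: front_nonneg front_le_1)
  qed
qed

section \<open>Convolution of fronts with an atomless probability measure\<close>

definition conv :: "real measure \<Rightarrow> (real \<Rightarrow> real) \<Rightarrow> real \<Rightarrow> real" where
  "conv M h t = (\<integral>y. h (t - y) \<partial>M)"

text \<open>Without atoms, a monotone function is continuous at \<open>t - y\<close> for almost every \<open>y\<close>, so the
  convolution operators are continuous along sequences of fronts converging only at continuity points.\<close>

locale diffuse = real_distribution M for M +
  assumes no_atoms: "emeasure M {x} = 0"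
begin

lemma AE_notin_countable: "countable A \<Longrightarrow> AE y in M. y \<notin> A"
  using null_sets_UN'[of A "\<lambda>x. {x}" M] no_atoms
  by (intro AE_not_in) (auto simp: null_sets_def)

lemma AE_isCont:
  assumes "mono (f :: real \<Rightarrow> real)"
  shows "AE y in M. isCont f (t - y)"
proof -
  have "countable ((\<lambda>x. t - x) ` {x. \<not> isCont f x})"
    using mono_ctble_discont[OF assms] by (rule countable_image)
  from AE_notin_countable[OF this] show ?thesis
    by eventually_elim (force simp: image_iff)
qed

lemma front_integrable: "front h \<Longrightarrow> integrable M (\<lambda>y. h (t - y))"
  by (rule integrable_const_bound[where B=1])
    (auto simp: front_nonneg front_le_1 intro: measurable_compose[OF _ front_measurable])

lemma front_conv:
  assumes "front h" shows "front (conv M h)"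
proof (rule frontI)
  show "mono (conv M h)" unfolding conv_def
    by (intro monoI integral_mono front_integrable assms) (simp add: front_monoD[OF assms])
  show "0 \<le> conv M h t" for t unfolding conv_def
    by (intro integral_nonneg_AE) (simp add: front_nonneg assms)
  show "conv M h t \<le> 1" for t unfolding conv_def
    by (rule integral_le_const) (auto simp: front_integrable front_le_1 assms)
qed

lemma conv_mono:
  assumes "front h" "front h'" "\<And>t. h t \<le> h' t" shows "conv M h t \<le> conv M h' t"
  unfolding conv_def by (intro integral_mono front_integrable assms)

lemma conv_limit:
  assumes F: "reaction F" and fn: "\<And>n. front (fn n)" "\<And>n. front (gn n)" and f: "front f" "front g"
    and lim: "\<And>x. isCont f x \<Longrightarrow> (\<lambda>n. fn n x) \<longlonglongrightarrow> f x"
      "\<And>x. isCont g x \<Longrightarrow> (\<lambda>n. gn n x) \<longlonglongrightarrow> g x"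
    and x: "xn \<longlonglongrightarrow> x"
  shows "(\<lambda>n. conv M (\<lambda>s. F (fn n s) (gn n s)) (xn n)) \<longlonglongrightarrow> conv M (\<lambda>s. F (f s) (g s)) x"
  unfolding conv_def
proof (rule integral_dominated_convergence[where w="\<lambda>_. 1"])
  have [measurable]: "(\<lambda>s. F (f s) (g s)) \<in> borel_measurable borel" "(\<lambda>s. F (fn n s) (gn n s)) \<in> borel_measurable borel" for n
    by (rule front_measurable[OF front_reaction[OF F f]], rule front_measurable[OF front_reaction[OF F fn]])
  show "(\<lambda>y. F (f (x - y)) (g (x - y))) \<in> borel_measurable M" by measurable
  show "(\<lambda>y. F (fn n (xn n - y)) (gn n (xn n - y))) \<in> borel_measurable M" for n
  proof -
    have "(\<lambda>y. xn n - y) \<in> borel_measurable M" by measurable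
    from measurable_compose[OF this \<open>(\<lambda>s. F (fn n s) (gn n s)) \<in> borel_measurable borel\<close>]
    show ?thesis by simp
  qed
  show "AE y in M. (\<lambda>n. F (fn n (xn n - y)) (gn n (xn n - y))) \<longlonglongrightarrow> F (f (x - y)) (g (x - y))"
    using AE_isCont[OF front_mono[OF f(1)], of x] AE_isCont[OF front_mono[OF f(2)], of x]
  proof eventually_elim
    case (elim y)
    have "(\<lambda>n. xn n - y) \<longlonglongrightarrow> x - y" by (intro tendsto_intros x)
    then show ?case
      by (intro reaction_tendsto[OF F]
          mono_limit_moving_point[OF front_mono[OF fn(1)] front_mono[OF f(1)] lim(1) _ elim(1)]
          mono_limit_moving_point[OF front_mono[OF fn(2)] front_mono[OF f(2)] lim(2) _ elim(2)])
  qed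
  show "AE y in M. norm (F (fn n (xn n - y)) (gn n (xn n - y))) \<le> 1" for n
    using front_nonneg[OF front_reaction[OF F fn]] front_le_1[OF front_reaction[OF F fn]] by simp
qed simp

lemma conv_isCont: "front h \<Longrightarrow> isCont (conv M h) x"
  unfolding continuous_at_sequentially o_def
proof (intro allI impI)
  fix xn assume h: "front h" and "xn \<longlonglongrightarrow> x"
  \<comment> \<open>The first projection counts as a reaction, so sequential continuity is
    \<open>conv_limit\<close> for constant sequences of fronts and a moving point.\<close>
  have *: "reaction (\<lambda>u v. u)" by (auto simp: reaction_def split_beta intro!: continuous_intros)
  show "(\<lambda>n. conv M h (xn n)) \<longlonglongrightarrow> conv M h x"
    using conv_limit[OF *, of "\<lambda>_. h" "\<lambda>_. h" h h] h \<open>xn \<longlonglongrightarrow> x\<close> by simp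
qed

lemma conv_at_limit:
  assumes h: "front h" and lim: "(h \<longlongrightarrow> A) X" and X: "X = at_bot \<or> X = at_top"
  shows "(conv M h \<longlongrightarrow> A) X"
proof -
  have seq: "(\<lambda>n. conv M h (xn n)) \<longlonglongrightarrow> A" if xn: "filterlim xn X sequentially" for xn
  proof -
    have "(\<lambda>n. \<integral>y. h (xn n - y) \<partial>M) \<longlonglongrightarrow> (\<integral>y. A \<partial>M)"
    proof (rule integral_dominated_convergence[where w="\<lambda>_. 1"])
      note [measurable] = front_measurable[OF h]
      show "(\<lambda>y. h (xn n - y)) \<in> borel_measurable M" for n by measurable
      have "(\<lambda>n. h (xn n - y)) \<longlonglongrightarrow> A" for y
      proof (rule filterlim_compose[OF lim])
        show "filterlim (\<lambda>n. xn n - y) X sequentially"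
          using X xn by (auto simp: filterlim_at_top filterlim_at_bot le_diff_eq diff_le_eq)
      qed
      then show "AE y in M. (\<lambda>n. h (xn n - y)) \<longlonglongrightarrow> A" by simp
    qed (auto simp: front_nonneg front_le_1 h)
    then show ?thesis by (simp add: conv_def prob_space[simplified])
  qed
  from X show ?thesis
  proof
    assume "X = at_top"
    then show ?thesis using seq by (auto intro: tendsto_at_topI_sequentially)
  next
    assume [simp]: "X = at_bot"
    have "((\<lambda>x. conv M h (- x)) \<longlongrightarrow> A) at_top"
    proof (rule tendsto_at_topI_sequentially)
      fix xn :: "nat \<Rightarrow> real" assume "filterlim xn at_top sequentially"
      then show "(\<lambda>n. conv M h (- xn n)) \<longlonglongrightarrow> A"
        using seq[of "\<lambda>n. - xn n"] by (simp add: filterlim_uminus_at_top)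
    qed
    then show ?thesis by (simp add: filterlim_at_bot_mirror)
  qed
qed

end

lemma front_limit_at_top:
  assumes h: "front h"
  obtains B where "(h \<longlongrightarrow> B) at_top" "\<And>t. h t \<le> B" "B \<le> 1"
proof (rule that)
  have bdd: "bdd_above (range h)" using front_le_1[OF h] by (auto intro!: bdd_aboveI)
  show le: "h t \<le> Sup (range h)" for t using bdd by (auto intro: cSup_upper)
  show "Sup (range h) \<le> 1" using front_le_1[OF h] by (intro cSup_least) auto
  show "(h \<longlongrightarrow> Sup (range h)) at_top"
  proof (rule order_tendstoI)
    fix a assume "a < Sup (range h)"
    then obtain t where "a < h t" using less_cSup_iff[OF _ bdd] by auto
    then show "\<forall>\<^sub>F x in at_top. a < h x"
      using front_monoD[OF h, of t] by (auto simp: eventually_at_top_linorder intro!: exI[of _ t] intro: order.strict_trans2)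
  next
    fix a assume "Sup (range h) < a"
    then show "\<forall>\<^sub>F x in at_top. h x < a" using le by (auto intro!: always_eventually intro: order.strict_trans1)
  qed
qed

lemma front_limit_at_bot:
  assumes h: "front h"
  obtains A where "(h \<longlongrightarrow> A) at_bot" "\<And>t. A \<le> h t" "0 \<le> A"
proof -
  obtain B where B: "((\<lambda>t. 1 - h (- t)) \<longlongrightarrow> B) at_top" "\<And>t. 1 - h (- t) \<le> B" "B \<le> 1"
    by (rule front_limit_at_top[OF front_reflect[OF h]]) (rule that)
  have "((\<lambda>t. 1 - (1 - h (- t))) \<longlongrightarrow> 1 - B) at_top" by (intro tendsto_intros B)
  then have "(h \<longlongrightarrow> 1 - B) at_bot" by (simp add: filterlim_at_bot_mirror)
  moreover have "1 - B \<le> h t" for t using B(2)[of "- t"] by simp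
  ultimately show thesis using that[of "1 - B"] B(3) by simp
qed

section \<open>The window problem\<close>

lemma front_LIMSEQ:
  assumes fn: "\<And>n. front (fn n)" and lim: "\<And>t. (\<lambda>n. fn n t) \<longlonglongrightarrow> f t"
  shows "front f"
proof (rule frontI, rule monoI)
  show "f x \<le> f y" if "x \<le> y" for x y
    using front_monoD[OF fn that] by (intro LIMSEQ_le[OF lim lim]) auto
  show "0 \<le> f t" for t using front_nonneg[OF fn] by (intro LIMSEQ_le_const[OF lim]) auto
  show "f t \<le> 1" for t using front_le_1[OF fn] by (intro LIMSEQ_le_const2[OF lim]) auto
qed

text \<open>One component of the recursion operator. The wave equation
  \<open>f (t + c) = step M F f g t\<close> is written throughout as
  \<open>f t = step M F f g (t - c)\<close>, so for a front a positive \<open>c\<close> means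
  \<open>f t \<le> step M F f g t\<close>.\<close>

definition step :: "real measure \<Rightarrow> (real \<Rightarrow> real \<Rightarrow> real) \<Rightarrow> (real \<Rightarrow> real) \<Rightarrow> (real \<Rightarrow> real) \<Rightarrow> real \<Rightarrow> real" where
  "step M F f g = conv M (\<lambda>s. F (f s) (g s))"

context diffuse
begin

lemma front_step: "\<lbrakk>reaction F; front f; front g\<rbrakk> \<Longrightarrow> front (step M F f g)"
  unfolding step_def by (rule front_conv[OF front_reaction])

lemma step_isCont: "\<lbrakk>reaction F; front f; front g\<rbrakk> \<Longrightarrow> isCont (step M F f g) x"
  unfolding step_def by (rule conv_isCont[OF front_reaction])

lemma step_mono:
  assumes "reaction F" "front f" "front g" "front f'" "front g'" "\<And>t. f t \<le> f' t" "\<And>t. g t \<le> g' t"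
  shows "step M F f g t \<le> step M F f' g' t"
  unfolding step_def
  by (rule conv_mono[OF front_reaction[OF assms(1-3)] front_reaction[OF assms(1,4,5)]])
    (use assms in \<open>auto intro!: reaction_mono[OF assms(1)] simp: front_nonneg front_le_1\<close>)

lemma step_zero: "reaction F \<Longrightarrow> step M F (\<lambda>_. 0) (\<lambda>_. 0) t = 0"
  by (simp add: step_def conv_def reaction_def)

text \<open>Full support carries a strict inequality on a single interval to every \<open>t\<close>:
  the \<open>y\<close> with \<open>t - y\<close> in that interval form an open interval of positive
  mass.\<close>

lemma step_strict:
  assumes F: "reaction F" and fr: "front f" "front g" "front f'" "front g'"
    and le: "\<And>t. f t \<le> f' t" "\<And>t. g t \<le> g' t"
    and supp: "\<And>a b. a < b \<Longrightarrow> 0 < emeasure M {a<..<b}"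
    and ab: "a < b" "\<And>s. a < s \<Longrightarrow> s < b \<Longrightarrow> F (f s) (g s) < F (f' s) (g' s)"
  shows "step M F f g t < step M F f' g' t"
  unfolding step_def conv_def
proof (rule integral_less_AE)
  show "integrable M (\<lambda>y. F (f (t - y)) (g (t - y)))" "integrable M (\<lambda>y. F (f' (t - y)) (g' (t - y)))"
    using front_integrable[OF front_reaction[OF F fr(1,2)]] front_integrable[OF front_reaction[OF F fr(3,4)]] by auto
  show "emeasure M {t - b<..<t - a} \<noteq> 0" using supp[of "t - b" "t - a"] ab(1) by simp
  show "AE y in M. y \<in> {t - b<..<t - a} \<longrightarrow> F (f (t - y)) (g (t - y)) \<noteq> F (f' (t - y)) (g' (t - y))"
  proof (rule AE_I2, rule impI)
    fix y assume "y \<in> {t - b<..<t - a}"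
    then show "F (f (t - y)) (g (t - y)) \<noteq> F (f' (t - y)) (g' (t - y))"
      using ab(2)[of "t - y"] by force
  qed
  show "AE y in M. F (f (t - y)) (g (t - y)) \<le> F (f' (t - y)) (g' (t - y))"
    using fr le by (auto intro!: AE_I2 reaction_mono[OF F] simp: front_nonneg front_le_1)
qed auto

lemma step_limit:
  assumes F: "reaction F" and fn: "\<And>n. front (fn n)" "\<And>n. front (gn n)" and f: "front f" "front g"
    and lim: "\<And>x. isCont f x \<Longrightarrow> (\<lambda>n. fn n x) \<longlonglongrightarrow> f x"
      "\<And>x. isCont g x \<Longrightarrow> (\<lambda>n. gn n x) \<longlonglongrightarrow> g x"
    and x: "xn \<longlonglongrightarrow> x"
  shows "(\<lambda>n. step M F (fn n) (gn n) (xn n)) \<longlonglongrightarrow> step M F f g x"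
  unfolding step_def by (rule conv_limit[OF F fn f lim x])

text \<open>A Helly limit is determined only at its continuity points; the countably many other
  points are invisible to an atomless kernel. This allows a limit to be replaced by a better
  representative.\<close>

lemma step_cong_isCont:
  assumes F: "reaction F" and fr: "front f" "front g" "front f'" "front g'"
    and eq: "\<And>x. isCont f x \<Longrightarrow> f' x = f x" "\<And>x. isCont g x \<Longrightarrow> g' x = g x"
  shows "step M F f' g' t = step M F f g t"
  unfolding step_def conv_def
proof (rule integral_cong_AE)
  show "(\<lambda>y. F (f' (t - y)) (g' (t - y))) \<in> borel_measurable M" "(\<lambda>y. F (f (t - y)) (g (t - y))) \<in> borel_measurable M"
    using borel_measurable_integrable[OF front_integrable[OF front_reaction[OF F fr(1,2)]]]
      borel_measurable_integrable[OF front_integrable[OF front_reaction[OF F fr(3,4)]]] by auto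
  show "AE y in M. F (f' (t - y)) (g' (t - y)) = F (f (t - y)) (g (t - y))"
    using AE_isCont[OF front_mono[OF fr(1)], of t] AE_isCont[OF front_mono[OF fr(2)], of t]
    by eventually_elim (simp add: eq)
qed

end

definition window_ext :: "real \<Rightarrow> (real \<Rightarrow> real) \<Rightarrow> real \<Rightarrow> real" where
  "window_ext k h t = (if t < - k then 0 else if t < k then h t else 1)"

lemma front_window_ext: "front h \<Longrightarrow> front (window_ext k h)"
  by (auto simp: front_def window_ext_def mono_def)

lemma window_ext_mono: "(\<And>t. h t \<le> h' t) \<Longrightarrow> window_ext k h t \<le> window_ext k h' t"
  by (auto simp: window_ext_def)

lemma gap_persists_under_shift:
  fixes u v :: "real \<Rightarrow> real"
  assumes u: "\<And>x. isCont u x" and v: "\<And>x. isCont v x" and lt: "\<And>s. v s < u s"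
  obtains e where "0 < e" "\<And>d s. \<lbrakk>0 \<le> d; d \<le> e; a \<le> s; s \<le> b\<rbrakk> \<Longrightarrow> v s \<le> u (s - d)"
proof (cases "a \<le> b")
  case False
  then show thesis using that[of 1] by auto
next
  case True
  have "continuous_on {a..b} (\<lambda>s. u s - v s)"
    using u v by (intro continuous_intros continuous_at_imp_continuous_on) auto
  then obtain m where m: "m \<in> {a..b}" "\<And>s. s \<in> {a..b} \<Longrightarrow> u m - v m \<le> u s - v s"
    using continuous_attains_inf[of "{a..b}" "\<lambda>s. u s - v s"] True by auto
  have "continuous_on {a - 1..b} u" using u by (intro continuous_at_imp_continuous_on) auto
  then have "uniformly_continuous_on {a - 1..b} u" by (intro compact_uniformly_continuous) auto
  then obtain e where e: "0 < e"
    "\<And>s s'. \<lbrakk>s \<in> {a - 1..b}; s' \<in> {a - 1..b}; dist s' s < e\<rbrakk> \<Longrightarrow> dist (u s') (u s) < u m - v m"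
    using lt[of m] unfolding uniformly_continuous_on_def by (metis diff_gt_0_iff_gt)
  show thesis
  \<comment> \<open>The cap 1 keeps \<open>s - d\<close> inside \<open>{a - 1..b}\<close>, where
    \<open>u\<close> is uniformly continuous; the half keeps \<open>d\<close> strictly below
    \<open>e\<close>. The modulus was taken for the minimal gap \<open>u m - v m\<close> on
    \<open>{a..b}\<close>.\<close>
  proof (rule that[of "min 1 (e / 2)"])
    fix d s assume d: "0 \<le> d" "d \<le> min 1 (e / 2)" "a \<le> s" "s \<le> b"
    have "dist (u (s - d)) (u s) < u m - v m"
      using d e(1) by (intro e(2)) (auto simp: dist_real_def)
    with m(2)[of s] d show "v s \<le> u (s - d)" by (auto simp: dist_real_def)
  qed (use e in auto)
qed

locale coupled = A: diffuse M1 + B: diffuse M2 for M1 M2 +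
  fixes F1 F2 :: "real \<Rightarrow> real \<Rightarrow> real"
  assumes F1: "reaction F1" and F2: "reaction F2"
begin

definition window :: "real \<Rightarrow> real \<Rightarrow> (real \<Rightarrow> real) \<Rightarrow> (real \<Rightarrow> real) \<Rightarrow> bool" where
  "window k c f g \<longleftrightarrow> front f \<and> front g \<and>
     f = window_ext k (\<lambda>t. step M1 F1 f g (t - c)) \<and> g = window_ext k (\<lambda>t. step M2 F2 f g (t - c))"

lemma window_front: "window k c f g \<Longrightarrow> front f" "window k c f g \<Longrightarrow> front g"
  by (auto simp: window_def)

lemma window_eq:
  assumes "window k c f g"
  shows "f t = (if t < - k then 0 else if t < k then step M1 F1 f g (t - c) else 1)"
    "g t = (if t < - k then 0 else if t < k then step M2 F2 f g (t - c) else 1)"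
proof -
  have "f = window_ext k (\<lambda>t. step M1 F1 f g (t - c))" "g = window_ext k (\<lambda>t. step M2 F2 f g (t - c))"
    using assms by (auto simp: window_def)
  then show "f t = (if t < - k then 0 else if t < k then step M1 F1 f g (t - c) else 1)"
    "g t = (if t < - k then 0 else if t < k then step M2 F2 f g (t - c) else 1)"
    unfolding window_ext_def by metis+
qed

text \<open>The prescribed values err in one direction each: 1 on the right is never below the
  operator, 0 on the left never above it. Hence each inequality fails at most beyond one
  edge.\<close>

lemma window_super_sub:
  assumes w: "window k c f g"
  shows "- k < t \<Longrightarrow> step M1 F1 f g (t - c) \<le> f t" "- k < t \<Longrightarrow> step M2 F2 f g (t - c) \<le> g t"
    "t < k \<Longrightarrow> f t \<le> step M1 F1 f g (t - c)" "t < k \<Longrightarrow> g t \<le> step M2 F2 f g (t - c)"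
  using window_eq[OF w, of t]
    front_nonneg[OF A.front_step[OF F1 window_front[OF w]], of "t - c"] front_le_1[OF A.front_step[OF F1 window_front[OF w]], of "t - c"]
    front_nonneg[OF B.front_step[OF F2 window_front[OF w]], of "t - c"] front_le_1[OF B.front_step[OF F2 window_front[OF w]], of "t - c"]
  by auto

text \<open>Monotone iteration from the least front with the prescribed outer values. The iterates
  increase, and their pointwise limit solves the equation by \<open>step_limit\<close>.\<close>

lemma window_exists: "\<exists>f g. window k c f g"
proof -
  define T where "T = (\<lambda>(f, g). (window_ext k (\<lambda>t. step M1 F1 f g (t - c)), window_ext k (\<lambda>t. step M2 F2 f g (t - c))))"
  define z where "z n = (T ^^ n) (window_ext k (\<lambda>_. 0), window_ext k (\<lambda>_. 0))" for n
  define f where "f n = fst (z n)" for n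
  define g where "g n = snd (z n)" for n
  have f_Suc: "f (Suc n) = window_ext k (\<lambda>t. step M1 F1 (f n) (g n) (t - c))"
    and g_Suc: "g (Suc n) = window_ext k (\<lambda>t. step M2 F2 (f n) (g n) (t - c))" for n
    by (auto simp: f_def g_def z_def T_def split_beta)
  have f0: "f 0 = window_ext k (\<lambda>_. 0)" "g 0 = window_ext k (\<lambda>_. 0)" by (auto simp: f_def g_def z_def)
  have fr: "front (f n) \<and> front (g n)" for n
  proof (induction n)
    case 0
    then show ?case unfolding f0 by (intro conjI front_window_ext) (auto simp: front_def mono_def)
  next
    case (Suc n)
    then have "front (\<lambda>t. step M1 F1 (f n) (g n) (t + - c))" "front (\<lambda>t. step M2 F2 (f n) (g n) (t + - c))"
      by (intro front_shift A.front_step B.front_step F1 F2; simp)+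
    then show ?case unfolding f_Suc g_Suc by (simp add: front_window_ext)
  qed
  have inc: "\<forall>t. f n t \<le> f (Suc n) t \<and> g n t \<le> g (Suc n) t" for n
  proof (induction n)
    case 0
    show ?case unfolding f_Suc g_Suc
      using front_nonneg[OF A.front_step[OF F1, of "f 0" "g 0"]] front_nonneg[OF B.front_step[OF F2, of "f 0" "g 0"]] fr[of 0]
      by (auto simp: f0 intro!: window_ext_mono)
  next
    case (Suc n)
    have "window_ext k (\<lambda>t. step M1 F1 (f n) (g n) (t - c)) t \<le> window_ext k (\<lambda>t. step M1 F1 (f (Suc n)) (g (Suc n)) (t - c)) t"
      "window_ext k (\<lambda>t. step M2 F2 (f n) (g n) (t - c)) t \<le> window_ext k (\<lambda>t. step M2 F2 (f (Suc n)) (g (Suc n)) (t - c)) t" for t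
      using Suc fr by (auto intro!: window_ext_mono A.step_mono B.step_mono F1 F2)
    then show ?case unfolding f_Suc[symmetric] g_Suc[symmetric] by blast
  qed
  have "convergent (\<lambda>n. f n t)" for t
    using fr inc by (intro Bseq_mono_convergent BseqI'[of _ 1]) (auto simp: front_nonneg front_le_1 intro: lift_Suc_mono_le[of "\<lambda>n. f n t"])
  then obtain f' where f': "\<And>t. (\<lambda>n. f n t) \<longlonglongrightarrow> f' t" unfolding convergent_def by metis
  have "convergent (\<lambda>n. g n t)" for t
    using fr inc by (intro Bseq_mono_convergent BseqI'[of _ 1]) (auto simp: front_nonneg front_le_1 intro: lift_Suc_mono_le[of "\<lambda>n. g n t"])
  then obtain g' where g': "\<And>t. (\<lambda>n. g n t) \<longlonglongrightarrow> g' t" unfolding convergent_def by metis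
  have front': "front f'" "front g'"
    by (rule front_LIMSEQ[OF conjunct1[OF fr] f'], rule front_LIMSEQ[OF conjunct2[OF fr] g'])
  have "f' t = window_ext k (\<lambda>t. step M1 F1 f' g' (t - c)) t" for t
  proof (rule LIMSEQ_unique)
    show "(\<lambda>n. f (Suc n) t) \<longlonglongrightarrow> f' t" using f' by (rule LIMSEQ_Suc)
    show "(\<lambda>n. f (Suc n) t) \<longlonglongrightarrow> window_ext k (\<lambda>t. step M1 F1 f' g' (t - c)) t"
      unfolding f_Suc window_ext_def using fr front' f' g' by (auto intro!: A.step_limit F1)
  qed
  moreover have "g' t = window_ext k (\<lambda>t. step M2 F2 f' g' (t - c)) t" for t
  proof (rule LIMSEQ_unique)
    show "(\<lambda>n. g (Suc n) t) \<longlonglongrightarrow> g' t" using g' by (rule LIMSEQ_Suc)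
    show "(\<lambda>n. g (Suc n) t) \<longlonglongrightarrow> window_ext k (\<lambda>t. step M2 F2 f' g' (t - c)) t"
      unfolding g_Suc window_ext_def using fr front' f' g' by (auto intro!: B.step_limit F2)
  qed
  ultimately show ?thesis unfolding window_def using front' by blast
qed

text \<open>Slide the solution for the smaller speed to the left until it dominates the other one, then slide it
  back: a first contact would have to occur inside the bounded window, where full support of the
  kernels makes the inequality strict.\<close>

lemma window_comparison:
  assumes x: "window k c x1 x2" and y: "window k c' y1 y2" and c: "c \<le> c'" and k: "0 < k"
    and supp1: "\<And>a b. a < b \<Longrightarrow> 0 < emeasure M1 {a<..<b}"
    and supp2: "\<And>a b. a < b \<Longrightarrow> 0 < emeasure M2 {a<..<b}"
  shows "y1 t \<le> x1 t \<and> y2 t \<le> x2 t"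
proof -
  note xe = window_eq[OF x] and ye = window_eq[OF y]
  note xf = window_front[OF x] and yf = window_front[OF y]
  define P where "P h \<longleftrightarrow> (\<forall>t. y1 t \<le> x1 (t + h) \<and> y2 t \<le> x2 (t + h))" for h
  define S where "S = {h. 0 \<le> h \<and> P h}"
  \<comment> \<open>After a shift by the full width of the window, \<open>x1\<close> and
    \<open>x2\<close> have already reached 1 wherever \<open>y1\<close> or \<open>y2\<close> can be
    nonzero.\<close>
  have "P h" if "h \<ge> 2 * k" for h
    unfolding P_def
  proof
    fix t
    show "y1 t \<le> x1 (t + h) \<and> y2 t \<le> x2 (t + h)"
    proof (cases "t < - k")
      case True
      then show ?thesis using ye[of t] xf by (simp add: front_nonneg)
    next
      case False
      then show ?thesis using xe[of "t + h"] that yf k by (simp add: front_le_1)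
    qed
  qed
  then have ne: "S \<noteq> {}" unfolding S_def by (auto intro!: exI[of _ "max 0 (2 * k)"])
  have bdd: "bdd_below S" unfolding S_def by (auto intro!: bdd_belowI)
  define h where "h = Inf S"
  have h0: "0 \<le> h" unfolding h_def using ne by (intro cInf_greatest) (auto simp: S_def)
  have up: "P h'" if lt: "h < h'" for h'
  proof -
    obtain h'' where "h'' \<in> S" "h'' < h'" using cInf_lessD[OF ne lt[unfolded h_def]] by blast
    then show ?thesis
      using front_monoD[OF xf(1), of "_ + h''" "_ + h'"] front_monoD[OF xf(2), of "_ + h''" "_ + h'"]
      unfolding S_def P_def by (auto intro: order_trans)
  qed
  have Ph: "P h"
    unfolding P_def
  proof
    fix t
    consider "t < - k" | "k \<le> t + h" | "- k \<le> t + h" "t + h < k" using h0 by linarith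
    then show "y1 t \<le> x1 (t + h) \<and> y2 t \<le> x2 (t + h)"
    proof cases
      case 1
      then show ?thesis using ye[of t] xf by (simp add: front_nonneg)
    next
      case 2
      then show ?thesis using xe[of "t + h"] yf h0 k by (simp add: front_le_1)
    next
      case 3
      \<comment> \<open>Passing to the infimum uses right limits of \<open>step\<close>, which is
        continuous, instead of \<open>x1\<close> and \<open>x2\<close> themselves, which may jump at
        the edges.\<close>
      have ev: "\<forall>\<^sub>F h' in at_right h. y1 t \<le> step M1 F1 x1 x2 (t + h' - c) \<and> y2 t \<le> step M2 F2 x1 x2 (t + h' - c)"
      proof (rule eventually_at_rightI[of h "k - t"])
        fix h' assume h': "h' \<in> {h<..<k - t}"
        then have "P h'" using up by auto
        moreover have "x1 (t + h') = step M1 F1 x1 x2 (t + h' - c)" "x2 (t + h') = step M2 F2 x1 x2 (t + h' - c)"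
          using xe[of "t + h'"] 3 h' by auto
        ultimately show "y1 t \<le> step M1 F1 x1 x2 (t + h' - c) \<and> y2 t \<le> step M2 F2 x1 x2 (t + h' - c)"
          unfolding P_def by metis
      qed (use 3 in auto)
      have "((\<lambda>h'. step M1 F1 x1 x2 (t + h' - c)) \<longlongrightarrow> step M1 F1 x1 x2 (t + h - c)) (at_right h)"
        by (intro isCont_tendsto_compose[OF A.step_isCont[OF F1 xf]] tendsto_intros)
      from tendsto_lowerbound[OF this eventually_mono[OF ev]]
      have "y1 t \<le> step M1 F1 x1 x2 (t + h - c)" by simp
      moreover have "((\<lambda>h'. step M2 F2 x1 x2 (t + h' - c)) \<longlongrightarrow> step M2 F2 x1 x2 (t + h - c)) (at_right h)"
        by (intro isCont_tendsto_compose[OF B.step_isCont[OF F2 xf]] tendsto_intros)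
      from tendsto_lowerbound[OF this eventually_mono[OF ev]]
      have "y2 t \<le> step M2 F2 x1 x2 (t + h - c)" by simp
      ultimately show ?thesis using xe[of "t + h"] 3 by simp
    qed
  qed
  have "h = 0"
  proof (rule ccontr)
    assume "h \<noteq> 0"
    then have hpos: "0 < h" using h0 by simp
    define b1 where "b1 t = x1 (t + h)" for t
    define b2 where "b2 t = x2 (t + h)" for t
    have bf: "front b1" "front b2" unfolding b1_def b2_def using xf by (auto intro: front_shift)
    have yb: "y1 t \<le> b1 t" "y2 t \<le> b2 t" for t using Ph by (auto simp: P_def b1_def b2_def)
    have one: "F1 0 0 = 0" "F1 1 1 = 1" "F2 0 0 = 0" "F2 1 1 = 1" using F1 F2 by (auto simp: reaction_def)
    have fz: "front (\<lambda>_. 0)" by (auto simp: front_def mono_def)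
    have ge_k: "x1 s = 1 \<and> x2 s = 1" if "s \<ge> max k (-k)" for s using xe[of s] that k by auto
    have spos: "0 < step M1 F1 x1 x2 s" "0 < step M2 F2 x1 x2 s" for s
      using A.step_strict[OF F1 fz fz xf _ _ supp1, of "max k (-k)" "max k (-k) + 1" s] B.step_strict[OF F2 fz fz xf _ _ supp2, of "max k (-k)" "max k (-k) + 1" s]
        A.step_zero[OF F1] B.step_zero[OF F2] xf one ge_k
      by (auto simp: front_nonneg)
    have xpos: "0 < x1 s \<and> 0 < x2 s" if "- k \<le> s" for s using xe[of s] spos that by auto
    \<comment> \<open>On the interval of length \<open>h\<close> just left of the window,
      \<open>y1\<close> and \<open>y2\<close> vanish by prescription while the shifted solution is
      positive. Full support spreads this gap to all points.\<close>
    have gap: "y1 s = 0 \<and> y2 s = 0 \<and> 0 < b1 s \<and> 0 < b2 s" if "- k - h < s" "s < - k" for s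
      using ye[of s] xpos[of "s + h"] that by (auto simp: b1_def b2_def)
    have gapF: "F1 (y1 s) (y2 s) < F1 (b1 s) (b2 s)" "F2 (y1 s) (y2 s) < F2 (b1 s) (b2 s)" if "- k - h < s" "s < - k" for s
      using gap[OF that] one F1 F2 front_le_1[OF bf(1), of s] front_le_1[OF bf(2), of s]
      by (auto simp: reaction_def)
    have st1: "step M1 F1 y1 y2 s < step M1 F1 b1 b2 s" for s
      using hpos by (intro A.step_strict[OF F1 yf bf yb supp1, of "- k - h" "- k"] gapF) auto
    have st2: "step M2 F2 y1 y2 s < step M2 F2 b1 b2 s" for s
      using hpos by (intro B.step_strict[OF F2 yf bf yb supp2, of "- k - h" "- k"] gapF) auto
    obtain e1 where e1: "0 < e1" "\<And>d s. \<lbrakk>0 \<le> d; d \<le> e1; - k - c' \<le> s; s \<le> k - c'\<rbrakk> \<Longrightarrow> step M1 F1 y1 y2 s \<le> step M1 F1 b1 b2 (s - d)"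
      by (rule gap_persists_under_shift[OF A.step_isCont[OF F1 bf] A.step_isCont[OF F1 yf] st1, of "- k - c'" "k - c'"]) blast
    obtain e2 where e2: "0 < e2" "\<And>d s. \<lbrakk>0 \<le> d; d \<le> e2; - k - c' \<le> s; s \<le> k - c'\<rbrakk> \<Longrightarrow> step M2 F2 y1 y2 s \<le> step M2 F2 b1 b2 (s - d)"
      by (rule gap_persists_under_shift[OF B.step_isCont[OF F2 bf] B.step_isCont[OF F2 yf] st2, of "- k - c'" "k - c'"]) blast
    \<comment> \<open>A shift back by \<open>d\<close> is absorbed by both gaps; the bound by
      \<open>h\<close> keeps \<open>h - d\<close> nonnegative, hence in \<open>S\<close>.\<close>
    define d where "d = min (min e1 e2) h"
    have d: "0 < d" "d \<le> e1" "d \<le> e2" "d \<le> h" using e1 e2 hpos by (auto simp: d_def)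
    have stepb: "step M1 F1 b1 b2 s = step M1 F1 x1 x2 (s + h)" "step M2 F2 b1 b2 s = step M2 F2 x1 x2 (s + h)" for s
      unfolding step_def conv_def b1_def b2_def by (simp_all add: algebra_simps)
    have "P (h - d)"
      unfolding P_def
    proof
      fix t
      consider "t < - k" | "\<not> t < - k" "k \<le> t + (h - d)" | "- k \<le> t" "t + (h - d) < k" by linarith
      then show "y1 t \<le> x1 (t + (h - d)) \<and> y2 t \<le> x2 (t + (h - d))"
      proof cases
        case 1
        then show ?thesis using ye[of t] xf by (simp add: front_nonneg)
      next
        case 2
        then show ?thesis using xe[of "t + (h - d)"] yf d k by (simp add: front_le_1)
      next
        case 3
        have "step M1 F1 y1 y2 (t - c') \<le> step M1 F1 b1 b2 (t - c' - d)"
          using 3 d by (intro e1) auto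
        \<comment> \<open>The order \<open>c \<le> c'\<close> of the speeds enters here, through
          monotonicity of \<open>step\<close> in its argument.\<close>
        also have "\<dots> \<le> step M1 F1 x1 x2 (t + (h - d) - c)"
          unfolding stepb using c by (intro front_monoD[OF A.front_step[OF F1 xf]]) simp
        finally have 1: "step M1 F1 y1 y2 (t - c') \<le> step M1 F1 x1 x2 (t + (h - d) - c)" .
        have "step M2 F2 y1 y2 (t - c') \<le> step M2 F2 b1 b2 (t - c' - d)"
          using 3 d by (intro e2) auto
        also have "\<dots> \<le> step M2 F2 x1 x2 (t + (h - d) - c)"
          unfolding stepb using c by (intro front_monoD[OF B.front_step[OF F2 xf]]) simp
        finally show ?thesis using 1 3 d xe[of "t + (h - d)"] ye[of t] by simp
      qed
    qed
    then have "h - d \<in> S" using d by (auto simp: S_def)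
    then have "h \<le> h - d" unfolding h_def using bdd by (rule cInf_lower)
    then show False using d by simp
  qed
  then show ?thesis using Ph by (simp add: P_def)
qed

text \<open>The Helly limits \<open>f'\<close> and \<open>g'\<close> need not satisfy the equation
  at their jumps. Applying the window operator to them once gives \<open>f\<close> and
  \<open>g\<close>, to which the sequences converge at every point; these agree with
  \<open>f'\<close> and \<open>g'\<close> wherever the latter are continuous, so the operator takes
  the same value on both pairs.\<close>

lemma window_sequential_limit:
  assumes w: "\<And>n. window k (cn n) (fn n) (gn n)" and c: "cn \<longlonglongrightarrow> c"
  obtains s f g where "strict_mono (s::nat\<Rightarrow>nat)" "window k c f g"
    "\<And>t. (\<lambda>n. fn (s n) t) \<longlonglongrightarrow> f t" "\<And>t. (\<lambda>n. gn (s n) t) \<longlonglongrightarrow> g t"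
proof -
  note wf = window_front[OF w]
  obtain s f' g' where s: "strict_mono (s::nat\<Rightarrow>nat)" and f': "front f'" "front g'"
    and lim: "\<And>x. isCont f' x \<Longrightarrow> (\<lambda>n. fn (s n) x) \<longlonglongrightarrow> f' x"
      "\<And>x. isCont g' x \<Longrightarrow> (\<lambda>n. gn (s n) x) \<longlonglongrightarrow> g' x"
    by (rule Helly_selection_front_pair[of fn gn, OF wf]) (rule that)
  define f where "f = window_ext k (\<lambda>t. step M1 F1 f' g' (t - c))"
  define g where "g = window_ext k (\<lambda>t. step M2 F2 f' g' (t - c))"
  have cs: "(\<lambda>n. t - cn (s n)) \<longlonglongrightarrow> t - c" for t
    by (intro tendsto_intros LIMSEQ_subseq_LIMSEQ[OF c s, unfolded o_def])
  have fl: "(\<lambda>n. fn (s n) t) \<longlonglongrightarrow> f t" for t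
  proof -
    have "fn (s n) t = window_ext k (\<lambda>t. step M1 F1 (fn (s n)) (gn (s n)) (t - cn (s n))) t" for n
      using w[of "s n"] by (auto simp: window_def)
    moreover have "(\<lambda>n. window_ext k (\<lambda>t. step M1 F1 (fn (s n)) (gn (s n)) (t - cn (s n))) t) \<longlonglongrightarrow> f t"
      unfolding f_def window_ext_def using A.step_limit[OF F1 wf(1) wf(2) f' lim cs] by simp
    ultimately show ?thesis by simp
  qed
  have gl: "(\<lambda>n. gn (s n) t) \<longlonglongrightarrow> g t" for t
  proof -
    have "gn (s n) t = window_ext k (\<lambda>t. step M2 F2 (fn (s n)) (gn (s n)) (t - cn (s n))) t" for n
      using w[of "s n"] by (auto simp: window_def)
    moreover have "(\<lambda>n. window_ext k (\<lambda>t. step M2 F2 (fn (s n)) (gn (s n)) (t - cn (s n))) t) \<longlonglongrightarrow> g t"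
      unfolding g_def window_ext_def using B.step_limit[OF F2 wf(1) wf(2) f' lim cs] by simp
    ultimately show ?thesis by simp
  qed
  have fr: "front f" "front g" unfolding f_def g_def
    using front_shift[OF A.front_step[OF F1 f'], of "-c"] front_shift[OF B.front_step[OF F2 f'], of "-c"]
    by (auto intro: front_window_ext)
  have eq: "f x = f' x" if "isCont f' x" for x
    using LIMSEQ_unique[OF fl lim(1)[OF that]] .
  have eq': "g x = g' x" if "isCont g' x" for x
    using LIMSEQ_unique[OF gl lim(2)[OF that]] .
  have "window k c f g"
    unfolding window_def
    using fr A.step_cong_isCont[OF F1 f' fr eq eq'] B.step_cong_isCont[OF F2 f' fr eq eq']
    by (simp add: f_def[symmetric] g_def[symmetric])
  then show thesis using that s fl gl by blast
qed

text \<open>The constant state \<open>(p, q)\<close> is propagated from the left edge in unit steps.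
  For \<open>y > - C\<close> and \<open>c \<ge> C + 1\<close> the point \<open>t - c - y\<close>
  lies left of \<open>t - 1\<close>, where the bound is already known; the remaining
  \<open>y\<close> contribute at most the tail mass, which the margin of \<open>(p, q)\<close>
  absorbs.\<close>

lemma window_upper_bound:
  assumes w: "window k c f g" and c: "C + 1 \<le> c" and p: "0 \<le> p" "p \<le> 1" and q: "0 \<le> q" "q \<le> 1"
    and F1p: "F1 p q + measure M1 {..- C} \<le> p" and F2q: "F2 p q + measure M2 {..- C} \<le> q"
    and t: "t < k"
  shows "f t \<le> p \<and> g t \<le> q"
proof -
  note e = window_eq[OF w] and fr = window_front[OF w]
  have "\<forall>t. t < k \<and> t < - k + real n \<longrightarrow> f t \<le> p \<and> g t \<le> q" for n
  proof (induction n)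
    case 0
    then show ?case using e p q by simp
  next
    case (Suc n)
    have gen: "step M F f g (t - c) \<le> F p q + measure M {..- C}"
      if D: "diffuse M" and F: "reaction F" and t: "t < k" "t < - k + real (Suc n)" for M F t
    proof -
      interpret D: diffuse M by fact
      have "F (f (t - c - y)) (g (t - c - y)) \<le> F p q + indicator {..- C} y" for y
      proof (cases "y \<le> - C")
        case True
        then show ?thesis
          using front_le_1[OF front_reaction[OF F fr]] reaction_mono[OF F, of 0 p 0 q] F p q
          by (auto simp: reaction_def add_increasing)
      next
        case False
        then have "t - c - y < k" "t - c - y < - k + real n" using t c by auto
        then have "f (t - c - y) \<le> p" "g (t - c - y) \<le> q" using Suc by auto
        then show ?thesis using False p q fr by (auto intro!: reaction_mono[OF F] simp: front_nonneg)
      qed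
      then have "step M F f g (t - c) \<le> (\<integral>y. F p q + indicator {..- C} y \<partial>M)"
        unfolding step_def conv_def
        by (intro integral_mono D.front_integrable[OF front_reaction[OF F fr]]) (auto simp: D.emeasure_eq_measure)
      also have "\<dots> = F p q + measure M {..- C}"
        using D.prob_space by (subst Bochner_Integration.integral_add) (auto simp: D.emeasure_eq_measure)
      finally show ?thesis .
    qed
    show ?case
    proof (intro allI impI)
      fix t assume t: "t < k \<and> t < - k + real (Suc n)"
      show "f t \<le> p \<and> g t \<le> q"
        using gen[OF A.diffuse_axioms F1, of t] gen[OF B.diffuse_axioms F2, of t] t e[of t] F1p F2q p q by auto
    qed
  qed
  moreover obtain n where "t + k < real n" using reals_Archimedean2 by blast
  then have "t < k \<and> t < - k + real n" using t by simp
  ultimately show ?thesis by blast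
qed

text \<open>Mirror image of \<open>window_upper_bound\<close>: for \<open>y < C\<close> and
  \<open>c \<le> - C - 1\<close> the point \<open>t - c - y\<close> lies right of
  \<open>t + 1\<close>, so the bound moves leftwards from the edge \<open>k\<close> in unit
  steps.\<close>

lemma window_lower_bound:
  assumes w: "window k c f g" and c: "c \<le> - C - 1" and p: "0 \<le> p" "p \<le> 1" and q: "0 \<le> q" "q \<le> 1"
    and F1p: "p \<le> F1 p q - measure M1 {C..}" and F2q: "q \<le> F2 p q - measure M2 {C..}"
    and t: "- k \<le> t"
  shows "p \<le> f t \<and> q \<le> g t"
proof -
  note e = window_eq[OF w] and fr = window_front[OF w]
  have "\<forall>t. - k \<le> t \<and> k - real n \<le> t \<longrightarrow> p \<le> f t \<and> q \<le> g t" for n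
  proof (induction n)
    case 0
    then show ?case using e p q by simp
  next
    case (Suc n)
    have gen: "F p q - measure M {C..} \<le> step M F f g (t - c)"
      if D: "diffuse M" and F: "reaction F" and t: "- k \<le> t" "k - real (Suc n) \<le> t" for M F t
    proof -
      interpret D: diffuse M by fact
      have "F p q - indicator {C..} y \<le> F (f (t - c - y)) (g (t - c - y))" for y
      proof (cases "C \<le> y")
        case True
        then show ?thesis
          using front_nonneg[OF front_reaction[OF F fr], of "t - c - y"] reaction_mono[OF F, of p 1 q 1] F p q
          by (auto simp: reaction_def)
      next
        case False
        then have "- k \<le> t - c - y" "k - real n \<le> t - c - y" using t c by auto
        then have "p \<le> f (t - c - y)" "q \<le> g (t - c - y)" using Suc by auto
        then show ?thesis using False p q fr by (auto intro!: reaction_mono[OF F] simp: front_le_1)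
      qed
      then have "(\<integral>y. F p q - indicator {C..} y \<partial>M) \<le> step M F f g (t - c)"
        unfolding step_def conv_def
        by (intro integral_mono D.front_integrable[OF front_reaction[OF F fr]]) (auto simp: D.emeasure_eq_measure)
      moreover have "(\<integral>y. F p q - indicator {C..} y \<partial>M) = F p q - measure M {C..}"
        using D.prob_space by (subst Bochner_Integration.integral_diff) (auto simp: D.emeasure_eq_measure)
      ultimately show ?thesis by simp
    qed
    show ?case
    proof (intro allI impI)
      fix t assume t: "- k \<le> t \<and> k - real (Suc n) \<le> t"
      show "p \<le> f t \<and> q \<le> g t"
        using gen[OF A.diffuse_axioms F1, of t] gen[OF B.diffuse_axioms F2, of t] t e[of t] F1p F2q p q by auto
    qed
  qed
  moreover obtain n where "k - t < real n" using reals_Archimedean2 by blast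
  then have "- k \<le> t \<and> k - real n \<le> t" using t by simp
  ultimately show ?thesis by blast
qed

text \<open>An intermediate value argument in the speed. Continuity of the value at 0 comes from
  compactness and uniqueness: a limit of window solutions solves the window problem for the limit
  speed, and \<open>window_comparison\<close> used in both directions identifies it.\<close>

lemma window_with_level:
  assumes k: "0 < k"
    and supp1: "\<And>a b. a < b \<Longrightarrow> 0 < emeasure M1 {a<..<b}"
    and supp2: "\<And>a b. a < b \<Longrightarrow> 0 < emeasure M2 {a<..<b}"
    and p: "0 \<le> p" "p \<le> 1" "0 \<le> q" "q \<le> 1"
      "F1 p q + measure M1 {..- C} \<le> p" "F2 p q + measure M2 {..- C} \<le> q" "p + q < \<theta>"
    and p': "0 \<le> p'" "p' \<le> 1" "0 \<le> q'" "q' \<le> 1"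
      "p' \<le> F1 p' q' - measure M1 {C..}" "q' \<le> F2 p' q' - measure M2 {C..}" "\<theta> < p' + q'"
  obtains c f g where "window k c f g" "f 0 + g 0 = \<theta>" "\<bar>c\<bar> \<le> \<bar>C\<bar> + 1"
proof -
  obtain f g where w: "\<And>c. window k c (f c) (g c)" using window_exists by metis
  define v where "v c = f c 0 + g c 0" for c
  have anti: "v c' \<le> v c" if "c \<le> c'" for c c'
    using window_comparison[OF w w that k supp1 supp2, of 0] by (simp add: v_def add_mono)
  have hi: "v c < \<theta>" if "C + 1 \<le> c" for c
    using window_upper_bound[OF w that p(1-6), of 0] k p(7) by (simp add: v_def)
  have lo: "\<theta> < v c" if "c \<le> - C - 1" for c
    using window_lower_bound[OF w that p'(1-6), of 0] k p'(7) by (simp add: v_def)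
  have seq: "\<exists>s. (\<lambda>n. v (cn (s n))) \<longlonglongrightarrow> v c" if cn: "cn \<longlonglongrightarrow> c" for cn c
  proof -
    obtain s f' g' where s: "strict_mono (s::nat\<Rightarrow>nat)" "window k c f' g'"
      "\<And>t. (\<lambda>n. f (cn (s n)) t) \<longlonglongrightarrow> f' t" "\<And>t. (\<lambda>n. g (cn (s n)) t) \<longlonglongrightarrow> g' t"
      by (rule window_sequential_limit[of k cn "\<lambda>n. f (cn n)" "\<lambda>n. g (cn n)", OF w cn]) (rule that)
    have "f' 0 = f c 0" "g' 0 = g c 0"
      using window_comparison[OF s(2) w order_refl k supp1 supp2, of 0]
        window_comparison[OF w s(2) order_refl k supp1 supp2, of 0] by auto
    then show ?thesis using tendsto_add[OF s(3)[of 0] s(4)[of 0]] by (auto simp: v_def)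
  qed
  \<comment> \<open>At the supremum of \<open>S\<close> the value is exactly \<theta>: approach it
    from the left within \<open>S\<close> and from the right outside it. Convergence along some
    subsequence, as given by \<open>seq\<close>, suffices because the inequalities hold for every
    term.\<close>
  define S where "S = {c. \<theta> \<le> v c}"
  have ne: "S \<noteq> {}" using lo[of "- C - 1"] by (auto simp: S_def intro: less_imp_le)
  have ub: "c < C + 1" if "c \<in> S" for c using that hi[of c] by (force simp: S_def)
  then have bdd: "bdd_above S" by (meson bdd_aboveI less_imp_le)
  define c where "c = Sup S"
  have "c \<le> C + 1" unfolding c_def using ne ub by (intro cSup_least) (auto intro: less_imp_le)
  moreover have "- C - 1 \<le> c" unfolding c_def using lo[of "- C - 1"] bdd by (intro cSup_upper) (auto simp: S_def)
  ultimately have "\<bar>c\<bar> \<le> \<bar>C\<bar> + 1" by linarith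
  have inv: "(\<lambda>n. 1 / real (Suc n)) \<longlonglongrightarrow> 0" by (rule lim_1_over_n[THEN LIMSEQ_Suc])
  have ge: "\<theta> \<le> v c"
  proof -
    have "(\<lambda>n. c - 1 / real (Suc n)) \<longlonglongrightarrow> c" using tendsto_diff[OF tendsto_const inv, of c] by simp
    then obtain s where s: "(\<lambda>n. v (c - 1 / real (Suc (s n)))) \<longlonglongrightarrow> v c" using seq by blast
    have "\<theta> \<le> v (c - 1 / real (Suc n))" for n
    proof -
      obtain c' where "c' \<in> S" "c - 1 / real (Suc n) < c'"
        using less_cSup_iff[OF ne bdd, of "c - 1 / real (Suc n)"] by (auto simp: c_def[symmetric])
      then show ?thesis using anti[of "c - 1 / real (Suc n)" c'] by (simp add: S_def)
    qed
    then show ?thesis by (intro LIMSEQ_le_const[OF s]) auto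
  qed
  have le: "v c \<le> \<theta>"
  proof -
    have "(\<lambda>n. c + 1 / real (Suc n)) \<longlonglongrightarrow> c" using tendsto_add[OF tendsto_const inv, of c] by simp
    then obtain s where s: "(\<lambda>n. v (c + 1 / real (Suc (s n)))) \<longlonglongrightarrow> v c" using seq by blast
    have "v (c + 1 / real (Suc n)) \<le> \<theta>" for n
    proof (rule ccontr)
      assume "\<not> ?thesis"
      then have "c + 1 / real (Suc n) \<in> S" by (simp add: S_def)
      then have "c + 1 / real (Suc n) \<le> c" unfolding c_def using bdd by (rule cSup_upper)
      moreover have "0 < 1 / real (Suc n)" by simp
      ultimately show False by linarith
    qed
    then show ?thesis by (intro LIMSEQ_le_const2[OF s]) auto
  qed
  show thesis using that[OF w[of c]] ge le \<open>\<bar>c\<bar> \<le> \<bar>C\<bar> + 1\<close> by (simp add: v_def)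
qed

end

section \<open>Supersolutions emanating from an unstable state\<close>

lemma front_integrable_Icc:
  assumes h: "front h" shows "integrable lborel (\<lambda>t. indicator {b..c} t * h t)"
proof (rule Bochner_Integration.integrable_bound[of _ "indicator {b..c} :: real \<Rightarrow> real"])
  have [measurable]: "h \<in> borel_measurable borel" by (rule front_measurable[OF h])
  show "(\<lambda>t. indicator {b..c} t * h t) \<in> borel_measurable lborel" by measurable
  show "integrable lborel (indicator {b..c} :: real \<Rightarrow> real)" by (simp add: emeasure_lborel_Icc_eq)
qed (auto simp: front_nonneg[OF h] front_le_1[OF h] indicator_def)

locale symmetric = diffuse +
  assumes sym: "\<And>f :: real \<Rightarrow> real. f \<in> borel_measurable borel \<Longrightarrow> (\<integral>y. f (- y) \<partial>M) = (\<integral>y. f y \<partial>M)"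

text \<open>The first moment is asked of the limit kernels, where the sign argument takes place; the
  smoothed kernels enter only as \<open>symmetric\<close>.\<close>

locale centered = symmetric +
  assumes moment: "integrable M (\<lambda>y. y)"
begin

lemma mean_zero: "(\<integral>y. y \<partial>M) = 0"
  using sym[of "\<lambda>y. y"] by simp

lemma moment_front:
  assumes h: "front h" shows "integrable M (\<lambda>y. y * h (a - y))"
proof (rule Bochner_Integration.integrable_bound[OF moment])
  have [measurable]: "h \<in> borel_measurable borel" by (rule front_measurable[OF h])
  show "(\<lambda>y. y * h (a - y)) \<in> borel_measurable M" by measurable
  show "AE y in M. norm (y * h (a - y)) \<le> norm y"
    by (auto simp: front_nonneg[OF h] front_le_1[OF h] abs_mult mult_left_le)
qed

text \<open>If no such \<open>d\<close> existed, symmetry would make the right half-line null too,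
  and the whole mass would sit at 0, which is not an atom.\<close>

lemma ex_left_mass: "\<exists>d>0. 0 < emeasure M {..<- d}"
proof (rule ccontr)
  assume neg: "\<not> ?thesis"
  have l: "emeasure M {..<- d} = 0" if "0 < d" for d using neg that by (auto simp: zero_less_iff_neq_zero)
  have r: "emeasure M {d<..} = 0" if "0 < d" for d
  proof -
    have "(\<integral>y. indicator {d<..} (- y) \<partial>M) = (\<integral>y. indicator {d<..} y \<partial>M :: real)"
      by (rule sym) simp
    moreover have "(\<lambda>y. indicator {d<..} (- y)) = (indicator {..<- d} :: real \<Rightarrow> real)"
      by (auto simp: indicator_def fun_eq_iff)
    ultimately have "measure M {d<..} = measure M {..<- d}" by simp
    then show ?thesis using l[OF that] by (simp add: emeasure_eq_measure)
  qed
  have "AE y in M. \<forall>n. y \<notin> {..<- (1 / real (Suc n))}" "AE y in M. \<forall>n. y \<notin> {1 / real (Suc n)<..}"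
    unfolding AE_all_countable by (intro allI AE_not_in null_setsI l r; simp)+
  moreover have "AE y in M. y \<noteq> 0" using AE_notin_countable[of "{0}"] by simp
  ultimately have "AE y in M. False"
  proof eventually_elim
    case (elim y)
    obtain n where "1 / real (Suc n) < \<bar>y\<bar>" using elim nat_approx_posE[of "\<bar>y\<bar>"] by auto
    then show ?case using elim(1,2) by (auto simp: abs_if not_less split: if_splits dest!: spec[of _ n])
  qed
  then show False using AE_False by simp
qed

text \<open>Tangent inequality for the convex primitive of \<open>h\<close>. Shifting by
  \<open>y \<ge> 0\<close> trades a piece of length \<open>y\<close> below \<open>T\<close>, where
  \<open>h\<close> is at most \<open>h T\<close>, for one below \<open>a\<close>, where it is at
  least \<open>h (a - y)\<close>; for \<open>y < 0\<close> the roles are exchanged. \<open>D\<close>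
  is the resulting pointwise bound.\<close>

lemma integral_shift_front_ge:
  assumes h: "front h" and aT: "a \<le> T"
  shows "(\<integral>t. indicator {a..T} t * h t \<partial>lborel) - y * h T + y * h (a - y)
    \<le> (\<integral>t. indicator {a..T} t * h (t - y) \<partial>lborel)"
proof -
  note int = front_integrable_Icc[OF h]
  have "(\<integral>t. indicator {a..T} t * h (t - y) \<partial>lborel) = (\<integral>t. indicator {a - y..T - y} t * h t \<partial>lborel)"
    by (subst lborel_integral_real_affine[where c=1 and t=y]) (auto simp: indicator_def intro!: Bochner_Integration.integral_cong)
  moreover have "(\<integral>t. indicator {a..T} t * h t \<partial>lborel) - (\<integral>t. indicator {a - y..T - y} t * h t \<partial>lborel) \<le> y * h T - y * h (a - y)"
  proof -
    define D where "D t = (if y \<ge> 0 then indicator {T - y<..T} t * h T - indicator {a - y..<a} t * h (a - y)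
      else indicator {a..<a - y} t * h (a - y) - indicator {T<..T - y} t * h T)" for t
    have *: "(indicator {a..T} t - indicator {a - y..T - y} t) * h t \<le> D t" for t
    proof (cases "y \<ge> 0")
      case True
      have "h t \<le> h T" if "t \<le> T" using front_monoD[OF h that] .
      moreover have "h (a - y) \<le> h t" if "a - y \<le> t" using front_monoD[OF h that] .
      ultimately show ?thesis using True aT by (auto simp: D_def indicator_def)
    next
      case False
      have "h T \<le> h t" if "T < t" using front_monoD[OF h, of T t] that by simp
      moreover have "h t \<le> h (a - y)" if "t < a - y" using front_monoD[OF h, of t "a - y"] that by simp
      ultimately show ?thesis using False aT by (auto simp: D_def indicator_def)
    qed
    have "(\<integral>t. indicator {a..T} t * h t \<partial>lborel) - (\<integral>t. indicator {a - y..T - y} t * h t \<partial>lborel)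
      = (\<integral>t. (indicator {a..T} t - indicator {a - y..T - y} t) * h t \<partial>lborel)"
      using int[of a T] int[of "a - y" "T - y"] by (simp add: left_diff_distrib)
    also have "\<dots> \<le> (\<integral>t. D t \<partial>lborel)"
    proof (rule integral_mono[OF _ _ *])
      show "integrable lborel (\<lambda>t. (indicator {a..T} t - indicator {a - y..T - y} t) * h t)"
        using int[of a T] int[of "a - y" "T - y"] by (simp add: left_diff_distrib)
      show "integrable lborel D" unfolding D_def by (cases "y \<ge> 0") auto
    qed
    also have "\<dots> = y * h T - y * h (a - y)"
      unfolding D_def by (cases "y \<ge> 0") auto
    finally show ?thesis .
  qed
  ultimately show ?thesis by simp
qed

text \<open>Jensen's inequality for the convex primitive of \<open>h\<close>: since \<open>M\<close> has mean zero, averaging can only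
  increase the integral up to the right end point \<open>T\<close>.\<close>

lemma conv_average:
  assumes h: "front h" and aT: "a \<le> T"
  shows "(\<integral>t. indicator {a..T} t * h t \<partial>lborel) + (\<integral>y. y * h (a - y) \<partial>M)
    \<le> (\<integral>t. indicator {a..T} t * conv M h t \<partial>lborel)"
proof -
  interpret P: pair_sigma_finite lborel M ..
  have sM: "sets (lborel \<Otimes>\<^sub>M M) = sets (borel \<Otimes>\<^sub>M borel)"
    by (rule sets_pair_measure_cong) auto
  have hm [measurable]: "h \<in> borel_measurable borel" by (rule front_measurable[OF h])
  have int: "integrable (lborel \<Otimes>\<^sub>M M) (\<lambda>(t, y). indicator {a..T} t * h (t - y))"
  proof (rule Bochner_Integration.integrable_bound)
    have "emeasure (lborel \<Otimes>\<^sub>M M) ({a..T} \<times> UNIV) = ennreal (T - a)"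
      using emeasure_pair_measure_Times[of "{a..T}" lborel UNIV] aT emeasure_space_1 by simp
    moreover have "{a..T} \<times> UNIV \<in> sets (lborel \<Otimes>\<^sub>M M)" by (intro pair_measureI) auto
    ultimately show "integrable (lborel \<Otimes>\<^sub>M M) (indicator ({a..T} \<times> UNIV) :: _ \<Rightarrow> real)"
      by simp
    show "(\<lambda>(t, y). indicator {a..T} t * h (t - y)) \<in> borel_measurable (lborel \<Otimes>\<^sub>M M)"
      unfolding measurable_cong_sets[OF sM refl] by measurable
    show "AE x in lborel \<Otimes>\<^sub>M M. norm (case x of (t, y) \<Rightarrow> indicator {a..T} t * h (t - y))
         \<le> norm (indicator ({a..T} \<times> UNIV) x :: real)"
      by (auto simp: indicator_def front_nonneg[OF h] front_le_1[OF h])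
  qed
  \<comment> \<open>The tangent term \<open>y * h T\<close> disappears under the integral because
    \<open>M\<close> has mean zero; only the term at the left end \<open>a\<close> is left.\<close>
  have "(\<integral>t. indicator {a..T} t * h t \<partial>lborel) + (\<integral>y. y * h (a - y) \<partial>M)
    = (\<integral>y. (\<integral>t. indicator {a..T} t * h t \<partial>lborel) - y * h T + y * h (a - y) \<partial>M)"
    using moment moment_front[OF h] mean_zero prob_space by simp
  also have "\<dots> \<le> (\<integral>y. (\<integral>t. indicator {a..T} t * h (t - y) \<partial>lborel) \<partial>M)"
  proof (rule integral_mono)
    show "integrable M (\<lambda>y. (\<integral>t. indicator {a..T} t * h t \<partial>lborel) - y * h T + y * h (a - y))"
      using moment moment_front[OF h] by simp
    show "integrable M (\<lambda>y. \<integral>t. indicator {a..T} t * h (t - y) \<partial>lborel)"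
      using P.integrable_snd[OF int] .
  qed (rule integral_shift_front_ge[OF h aT])
  also have "\<dots> = (\<integral>t. (\<integral>y. indicator {a..T} t * h (t - y) \<partial>M) \<partial>lborel)"
    by (rule P.Fubini_integral[OF int])
  finally show ?thesis by (simp add: conv_def)
qed

text \<open>Far to the left \<open>h\<close> is nearly the constant \<open>A\<close>, so the
  boundary term of \<open>conv_average\<close> tends to \<open>A\<close> times the mean, which is
  zero. The first moment supplies the dominating function.\<close>

lemma boundary_term_vanishes:
  assumes h: "front h" and lim: "(h \<longlongrightarrow> A) at_bot"
  shows "(\<lambda>n. \<integral>y. y * h (- real n - y) \<partial>M) \<longlonglongrightarrow> 0"
proof -
  have zero: "(\<integral>y. y * A \<partial>M) = 0"
    using mean_zero by simp
  have bot: "filterlim (\<lambda>n. - real n - y) at_bot sequentially" for y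
    unfolding filterlim_at_bot eventually_sequentially
  proof
    fix Z
    obtain N where "- Z - y < real N" using reals_Archimedean2 by blast
    then show "\<exists>N. \<forall>n\<ge>N. - real n - y \<le> Z" by (intro exI[of _ N]) auto
  qed
  have "(\<lambda>n. \<integral>y. y * h (- real n - y) \<partial>M) \<longlonglongrightarrow> (\<integral>y. y * A \<partial>M)"
  proof (rule integral_dominated_convergence[where w="\<lambda>y. \<bar>y\<bar>"])
    show "(\<lambda>y. y * h (- real n - y)) \<in> borel_measurable M" for n
      by (rule borel_measurable_integrable[OF moment_front[OF h]])
    show "AE y in M. (\<lambda>n. y * h (- real n - y)) \<longlonglongrightarrow> y * A"
      by (rule AE_I2, rule tendsto_mult_left, rule filterlim_compose[OF lim bot])
    show "AE y in M. norm (y * h (- real n - y)) \<le> \<bar>y\<bar>" for n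
      by (auto simp: abs_mult front_nonneg[OF h] front_le_1[OF h] mult_left_le)
    show "integrable M (\<lambda>y. \<bar>y\<bar>)" using moment by (rule integrable_abs)
  qed measurable
  then show ?thesis unfolding zero .
qed

end

text \<open>The weights \<open>p\<close>, \<open>q\<close> play the role of a left eigenvector of the linearisation with eigenvalue
  larger than one.\<close>

definition unstable_above :: "(real \<Rightarrow> real \<Rightarrow> real) \<Rightarrow> (real \<Rightarrow> real \<Rightarrow> real) \<Rightarrow> real \<Rightarrow> real \<Rightarrow> bool" where
  "unstable_above F1 F2 A B \<longleftrightarrow> F1 A B = A \<and> F2 A B = B \<and>
     (\<forall>u v. A \<le> u \<and> u \<le> 1 \<and> B \<le> v \<and> v \<le> 1 \<longrightarrow> (F1 u v = A \<longrightarrow> u = A) \<and> (F2 u v = B \<longrightarrow> v = B)) \<and>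
     (\<exists>p q e \<eta>. 0 \<le> p \<and> 0 \<le> q \<and> 0 < e \<and> 0 < \<eta> \<and>
       (\<forall>u v. A \<le> u \<and> u \<le> 1 \<and> u \<le> A + \<eta> \<and> B \<le> v \<and> v \<le> 1 \<and> v \<le> B + \<eta> \<longrightarrow>
         e * ((u - A) + (v - B)) \<le> p * (F1 u v - u) + q * (F2 u v - v)))"

locale centered_coupled = coupled M1 M2 F1 F2 + A: centered M1 + B: centered M2 for M1 M2 F1 F2
begin

text \<open>Choose \<open>T\<close> so far left that \<open>(f, g)\<close> is within \<eta> of
  \<open>(A, B)\<close>, and integrate the weighted reactions over \<open>{- n..T}\<close>. By
  \<open>conv_average\<close> and the supersolution property, integrating \<open>h1\<close> or
  \<open>h2\<close> gives at most the integral of \<open>f\<close> or \<open>g\<close> up to a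
  boundary term, while instability makes the weighted difference at least \<open>e\<close> times the
  deviation from \<open>(A, B)\<close>. So the total deviation is bounded by boundary terms that
  vanish as \<open>n\<close> grows.\<close>

lemma supersolution_at_unstable_initially_constant:
  assumes fr: "front f" "front g"
    and super: "\<And>t. step M1 F1 f g t \<le> f t" "\<And>t. step M2 F2 f g t \<le> g t"
    and lim: "(f \<longlongrightarrow> A) at_bot" "(g \<longlongrightarrow> B) at_bot"
    and ge: "\<And>t. A \<le> f t" "\<And>t. B \<le> g t"
    and u: "unstable_above F1 F2 A B"
  shows "\<exists>T. \<forall>t<T. f t = A \<and> g t = B"
proof -
  obtain p q e \<eta> where pq: "0 \<le> p" "0 \<le> q" "0 < e" "0 < \<eta>"
    and inst: "\<And>u v. \<lbrakk>A \<le> u; u \<le> 1; u \<le> A + \<eta>; B \<le> v; v \<le> 1; v \<le> B + \<eta>\<rbrakk> \<Longrightarrow>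
         e * ((u - A) + (v - B)) \<le> p * (F1 u v - u) + q * (F2 u v - v)"
    using u unfolding unstable_above_def by metis
  have "\<forall>\<^sub>F t in at_bot. f t < A + \<eta>" "\<forall>\<^sub>F t in at_bot. g t < B + \<eta>"
    using order_tendstoD(2)[OF lim(1), of "A + \<eta>"] order_tendstoD(2)[OF lim(2), of "B + \<eta>"] pq by auto
  then have "\<forall>\<^sub>F t in at_bot. f t < A + \<eta> \<and> g t < B + \<eta>" by eventually_elim simp
  then obtain T where T: "\<And>t. t \<le> T \<Longrightarrow> f t < A + \<eta> \<and> g t < B + \<eta>"
    unfolding eventually_at_bot_linorder by blast
  define h1 where "h1 = (\<lambda>s. F1 (f s) (g s))"
  define h2 where "h2 = (\<lambda>s. F2 (f s) (g s))"
  have hf: "front h1" "front h2" unfolding h1_def h2_def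
    by (rule front_reaction[OF F1 fr], rule front_reaction[OF F2 fr])
  have hlim: "(h1 \<longlongrightarrow> F1 A B) at_bot" "(h2 \<longlongrightarrow> F2 A B) at_bot"
    unfolding h1_def h2_def by (rule reaction_tendsto[OF F1 lim], rule reaction_tendsto[OF F2 lim])
  define E1 where "E1 n = (\<integral>y. y * h1 (- real n - y) \<partial>M1)" for n
  define E2 where "E2 n = (\<integral>y. y * h2 (- real n - y) \<partial>M2)" for n
  have E: "E1 \<longlonglongrightarrow> 0" "E2 \<longlonglongrightarrow> 0" unfolding E1_def E2_def
    by (rule A.boundary_term_vanishes[OF hf(1) hlim(1)], rule B.boundary_term_vanishes[OF hf(2) hlim(2)])
  note int = front_integrable_Icc
  have key: "e * ((T - t0) * ((f t0 - A) + (g t0 - B))) \<le> - (p * E1 n + q * E2 n)"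
    if t0: "t0 < T" and n: "- real n \<le> t0" for t0 n
  proof -
    define J where "J k = (\<integral>t. indicator {- real n..T} t * k t \<partial>lborel)" for k :: "real \<Rightarrow> real"
    have sf: "front (step M1 F1 f g)" "front (step M2 F2 f g)"
      by (rule A.front_step[OF F1 fr], rule B.front_step[OF F2 fr])
    have "J h1 + E1 n \<le> J (conv M1 h1)" unfolding J_def E1_def
      using t0 n by (intro A.conv_average hf) auto
    also have "\<dots> \<le> J f" unfolding J_def
      using super(1) by (intro integral_mono int fr) (auto simp: indicator_def step_def h1_def intro!: A.front_conv hf(1)[unfolded h1_def])
    finally have 1: "J h1 + E1 n \<le> J f" .
    have "J h2 + E2 n \<le> J (conv M2 h2)" unfolding J_def E2_def
      using t0 n by (intro B.conv_average hf) auto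
    also have "\<dots> \<le> J g" unfolding J_def
      using super(2) by (intro integral_mono int fr) (auto simp: indicator_def step_def h2_def intro!: B.front_conv hf(2)[unfolded h2_def])
    finally have 2: "J h2 + E2 n \<le> J g" .
    \<comment> \<open>Only \<open>{t0..T}\<close> is kept on the left: there the deviation is at
      least its value at \<open>t0\<close>, and on the rest of \<open>{- n..T}\<close> the weighted
      integrand is nonnegative.\<close>
    have "(\<integral>t. indicator {t0..T} t * (e * ((f t0 - A) + (g t0 - B))) \<partial>lborel)
      \<le> (\<integral>t. p * (indicator {- real n..T} t * h1 t - indicator {- real n..T} t * f t) + q * (indicator {- real n..T} t * h2 t - indicator {- real n..T} t * g t) \<partial>lborel)"
    proof (rule integral_mono)
      show "integrable lborel (\<lambda>t. p * (indicator {- real n..T} t * h1 t - indicator {- real n..T} t * f t) + q * (indicator {- real n..T} t * h2 t - indicator {- real n..T} t * g t))"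
        using int[OF hf(1)] int[OF hf(2)] int[OF fr(1)] int[OF fr(2)] by auto
      show "integrable lborel (\<lambda>t. indicator {t0..T} t * (e * ((f t0 - A) + (g t0 - B))))"
        by (intro integrable_mult_left) (auto simp: emeasure_lborel_Icc_eq)
      fix t
      show "indicator {t0..T} t * (e * ((f t0 - A) + (g t0 - B)))
        \<le> p * (indicator {- real n..T} t * h1 t - indicator {- real n..T} t * f t) + q * (indicator {- real n..T} t * h2 t - indicator {- real n..T} t * g t)"
      proof (cases "t \<in> {- real n..T}")
        case False
        then show ?thesis using t0 n by (auto simp: indicator_def)
      next
        case True
        have *: "e * ((f t - A) + (g t - B)) \<le> p * (h1 t - f t) + q * (h2 t - g t)"
          unfolding h1_def h2_def using T[of t] True ge fr by (intro inst) (auto simp: front_le_1)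
        show ?thesis
        proof (cases "t \<in> {t0..T}")
          case in0: True
          then have "(f t0 - A) + (g t0 - B) \<le> (f t - A) + (g t - B)"
            using front_monoD[OF fr(1), of t0 t] front_monoD[OF fr(2), of t0 t] by simp
          then have "e * ((f t0 - A) + (g t0 - B)) \<le> e * ((f t - A) + (g t - B))"
            using pq by (intro mult_left_mono) auto
          then show ?thesis using * True in0 by simp
        next
          case False
          have "0 \<le> e * ((f t - A) + (g t - B))" using pq ge[of t] by (intro mult_nonneg_nonneg) auto
          then show ?thesis using * True False by simp
        qed
      qed
    qed
    also have "\<dots> = p * (J h1 - J f) + q * (J h2 - J g)"
      unfolding J_def using int[OF hf(1)] int[OF hf(2)] int[OF fr(1)] int[OF fr(2)] by simp
    also have "\<dots> \<le> p * (- E1 n) + q * (- E2 n)"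
      using 1 2 pq by (intro add_mono mult_left_mono) auto
    finally show ?thesis using t0 by (simp add: mult.left_commute)
  qed
  have "f t0 = A \<and> g t0 = B" if t0: "t0 < T" for t0
  proof -
    have "(\<lambda>n. - (p * E1 n + q * E2 n)) \<longlonglongrightarrow> - (p * 0 + q * 0)" by (intro tendsto_intros E)
    moreover have "\<exists>N. \<forall>n\<ge>N. e * ((T - t0) * ((f t0 - A) + (g t0 - B))) \<le> - (p * E1 n + q * E2 n)"
    proof -
      obtain N where "- t0 < real N" using reals_Archimedean2 by blast
      then show ?thesis using key[OF t0] by (intro exI[of _ N]) auto
    qed
    ultimately have "e * ((T - t0) * ((f t0 - A) + (g t0 - B))) \<le> 0"
      by (auto dest: LIMSEQ_le_const)
    then have "(f t0 - A) + (g t0 - B) \<le> 0" using pq t0 by (auto simp: mult_le_0_iff)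
    then show ?thesis using ge[of t0] by auto
  qed
  then show ?thesis by blast
qed

text \<open>The set \<open>X\<close> where the state is attained is a left half-line; let
  \<open>s\<close> be its finite supremum. At \<open>s - d / 2\<close>, inside \<open>X\<close>, the
  average of a function that is at least \<open>K\<close> is at most \<open>K\<close>. The mass left
  of \<open>-d\<close> looks at points beyond \<open>s + d / 2\<close>, so the reaction still equals
  \<open>K\<close> at \<open>s + d / 2\<close>. Both reactions are then at \<open>(A, B)\<close>,
  and the second clause of \<open>unstable_above\<close> puts the point into \<open>X\<close>,
  beyond its supremum.\<close>

lemma supersolution_at_unstable_constant:
  assumes fr: "front f" "front g"
    and super: "\<And>t. step M1 F1 f g t \<le> f t" "\<And>t. step M2 F2 f g t \<le> g t"
    and lim: "(f \<longlongrightarrow> A) at_bot" "(g \<longlongrightarrow> B) at_bot"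
    and ge: "\<And>t. A \<le> f t" "\<And>t. B \<le> g t" and AB: "0 \<le> A" "0 \<le> B"
    and u: "unstable_above F1 F2 A B"
  shows "f t = A \<and> g t = B"
proof (rule ccontr)
  assume t: "\<not> ?thesis"
  define X where "X = {t. f t = A \<and> g t = B}"
  have down: "s' \<in> X" if "s \<in> X" "s' \<le> s" for s s'
    using that ge[of s'] front_monoD[OF fr(1), of s' s] front_monoD[OF fr(2), of s' s] by (auto simp: X_def)
  have bdd: "bdd_above X"
  proof (rule bdd_aboveI)
    show "s \<le> t" if "s \<in> X" for s using down[OF that, of t] t by (force simp: X_def)
  qed
  obtain T where T: "\<And>t. t < T \<Longrightarrow> f t = A \<and> g t = B"
    using supersolution_at_unstable_initially_constant[OF fr super lim ge u] by blast
  have ne: "X \<noteq> {}" using T[of "T - 1"] by (auto simp: X_def)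
  define s where "s = Sup X"
  have spread: "\<exists>d>0. \<forall>d'. d' \<le> d \<longrightarrow> F (f (s + d' / 2)) (g (s + d' / 2)) = K"
    if C: "centered M" and F: "reaction F" and K: "F A B = K" and sup: "\<And>t. t \<in> X \<Longrightarrow> step M F f g t \<le> K" for M F K
  proof -
    interpret C: centered M by fact
    obtain d where d: "0 < d" "0 < emeasure M {..<- d}" using C.ex_left_mass by blast
    define h where "h = (\<lambda>s. F (f s) (g s))"
    have hf: "front h" unfolding h_def by (rule front_reaction[OF F fr])
    have hK: "K \<le> h t" for t
      unfolding h_def K[symmetric] using ge fr AB by (intro reaction_mono[OF F]) (auto simp: front_le_1)
    have le: "h (s + d / 2) \<le> K"
    proof (rule ccontr)
      assume neg: "\<not> ?thesis"
      have "s - d / 2 < Sup X" using d by (simp add: s_def)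
      then obtain x where "x \<in> X" "s - d / 2 < x" using less_cSup_iff[OF ne bdd] by blast
      then have in_X: "s - d / 2 \<in> X" using down by auto
      have "(\<integral>y. K \<partial>M) < (\<integral>y. h (s - d / 2 - y) \<partial>M)"
      proof (rule C.integral_less_AE[where A="{..<- d}"])
        show "AE y in M. y \<in> {..<- d} \<longrightarrow> K \<noteq> h (s - d / 2 - y)"
        proof (rule AE_I2, rule impI)
          fix y assume "y \<in> {..<- d}"
          then have "h (s + d / 2) \<le> h (s - d / 2 - y)" by (intro front_monoD[OF hf]) (auto simp: field_simps)
          then show "K \<noteq> h (s - d / 2 - y)" using neg by auto
        qed
        show "emeasure M {..<- d} \<noteq> 0" using d by simp
      qed (use hK C.front_integrable[OF hf] in auto)
      then have "K < step M F f g (s - d / 2)" using C.prob_space by (simp add: step_def conv_def h_def)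
      then show False using sup[OF in_X] by simp
    qed
    have "h (s + d' / 2) = K" if "d' \<le> d" for d'
      using le hK[of "s + d' / 2"] front_monoD[OF hf, of "s + d' / 2" "s + d / 2"] that by auto
    then show ?thesis using d(1) unfolding h_def by blast
  qed
  have fixpt: "F1 A B = A" "F2 A B = B" using u by (auto simp: unstable_above_def)
  have s1: "step M1 F1 f g t \<le> A" and s2: "step M2 F2 f g t \<le> B" if "t \<in> X" for t
    using super[of t] that by (auto simp: X_def)
  obtain d1 where d1: "0 < d1" "\<And>d'. d' \<le> d1 \<Longrightarrow> F1 (f (s + d' / 2)) (g (s + d' / 2)) = A"
    using spread[OF A.centered_axioms F1 fixpt(1) s1] by blast
  obtain d2 where d2: "0 < d2" "\<And>d'. d' \<le> d2 \<Longrightarrow> F2 (f (s + d' / 2)) (g (s + d' / 2)) = B"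
    using spread[OF B.centered_axioms F2 fixpt(2) s2] by blast
  define d where "d = min d1 d2"
  have "F1 (f (s + d / 2)) (g (s + d / 2)) = A" "F2 (f (s + d / 2)) (g (s + d / 2)) = B"
    using d1(2)[of d] d2(2)[of d] by (auto simp: d_def)
  then have "s + d / 2 \<in> X" using u ge[of "s + d / 2"] front_le_1[OF fr(1), of "s + d / 2"] front_le_1[OF fr(2), of "s + d / 2"]
    unfolding unstable_above_def X_def by simp
  then have "s + d / 2 \<le> s" unfolding s_def using bdd by (rule cSup_upper)
  then show False using d1 d2 by (auto simp: d_def)
qed

end

section \<open>The competition map\<close>

definition compF :: "real \<Rightarrow> real \<Rightarrow> real \<Rightarrow> real \<Rightarrow> real" where
  "compF r a u v = 1 - (1 - u) * exp (r * (u - a * v))"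

definition compG :: "real \<Rightarrow> real \<Rightarrow> real \<Rightarrow> real \<Rightarrow> real" where
  "compG r a u v = v * exp (r * (1 - a - v + a * u))"

text \<open>The order-reversing map taking \<open>(u, v)\<close> to \<open>(1 - v, 1 - u)\<close>
  exchanges the two species. This is the symmetry that later turns statements about the right end of
  a wave into statements about the left end.\<close>

lemma compG_flip: "compG r a u v = 1 - compF r a (1 - v) (1 - u)"
  and compF_flip: "compF r a u v = 1 - compG r a (1 - v) (1 - u)"
  by (simp_all add: compF_def compG_def algebra_simps)

text \<open>The factor \<open>(1 - u) * exp (r * u)\<close> decreases on the unit interval because
  \<open>r < 1\<close>. Without derivatives: with \<open>d = u' - u\<close>, one has
  \<open>1 - u' \<le> (1 - u) * (1 - r * d)\<close>, and
  \<open>1 - r * d \<le> exp (- (r * d))\<close>.\<close>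

lemma compF_le:
  assumes r: "0 < r" "r < 1" and a: "0 \<le> a" and u: "0 \<le> u" "u \<le> u'" "u' \<le> 1" and v: "v \<le> v'"
  shows "compF r a u v \<le> compF r a u' v'" "u < u' \<Longrightarrow> compF r a u v < compF r a u' v'"
proof -
  define d where "d = u' - u"
  have d: "0 \<le> d" using u by (simp add: d_def)
  have wr: "(1 - u) * r < 1" using mult_right_mono[of "1 - u" 1 r] u r by linarith
  have le1: "1 - u - d \<le> (1 - u) * (1 - r * d)"
  proof -
    have "0 \<le> d * (1 - (1 - u) * r)" using d wr by simp
    then show ?thesis by (simp add: algebra_simps)
  qed
  have e: "1 - r * d \<le> exp (- (r * d))" using exp_ge_add_one_self[of "- (r * d)"] by simp
  then have le2: "(1 - u) * (1 - r * d) \<le> (1 - u) * exp (- (r * d))" using u by (intro mult_left_mono) auto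
  have "r * a * v \<le> r * a * v'" using v r a by (intro mult_left_mono) auto
  then have E: "exp (r * (u' - a * v')) \<le> exp (r * (u' - a * v))" by (simp add: algebra_simps)
  have eq: "exp (- (r * d)) * exp (r * (u' - a * v)) = exp (r * (u - a * v))"
    by (simp add: exp_add[symmetric] d_def algebra_simps)
  have "(1 - u') * exp (r * (u' - a * v')) \<le> (1 - u') * exp (r * (u' - a * v))"
    using E u by (intro mult_left_mono) auto
  moreover have "(1 - u') * exp (r * (u' - a * v)) \<le> (1 - u) * exp (- (r * d)) * exp (r * (u' - a * v))"
    using le1 le2 by (intro mult_right_mono) (auto simp: d_def)
  ultimately show "compF r a u v \<le> compF r a u' v'"
    unfolding compF_def mult.assoc eq by linarith
  assume lt: "u < u'"
  have "1 - u - d < (1 - u) * (1 - r * d)"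
  proof -
    have "0 < d * (1 - (1 - u) * r)" using lt wr by (simp add: d_def)
    then show ?thesis by (simp add: algebra_simps)
  qed
  then have "(1 - u') * exp (r * (u' - a * v)) < (1 - u) * exp (- (r * d)) * exp (r * (u' - a * v))"
    using le2 by (intro mult_strict_right_mono) (auto simp: d_def)
  then show "compF r a u v < compF r a u' v'"
    using \<open>(1 - u') * exp (r * (u' - a * v')) \<le> (1 - u') * exp (r * (u' - a * v))\<close>
    unfolding compF_def mult.assoc eq by linarith
qed

lemma compG_le:
  assumes r: "0 < r" "r < 1" and a: "0 \<le> a" and u: "u \<le> u'" and v: "0 \<le> v" "v \<le> v'" "v' \<le> 1"
  shows "compG r a u v \<le> compG r a u' v'" "v < v' \<Longrightarrow> compG r a u v < compG r a u' v'"
  using compF_le[OF r a, of "1 - v'" "1 - v" "1 - u'" "1 - u"] u v by (auto simp: compG_flip)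

lemma reaction_compF:
  assumes "0 < r" "r < 1" "1 < a" shows "reaction (compF r a)"
  unfolding reaction_def
proof (intro conjI allI impI)
  show "continuous_on UNIV (\<lambda>(u, v). compF r a u v)"
    unfolding compF_def split_beta by (intro continuous_intros)
  show "compF r a u v \<le> compF r a u' v'" if "0 \<le> u \<and> u \<le> u' \<and> u' \<le> 1 \<and> 0 \<le> v \<and> v \<le> v' \<and> v' \<le> 1" for u v u' v'
    using that assms by (intro compF_le) auto
  show "0 < compF r a u v" if "0 < u \<and> u \<le> 1 \<and> 0 < v \<and> v \<le> 1" for u v
    using compF_le(2)[of r a 0 u 0 v] that assms by (simp add: compF_def)
qed (simp_all add: compF_def)

lemma reaction_compG:
  assumes "0 < r" "r < 1" "1 < a" shows "reaction (compG r a)"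
  unfolding reaction_def
proof (intro conjI allI impI)
  show "continuous_on UNIV (\<lambda>(u, v). compG r a u v)"
    unfolding compG_def split_beta by (intro continuous_intros)
  show "compG r a u v \<le> compG r a u' v'" if "0 \<le> u \<and> u \<le> u' \<and> u' \<le> 1 \<and> 0 \<le> v \<and> v \<le> v' \<and> v' \<le> 1" for u v u' v'
    using that assms by (intro compG_le) auto
qed (simp_all add: compG_def)

section \<open>Fixed points of the competition map and their instability\<close>

definition fixpt :: "real \<Rightarrow> real \<Rightarrow> real \<Rightarrow> real \<Rightarrow> real \<Rightarrow> real \<Rightarrow> bool" where
  "fixpt r1 r2 a1 a2 A B \<longleftrightarrow> 0 \<le> A \<and> A \<le> 1 \<and> 0 \<le> B \<and> B \<le> 1 \<and> compF r1 a1 A B = A \<and> compG r2 a2 A B = B"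

lemma fixpt_flip: "fixpt r1 r2 a1 a2 A B \<longleftrightarrow> fixpt r2 r1 a2 a1 (1 - B) (1 - A)"
  by (auto simp: fixpt_def compF_flip[of r1] compG_flip[of r2])

text \<open>In each component either the population factor or the exponent vanishes. In the original
  variables \<open>(0, 0)\<close> and \<open>(1, 1)\<close> mean that only the first or only the
  second species survives, \<open>(1, 0)\<close> is joint extinction, and the last case is
  coexistence.\<close>

lemma fixpt_cases:
  assumes r: "0 < r1" "0 < r2" and a: "1 < a1" "1 < a2" and f: "fixpt r1 r2 a1 a2 A B"
  shows "(A = 0 \<and> B = 0) \<or> (A = 1 \<and> B = 1) \<or> (A = 1 \<and> B = 0) \<or>
    (A = a1 * B \<and> 1 - a2 - B + a2 * A = 0 \<and> 0 < A \<and> A < 1 \<and> 0 < B \<and> B < 1)"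
proof -
  have "(1 - A) * (1 - exp (r1 * (A - a1 * B))) = 0"
    using f by (simp add: fixpt_def compF_def algebra_simps)
  then have 1: "A = 1 \<or> A = a1 * B" using r by auto
  have "B * (exp (r2 * (1 - a2 - B + a2 * A)) - 1) = 0"
    using f by (simp add: fixpt_def compG_def algebra_simps)
  then have 2: "B = 0 \<or> 1 - a2 - B + a2 * A = 0" using r by auto
  have b: "0 \<le> A" "A \<le> 1" "0 \<le> B" "B \<le> 1" using f by (auto simp: fixpt_def)
  show ?thesis
  proof (cases "A = 1 \<or> B = 0")
    case True
    then show ?thesis using 1 2 by auto
  next
    case False
    then have *: "A = a1 * B" "1 - a2 - B + a2 * A = 0" using 1 2 by auto
    moreover have pos: "0 < B" "A < 1" using False b by auto
    moreover have "B < A" using * a pos by simp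
    then have "0 < A" "B < 1" using pos by linarith+
    ultimately show ?thesis by blast
  qed
qed

text \<open>Finiteness leaves room for a level \<theta> that no fixed point attains, and separates
  the sums below 2 from 2. In the coexistence case, eliminating \<open>A\<close> gives
  \<open>B * (a1 * a2 - 1) = a2 - 1\<close>.\<close>

lemma fixpt_sums:
  assumes r: "0 < r1" "0 < r2" and a: "1 < a1" "1 < a2"
  obtains S where "finite S" "\<And>A B. fixpt r1 r2 a1 a2 A B \<Longrightarrow> A + B \<in> S"
proof -
  define D where "D = a1 * a2 - 1"
  have D: "D > 0" using a by (simp add: D_def less_1_mult)
  have "A + B \<in> {0, 1, 2, (a1 + 1) * ((a2 - 1) / D)}" if "fixpt r1 r2 a1 a2 A B" for A B
    using fixpt_cases[OF r a that]
  proof (elim disjE conjE)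
    assume *: "A = a1 * B" "1 - a2 - B + a2 * A = 0"
    then have "B * D = a2 - 1" by (simp add: D_def algebra_simps)
    then have "B = (a2 - 1) / D" using D by (simp add: field_simps)
    moreover have "A + B = (a1 + 1) * B" using * by (simp add: algebra_simps)
    ultimately show ?thesis by simp
  qed auto
  then show thesis using that[of "{0, 1, 2, (a1 + 1) * ((a2 - 1) / D)}"] by blast
qed

text \<open>Above \<open>(1, 0)\<close> only \<open>v\<close> can move, since \<open>u = 1\<close>
  is forced, so the first weight is 0. There \<open>v\<close> is multiplied by
  \<open>exp (r2 * (1 - v))\<close>, which is at least \<open>1 + r2 / 2\<close> for
  \<open>v \<le> 1 / 2\<close>.\<close>

lemma unstable_above_semitrivial:
  assumes r: "0 < r2" "r2 < 1" and a: "1 < a2"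
  shows "unstable_above (compF r1 a1) (compG r2 a2) 1 0"
proof -
  have "r2 / 2 * ((u - 1) + (v - 0)) \<le> 0 * (compF r1 a1 u v - u) + 1 * (compG r2 a2 u v - v)"
    if "1 \<le> u" "u \<le> 1" "0 \<le> v" "v \<le> 1" "v \<le> 0 + 1 / 2" for u v
  proof -
    have [simp]: "u = 1" using that by simp
    have "r2 / 2 \<le> r2 * (1 - v)" using r that by (simp add: field_simps)
    also have "\<dots> \<le> exp (r2 * (1 - v)) - 1" using exp_ge_add_one_self[of "r2 * (1 - v)"] by linarith
    finally have "v * (r2 / 2) \<le> v * (exp (r2 * (1 - v)) - 1)" using that by (intro mult_left_mono) auto
    then show ?thesis by (simp add: compG_def algebra_simps)
  qed
  then have "\<exists>p q e \<eta>. 0 \<le> p \<and> 0 \<le> q \<and> 0 < e \<and> 0 < \<eta> \<and>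
       (\<forall>u v. (1::real) \<le> u \<and> u \<le> 1 \<and> u \<le> 1 + \<eta> \<and> 0 \<le> v \<and> v \<le> 1 \<and> v \<le> 0 + \<eta> \<longrightarrow>
         e * ((u - 1) + (v - 0)) \<le> p * (compF r1 a1 u v - u) + q * (compG r2 a2 u v - v))"
    using r by (intro exI[of _ 0] exI[of _ 1] exI[of _ "r2 / 2"] exI[of _ "1 / 2"]) auto
  then show ?thesis unfolding unstable_above_def by (auto simp: compF_def compG_def)
qed

text \<open>The weights cancel the factors \<open>r1 * P\<close> and \<open>r2 * B\<close> of the
  linearisation. With \<open>x = u - A\<close> and \<open>y = v - B\<close>, the weighted
  first-order increments are \<open>a1 * y - x\<close> and \<open>a2 * x - y\<close>; their sum
  \<open>(a2 - 1) * x + (a1 - 1) * y\<close> is positive off the state because \<open>a1\<close> and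
  \<open>a2\<close> exceed 1.\<close>

lemma unstable_above_coexistence:
  assumes r: "0 < r1" "r1 < 1" "0 < r2" "r2 < 1" and a: "1 < a1" "1 < a2"
    and A: "A = a1 * B" "1 - a2 - B + a2 * A = 0" "0 < A" "A < 1" "0 < B" "B < 1"
  shows "unstable_above (compF r1 a1) (compG r2 a2) A B"
proof -
  define P where "P = 1 - A"
  have P: "0 < P" using A by (simp add: P_def)
  define c where "c = 1 + a1"
  have c: "1 < c" using a by (simp add: c_def)
  \<comment> \<open>\<open>K\<close> collects the second-order errors: the product
    \<open>x * s / P\<close>, the quadratic remainder of the exponential, and
    \<open>y * w / B\<close>.\<close>
  define K where "K = c / P + 2 * c\<^sup>2 + 1 / B"
  have K: "0 < K" using P c A by (simp add: K_def add_pos_pos)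
  define e where "e = min (a1 - 1) (a2 - 1) / 2"
  have e: "0 < e" "2 * e \<le> a1 - 1" "2 * e \<le> a2 - 1" using a by (auto simp: e_def min_def)
  \<comment> \<open>Half of the linear gain pays for the errors: \<open>m \<le> 2 * \<eta>\<close>
    gives \<open>m * K \<le> e\<close>. The second bound keeps \<open>c * m \<le> 1 / 2\<close>, so
    that the quadratic estimate of the exponential applies.\<close>
  define \<eta> where "\<eta> = min (e / (2 * K)) (1 / (4 * c))"
  have \<eta>: "0 < \<eta>" "2 * \<eta> * K \<le> e" "2 * \<eta> * c \<le> 1 / 2"
  proof -
    show "0 < \<eta>" using e K c by (simp add: \<eta>_def)
    have "\<eta> \<le> e / (2 * K)" "\<eta> \<le> 1 / (4 * c)" by (auto simp: \<eta>_def)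
    then show "2 * \<eta> * K \<le> e" "2 * \<eta> * c \<le> 1 / 2" using K c by (auto simp: field_simps)
  qed
  have main: "e * ((u - A) + (v - B)) \<le> 1 / (r1 * P) * (compF r1 a1 u v - u) + 1 / (r2 * B) * (compG r2 a2 u v - v)"
    if u: "A \<le> u" "u \<le> 1" "u \<le> A + \<eta>" and v: "B \<le> v" "v \<le> 1" "v \<le> B + \<eta>" for u v
  proof -
    define x where "x = u - A"
    define y where "y = v - B"
    define m where "m = x + y"
    define s where "s = u - a1 * v"
    have xy: "0 \<le> x" "0 \<le> y" "x \<le> \<eta>" "y \<le> \<eta>" "x \<le> P" using u v by (auto simp: x_def y_def P_def)
    have m: "0 \<le> m" "m \<le> 2 * \<eta>" "x \<le> m" "y \<le> m" using xy by (auto simp: m_def)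
    have s: "s = x - a1 * y" using A by (simp add: s_def x_def y_def algebra_simps)
    have s_abs: "\<bar>s\<bar> \<le> c * m"
    proof -
      have "\<bar>s\<bar> \<le> x + a1 * y" unfolding s using xy a by (simp add: abs_le_iff algebra_simps add_increasing)
      also have "\<dots> \<le> c * m" using xy a by (simp add: c_def m_def algebra_simps)
      finally show ?thesis .
    qed
    have cm: "c * m \<le> 1 / 2"
    proof -
      have "c * m \<le> c * (2 * \<eta>)" using m c by (intro mult_left_mono) auto
      then show ?thesis using \<eta>(3) by (simp add: algebra_simps)
    qed
    have s_half: "\<bar>s\<bar> \<le> 1 / 2" using s_abs cm by linarith
    define z where "z = r1 * s"
    have z_half: "\<bar>z\<bar> \<le> 1 / 2"
      using mult_mono[of r1 1 "\<bar>s\<bar>" "1 / 2"] r s_half by (simp add: z_def abs_mult)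
    \<comment> \<open>Upper bound \<open>exp z \<le> 1 + z + 2 * z^2\<close>, obtained by
      multiplying with \<open>1 - z > 0\<close>: \<open>(1 - z) * exp z \<le> 1\<close>, and the
      product with the quadratic exceeds 1 by \<open>z^2 * (1 - 2 * z)\<close>.\<close>
    have exp_z: "- z - 2 * z\<^sup>2 \<le> 1 - exp z"
    proof -
      have "(1 - z) * exp z \<le> 1"
        using exp_ge_add_one_self[of "- z"] by (simp add: exp_minus field_simps)
      also have "1 \<le> (1 - z) * (1 + z + 2 * z\<^sup>2)"
      proof -
        have "0 \<le> z\<^sup>2 * (1 - 2 * z)" using z_half by (intro mult_nonneg_nonneg) auto
        then show ?thesis by (simp add: algebra_simps power2_eq_square)
      qed
      finally have "(1 - z) * exp z \<le> (1 - z) * (1 + z + 2 * z\<^sup>2)" .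
      then have "exp z \<le> 1 + z + 2 * z\<^sup>2" using z_half by (subst (asm) mult_le_cancel_left_pos) auto
      then show ?thesis by simp
    qed
    have Fpart: "- s - m\<^sup>2 * (c / P + 2 * c\<^sup>2) \<le> 1 / (r1 * P) * (compF r1 a1 u v - u)"
    proof -
      have "compF r1 a1 u v - u = (P - x) * (1 - exp z)"
        by (simp add: compF_def P_def x_def z_def s_def algebra_simps)
      moreover have "(P - x) * (- z - 2 * z\<^sup>2) \<le> (P - x) * (1 - exp z)"
        using exp_z xy by (intro mult_left_mono) auto
      ultimately have "1 / (r1 * P) * ((P - x) * (- z - 2 * z\<^sup>2)) \<le> 1 / (r1 * P) * (compF r1 a1 u v - u)"
        using r P by (intro mult_left_mono) auto
      moreover have "1 / (r1 * P) * ((P - x) * (- z - 2 * z\<^sup>2)) = - s + x * s / P - (1 - x / P) * (2 * r1 * s\<^sup>2)"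
        using r P by (simp add: z_def field_simps power2_eq_square)
      moreover have "- (m\<^sup>2 * (c / P)) \<le> x * s / P"
      proof -
        have "- (x * s) \<le> x * \<bar>s\<bar>" using xy by (metis abs_ge_minus_self minus_mult_right mult_left_mono)
        also have "\<dots> \<le> m * (c * m)" using xy m s_abs by (intro mult_mono) auto
        finally have "- (x * s) / P \<le> m * (c * m) / P" using P by (intro divide_right_mono) auto
        then show ?thesis by (simp add: power2_eq_square algebra_simps)
      qed
      moreover have "(1 - x / P) * (2 * r1 * s\<^sup>2) \<le> m\<^sup>2 * (2 * c\<^sup>2)"
      proof -
        have sq: "s\<^sup>2 \<le> (c * m)\<^sup>2" using s_abs by (metis abs_le_square_iff abs_of_nonneg c m(1) mult_nonneg_nonneg less_imp_le zero_less_one order.trans abs_ge_zero)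
        have coef: "(1 - x / P) * (2 * r1) \<le> 1 * 2" using xy P r by (intro mult_mono) (auto simp: field_simps)
        have "(1 - x / P) * (2 * r1) * s\<^sup>2 \<le> (1 * 2) * (c * m)\<^sup>2" using mult_mono[OF coef sq] by simp
        then show ?thesis by (simp add: power_mult_distrib algebra_simps)
      qed
      ultimately show ?thesis by (simp add: distrib_left)
    qed
    have Gpart: "a2 * x - y - m\<^sup>2 * (1 / B) \<le> 1 / (r2 * B) * (compG r2 a2 u v - v)"
    proof -
      define w where "w = a2 * x - y"
      have w: "1 - a2 - v + a2 * u = w" using A(2) by (simp add: w_def x_def y_def algebra_simps)
      have "compG r2 a2 u v - v = v * (exp (r2 * w) - 1)" unfolding compG_def w by (simp add: right_diff_distrib)
      moreover have "r2 * w \<le> exp (r2 * w) - 1" using exp_ge_add_one_self[of "r2 * w"] by linarith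
      then have "v * (r2 * w) \<le> v * (exp (r2 * w) - 1)" using v A by (intro mult_left_mono) auto
      ultimately have "1 / (r2 * B) * (v * (r2 * w)) \<le> 1 / (r2 * B) * (compG r2 a2 u v - v)"
        using r A by (intro mult_left_mono) auto
      moreover have "1 / (r2 * B) * (v * (r2 * w)) = w + y * w / B"
        using r A by (simp add: y_def field_simps)
      moreover have "- (m\<^sup>2 * (1 / B)) \<le> y * w / B"
      proof -
        have "- (y * w) \<le> y * y" using xy a by (simp add: w_def algebra_simps)
        also have "\<dots> \<le> m * m" using xy m by (intro mult_mono) auto
        finally have "- (y * w) / B \<le> m * m / B" using A by (intro divide_right_mono) auto
        then show ?thesis by (simp add: power2_eq_square)
      qed
      ultimately show ?thesis by (simp add: w_def)
    qed
    have "m\<^sup>2 * K \<le> e * m"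
    proof -
      have "m * K \<le> 2 * \<eta> * K" using m K by (intro mult_right_mono) auto
      then have "m * (m * K) \<le> m * e" using \<eta> m by (intro mult_left_mono) auto
      then show ?thesis by (simp add: power2_eq_square algebra_simps)
    qed
    moreover have "2 * e * m \<le> (a2 - 1) * x + (a1 - 1) * y"
    proof -
      have "2 * e * x \<le> (a2 - 1) * x" "2 * e * y \<le> (a1 - 1) * y" using e xy by (auto intro: mult_right_mono)
      then show ?thesis by (simp add: m_def algebra_simps)
    qed
    ultimately have "e * m \<le> (a2 - 1) * x + (a1 - 1) * y - m\<^sup>2 * K" by linarith
    also have "\<dots> = (- s - m\<^sup>2 * (c / P + 2 * c\<^sup>2)) + (a2 * x - y - m\<^sup>2 * (1 / B))"
      by (simp add: s K_def algebra_simps)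
    also have "\<dots> \<le> 1 / (r1 * P) * (compF r1 a1 u v - u) + 1 / (r2 * B) * (compG r2 a2 u v - v)"
      using Fpart Gpart by (rule add_mono)
    finally show ?thesis by (simp add: m_def x_def y_def)
  qed
  have "\<exists>p q e \<eta>. 0 \<le> p \<and> 0 \<le> q \<and> 0 < e \<and> 0 < \<eta> \<and>
       (\<forall>u v. A \<le> u \<and> u \<le> 1 \<and> u \<le> A + \<eta> \<and> B \<le> v \<and> v \<le> 1 \<and> v \<le> B + \<eta> \<longrightarrow>
         e * ((u - A) + (v - B)) \<le> p * (compF r1 a1 u v - u) + q * (compG r2 a2 u v - v))"
    using r P A e \<eta> main
    by (intro exI[of _ "1 / (r1 * P)"] exI[of _ "1 / (r2 * B)"] exI[of _ e] exI[of _ \<eta>]) auto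
  moreover have FA: "compF r1 a1 A B = A" "compG r2 a2 A B = B" using A by (auto simp: compF_def compG_def)
  moreover have "u = A" if "A \<le> u" "u \<le> 1" "B \<le> v" "compF r1 a1 u v = A" for u v
    using compF_le(2)[of r1 a1 A u B v] that r a A FA by (cases "A < u") auto
  moreover have "v = B" if "A \<le> u" "B \<le> v" "v \<le> 1" "compG r2 a2 u v = B" for u v
    using compG_le(2)[of r2 a2 A u B v] that r a A FA by (cases "B < v") auto
  ultimately show ?thesis unfolding unstable_above_def by blast
qed

section \<open>The competition system and its reflection symmetry\<close>

locale competition = A: centered M1 + B: centered M2 for M1 M2 +
  fixes r1 r2 a1 a2 :: real
  assumes r: "0 < r1" "r1 < 1" "0 < r2" "r2 < 1" and a: "1 < a1" "1 < a2"
begin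

sublocale centered_coupled M1 M2 "compF r1 a1" "compG r2 a2"
  by unfold_locales (use r a in \<open>auto intro: reaction_compF reaction_compG\<close>)

lemma flip: "competition M2 M1 r2 r1 a2 a1"
  by unfold_locales (use r a in auto)

lemma intermediate_unstable:
  assumes "fixpt r1 r2 a1 a2 A B" "\<not> (A = 0 \<and> B = 0)" "\<not> (A = 1 \<and> B = 1)"
  shows "unstable_above (compF r1 a1) (compG r2 a2) A B"
  using fixpt_cases[OF r(1,3) a assms(1)] assms(2,3) unstable_above_semitrivial[OF r(3,4) a(2)]
    unstable_above_coexistence[OF r a] by auto

lemma supersolution_constant:
  assumes fr: "front f" "front g"
    and super: "\<And>t. step M1 (compF r1 a1) f g t \<le> f t" "\<And>t. step M2 (compG r2 a2) f g t \<le> g t"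
    and lim: "(f \<longlongrightarrow> A) at_bot" "(g \<longlongrightarrow> B) at_bot"
    and ge: "\<And>t. A \<le> f t" "\<And>t. B \<le> g t"
    and AB: "fixpt r1 r2 a1 a2 A B" "\<not> (A = 0 \<and> B = 0)" "\<not> (A = 1 \<and> B = 1)"
  shows "f t = A \<and> g t = B"
  using AB(1) by (intro supersolution_at_unstable_constant[OF fr super lim ge _ _ intermediate_unstable[OF AB]])
    (auto simp: fixpt_def)

end

text \<open>Symmetry of the kernel makes convolution commute with the reflection of space; combined
  with the order-reversing exchange of species, the operator is conjugated to that of the flipped
  reaction.\<close>

lemma (in symmetric) step_flip:
  assumes F: "reaction F" and G: "\<And>u v. G u v = 1 - F (1 - v) (1 - u)" and fr: "front f" "front g"
  shows "step M F (\<lambda>t. 1 - g (- t)) (\<lambda>t. 1 - f (- t)) t = 1 - step M G f g (- t)"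
proof -
  define h where "h = (\<lambda>s. F (1 - g (- s)) (1 - f (- s)))"
  have h: "front h" unfolding h_def using front_reaction[OF F front_reflect[OF fr(2)] front_reflect[OF fr(1)]] .
  have hm: "(\<lambda>y. h (t - y)) \<in> borel_measurable borel"
    by (rule measurable_compose[OF _ front_measurable[OF h]]) measurable
  have "step M F (\<lambda>t. 1 - g (- t)) (\<lambda>t. 1 - f (- t)) t = (\<integral>y. h (t - y) \<partial>M)"
    by (simp add: step_def conv_def h_def)
  also have "\<dots> = (\<integral>y. h (t - - y) \<partial>M)" using sym[OF hm] by simp
  also have "\<dots> = 1 - (\<integral>y. 1 - h (t - - y) \<partial>M)"
  proof -
    have "integrable M (\<lambda>y. h (t - - y))"
    proof (rule integrable_const_bound[where B=1])
      show "(\<lambda>y. h (t - - y)) \<in> borel_measurable M"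
        using measurable_compose[OF _ front_measurable[OF h], of "\<lambda>y. t - - y" M] by simp
    qed (simp add: front_nonneg[OF h] front_le_1[OF h])
    then show ?thesis using prob_space by simp
  qed
  also have "\<dots> = 1 - step M G f g (- t)"
    by (simp add: step_def conv_def h_def G)
  finally show ?thesis .
qed

text \<open>The flip turns subsolutions into supersolutions, the limit at infinity into the limit at
  minus infinity, and intermediate fixed points into intermediate fixed points.\<close>

lemma (in competition) subsolution_constant:
  assumes fr: "front f" "front g"
    and sub: "\<And>t. f t \<le> step M1 (compF r1 a1) f g t" "\<And>t. g t \<le> step M2 (compG r2 a2) f g t"
    and lim: "(f \<longlongrightarrow> A) at_top" "(g \<longlongrightarrow> B) at_top"
    and le: "\<And>t. f t \<le> A" "\<And>t. g t \<le> B"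
    and AB: "fixpt r1 r2 a1 a2 A B" "\<not> (A = 0 \<and> B = 0)" "\<not> (A = 1 \<and> B = 1)"
  shows "f t = A \<and> g t = B"
proof -
  interpret X: competition M2 M1 r2 r1 a2 a1 by (rule flip)
  have s1: "step M2 (compF r2 a2) (\<lambda>t. 1 - g (- t)) (\<lambda>t. 1 - f (- t)) t = 1 - step M2 (compG r2 a2) f g (- t)" for t
    by (rule B.step_flip[OF X.F1 compG_flip fr])
  have s2: "step M1 (compG r1 a1) (\<lambda>t. 1 - g (- t)) (\<lambda>t. 1 - f (- t)) t = 1 - step M1 (compF r1 a1) f g (- t)" for t
    by (rule A.step_flip[OF X.F2 compF_flip fr])
  have "1 - g (- (- t)) = 1 - B \<and> 1 - f (- (- t)) = 1 - A"
  proof (rule X.supersolution_constant[of "\<lambda>t. 1 - g (- t)" "\<lambda>t. 1 - f (- t)" "1 - B" "1 - A" "- t"])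
    show "((\<lambda>t. 1 - g (- t)) \<longlongrightarrow> 1 - B) at_bot" "((\<lambda>t. 1 - f (- t)) \<longlongrightarrow> 1 - A) at_bot"
      using lim by (auto intro!: tendsto_intros simp: filterlim_at_bot_mirror)
    show "fixpt r2 r1 a2 a1 (1 - B) (1 - A)" using AB(1) by (simp add: fixpt_flip[of r1])
  qed (use AB sub le in \<open>auto simp: s1 s2 front_reflect fr\<close>)
  then show ?thesis by simp
qed

section \<open>Limits of approximate waves\<close>

text \<open>Convergence in total variation. The error must be uniform over test functions because
  the fronts being integrated change together with the kernel.\<close>

definition kernel_tendsto :: "(nat \<Rightarrow> real measure) \<Rightarrow> real measure \<Rightarrow> bool" where
  "kernel_tendsto L M \<longleftrightarrow> (\<exists>e. e \<longlonglongrightarrow> 0 \<and>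
     (\<forall>n (h :: real \<Rightarrow> real). h \<in> borel_measurable borel \<and> (\<forall>x. \<bar>h x\<bar> \<le> 1) \<longrightarrow>
       \<bar>(\<integral>y. h y \<partial>L n) - (\<integral>y. h y \<partial>M)\<bar> \<le> e n))"

lemma kernel_tendsto_subseq:
  assumes "kernel_tendsto L M" "strict_mono s" shows "kernel_tendsto (\<lambda>n. L (s n)) M"
proof -
  obtain e where e: "e \<longlonglongrightarrow> 0" "\<And>n (h :: real \<Rightarrow> real). h \<in> borel_measurable borel \<Longrightarrow> (\<forall>x. \<bar>h x\<bar> \<le> 1) \<Longrightarrow>
       \<bar>(\<integral>y. h y \<partial>L n) - (\<integral>y. h y \<partial>M)\<bar> \<le> e n"
    using assms(1) unfolding kernel_tendsto_def by blast
  have "(\<lambda>n. e (s n)) \<longlonglongrightarrow> 0" using LIMSEQ_subseq_LIMSEQ[OF e(1) assms(2)] by (simp add: o_def)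
  then show ?thesis unfolding kernel_tendsto_def using e(2) by (intro exI[of _ "\<lambda>n. e (s n)"]) auto
qed

lemma (in diffuse) step_kernel_tendsto:
  assumes K: "kernel_tendsto L M"
    and F: "reaction F" and fn: "\<And>n. front (fn n)" "\<And>n. front (gn n)" and f: "front f" "front g"
    and lim: "\<And>x. isCont f x \<Longrightarrow> (\<lambda>n. fn n x) \<longlonglongrightarrow> f x"
      "\<And>x. isCont g x \<Longrightarrow> (\<lambda>n. gn n x) \<longlonglongrightarrow> g x"
    and x: "xn \<longlonglongrightarrow> x"
  shows "(\<lambda>n. step (L n) F (fn n) (gn n) (xn n)) \<longlonglongrightarrow> step M F f g x"
proof -
  obtain e where e: "e \<longlonglongrightarrow> 0" "\<And>n (h :: real \<Rightarrow> real). h \<in> borel_measurable borel \<Longrightarrow> (\<forall>x. \<bar>h x\<bar> \<le> 1) \<Longrightarrow>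
       \<bar>(\<integral>y. h y \<partial>L n) - (\<integral>y. h y \<partial>M)\<bar> \<le> e n"
    using K unfolding kernel_tendsto_def by blast
  have "\<bar>step (L n) F (fn n) (gn n) (xn n) - step M F (fn n) (gn n) (xn n)\<bar> \<le> e n" for n
  proof -
    have h: "front (\<lambda>s. F (fn n s) (gn n s))" by (rule front_reaction[OF F fn])
    show ?thesis unfolding step_def conv_def
    proof (rule e(2))
      have [measurable]: "(\<lambda>s. F (fn n s) (gn n s)) \<in> borel_measurable borel" by (rule front_measurable[OF h])
      show "(\<lambda>y. F (fn n (xn n - y)) (gn n (xn n - y))) \<in> borel_measurable borel"
        by (rule measurable_compose[where f="\<lambda>y. xn n - y" and g="\<lambda>s. F (fn n s) (gn n s)"]) measurable
      show "\<forall>y. \<bar>F (fn n (xn n - y)) (gn n (xn n - y))\<bar> \<le> 1"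
        using front_nonneg[OF h] front_le_1[OF h] by simp
    qed
  qed
  then have "(\<lambda>n. step (L n) F (fn n) (gn n) (xn n) - step M F (fn n) (gn n) (xn n)) \<longlonglongrightarrow> 0"
    by (intro Lim_null_comparison[OF _ e(1)]) (auto intro!: always_eventually)
  from tendsto_add[OF this step_limit[OF F fn f lim x]] show ?thesis by simp
qed

lemma step_shift: "step M F (\<lambda>t. f (t + x)) (\<lambda>t. g (t + x)) t = step M F f g (t + x)"
  by (simp add: step_def conv_def algebra_simps)

text \<open>Limits of inequalities hold at continuity points only. These are dense, so right
  continuity of the Helly limit extends a lower bound by a continuous function to every
  point.\<close>

lemma right_continuous_front_ge:
  assumes f: "front f" and rc: "\<And>x. continuous (at_right x) f" and S: "\<And>x. isCont S x"
    and le: "\<And>t. isCont f t \<Longrightarrow> S t \<le> f t"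
  shows "S t \<le> f t"
proof (rule ccontr)
  assume "\<not> ?thesis"
  then have "0 < S t - f t" by simp
  moreover have "((\<lambda>x. S x - f x) \<longlongrightarrow> S t - f t) (at_right t)"
    using rc[of t] S[of t] by (intro tendsto_diff) (auto simp: continuous_within intro: tendsto_within_subset)
  ultimately have "\<forall>\<^sub>F x in at_right t. 0 < S x - f x" by (rule order_tendstoD(1)[rotated])
  then obtain b where b: "t < b" "\<And>x. t < x \<Longrightarrow> x < b \<Longrightarrow> 0 < S x - f x"
    by (auto simp: eventually_at_right_field)
  obtain x where "t < x" "x < b" "isCont f x"
    using ex_isCont_between[OF front_mono[OF f] front_mono[OF f] b(1)] by blast
  then show False using b(2)[of x] le[of x] by simp
qed

text \<open>All hypotheses are invariant under \<open>(f, g) \<mapsto> (\<lambda>t. 1 - g (- t), \<lambda>t. 1 - f (- t))\<close> together with an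
  exchange of the two species, so only the limit at \<open>\<infinity>\<close> has to be analysed.\<close>

locale wave_limit = competition M1 M2 r1 r2 a1 a2 for M1 M2 r1 r2 a1 a2 +
  fixes K1 K2 :: "nat \<Rightarrow> real measure" and c :: real and cn w :: "nat \<Rightarrow> real"
    and f g :: "nat \<Rightarrow> real \<Rightarrow> real" and \<theta> :: real and \<phi> \<psi> :: "real \<Rightarrow> real"
  assumes K: "\<And>n. symmetric (K1 n)" "\<And>n. symmetric (K2 n)" "kernel_tendsto K1 M1" "kernel_tendsto K2 M2"
    and fr: "\<And>n. front (f n)" "\<And>n. front (g n)"
    and super: "\<And>n t. - w n < t \<Longrightarrow> step (K1 n) (compF r1 a1) (f n) (g n) (t - cn n) \<le> f n t"
       "\<And>n t. - w n < t \<Longrightarrow> step (K2 n) (compG r2 a2) (f n) (g n) (t - cn n) \<le> g n t"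
    and sub: "\<And>n t. t < w n \<Longrightarrow> f n t \<le> step (K1 n) (compF r1 a1) (f n) (g n) (t - cn n)"
       "\<And>n t. t < w n \<Longrightarrow> g n t \<le> step (K2 n) (compG r2 a2) (f n) (g n) (t - cn n)"
    and right: "\<And>n t. w n < t \<Longrightarrow> f n t = 1 \<and> g n t = 1"
    and left: "\<And>n t. t < - w n \<Longrightarrow> f n t = 0 \<and> g n t = 0"
    and cn: "cn \<longlonglongrightarrow> c" and w: "filterlim w at_top sequentially"
    and level: "\<And>n. f n 0 + g n 0 = \<theta>" and \<theta>: "0 < \<theta>" "\<theta> < 2"
    and \<theta>_fixpt: "\<And>A B. fixpt r1 r2 a1 a2 A B \<Longrightarrow> A + B \<noteq> \<theta>"
    and lim: "\<And>t. (\<lambda>n. f n t) \<longlonglongrightarrow> \<phi> t" "\<And>t. (\<lambda>n. g n t) \<longlonglongrightarrow> \<psi> t"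
begin

lemma limit_front: "front \<phi>" "front \<psi>"
  by (rule front_LIMSEQ[OF fr(1) lim(1)], rule front_LIMSEQ[OF fr(2) lim(2)])

lemma limit_level: "\<phi> 0 + \<psi> 0 = \<theta>"
  using LIMSEQ_unique[OF tendsto_add[OF lim(1)[of 0] lim(2)[of 0], unfolded level] tendsto_const] .

text \<open>A fixed \<open>t\<close> is strictly inside the window for all large \<open>n\<close>,
  so both one-sided inequalities hold there and combine to the equation.\<close>

lemma limit_wave:
  "\<phi> t = step M1 (compF r1 a1) \<phi> \<psi> (t - c)" "\<psi> t = step M2 (compG r2 a2) \<phi> \<psi> (t - c)"
proof -
  have tc: "(\<lambda>n. t - cn n) \<longlonglongrightarrow> t - c" by (intro tendsto_intros cn)
  have ev: "\<forall>\<^sub>F n in sequentially. \<bar>t\<bar> < w n" using w by (simp add: filterlim_at_top_dense)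
  have "\<forall>\<^sub>F n in sequentially. step (K1 n) (compF r1 a1) (f n) (g n) (t - cn n) = f n t"
    using ev by eventually_elim (use super(1) sub(1) in \<open>force intro: antisym\<close>)
  from Lim_transform_eventually[OF A.step_kernel_tendsto[OF K(3) F1 fr limit_front lim tc] this]
  show "\<phi> t = step M1 (compF r1 a1) \<phi> \<psi> (t - c)" using LIMSEQ_unique[OF lim(1)[of t]] by blast
  have "\<forall>\<^sub>F n in sequentially. step (K2 n) (compG r2 a2) (f n) (g n) (t - cn n) = g n t"
    using ev by eventually_elim (use super(2) sub(2) in \<open>force intro: antisym\<close>)
  from Lim_transform_eventually[OF B.step_kernel_tendsto[OF K(4) F2 fr limit_front lim tc] this]
  show "\<psi> t = step M2 (compG r2 a2) \<phi> \<psi> (t - c)" using LIMSEQ_unique[OF lim(2)[of t]] by blast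
qed

lemma wave_endpoint_fixpt:
  assumes ff: "front f'" "front g'"
    and eq: "\<And>t. f' t = step M1 (compF r1 a1) f' g' (t - c)" "\<And>t. g' t = step M2 (compG r2 a2) f' g' (t - c)"
    and l: "(f' \<longlongrightarrow> A) at_top" "(g' \<longlongrightarrow> B) at_top"
  shows "fixpt r1 r2 a1 a2 A B"
proof -
  have ft: "filterlim (\<lambda>t. t - c) at_top at_top"
    using filterlim_tendsto_add_at_top[OF tendsto_const[of "- c"] filterlim_ident] by simp
  have "((\<lambda>t. step M1 (compF r1 a1) f' g' (t - c)) \<longlongrightarrow> compF r1 a1 A B) at_top"
    unfolding step_def
    by (rule filterlim_compose[OF A.conv_at_limit[OF front_reaction[OF F1 ff] reaction_tendsto[OF F1 l]] ft]) simp
  then have "(f' \<longlongrightarrow> compF r1 a1 A B) at_top" unfolding eq(1)[symmetric] .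
  then have 1: "compF r1 a1 A B = A" using l(1) by (rule tendsto_unique[rotated]) simp
  have "((\<lambda>t. step M2 (compG r2 a2) f' g' (t - c)) \<longlongrightarrow> compG r2 a2 A B) at_top"
    unfolding step_def
    by (rule filterlim_compose[OF B.conv_at_limit[OF front_reaction[OF F2 ff] reaction_tendsto[OF F2 l]] ft]) simp
  then have "(g' \<longlongrightarrow> compG r2 a2 A B) at_top" unfolding eq(2)[symmetric] .
  then have 2: "compG r2 a2 A B = B" using l(2) by (rule tendsto_unique[rotated]) simp
  have "0 \<le> A" "A \<le> 1"
    using front_nonneg[OF ff(1)] front_le_1[OF ff(1)] by (auto intro: tendsto_lowerbound[OF l(1)] tendsto_upperbound[OF l(1)])
  moreover have "0 \<le> B" "B \<le> 1"
    using front_nonneg[OF ff(2)] front_le_1[OF ff(2)] by (auto intro: tendsto_lowerbound[OF l(2)] tendsto_upperbound[OF l(2)])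
  ultimately show ?thesis using 1 2 by (simp add: fixpt_def)
qed

text \<open>Otherwise the limit front ends in an intermediate state, which forces \<open>c < 0\<close>. Recentring the
  approximate fronts where they come close to \<open>(1, 1)\<close> produces a supersolution leaving an intermediate
  state, which is impossible for \<open>c < 0\<close>.\<close>

lemma limit_at_top: "(\<phi> \<longlongrightarrow> 1) at_top \<and> (\<psi> \<longlongrightarrow> 1) at_top"
proof (rule ccontr)
  assume neg: "\<not> ?thesis"
  note pf = limit_front
  obtain A where A: "(\<phi> \<longlongrightarrow> A) at_top" "\<And>t. \<phi> t \<le> A" "A \<le> 1"
    by (rule front_limit_at_top[OF pf(1)]) (rule that)
  obtain B where B: "(\<psi> \<longlongrightarrow> B) at_top" "\<And>t. \<psi> t \<le> B" "B \<le> 1"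
    by (rule front_limit_at_top[OF pf(2)]) (rule that)
  have AB: "fixpt r1 r2 a1 a2 A B" by (rule wave_endpoint_fixpt[OF pf limit_wave A(1) B(1)])
  have AB1: "\<not> (A = 1 \<and> B = 1)" using neg A B by blast
  have AB0: "\<not> (A = 0 \<and> B = 0)" using limit_level \<theta> A(2)[of 0] B(2)[of 0] by auto
  \<comment> \<open>For \<open>c \<ge> 0\<close> monotonicity would make the wave a subsolution for
    speed 0 ending in an intermediate state, hence constant. Its sum at 0 would then be that of a
    fixed point, which \<theta> avoids.\<close>
  have c: "c < 0"
  proof (rule ccontr)
    assume "\<not> c < 0"
    then have c0: "t - c \<le> t" for t by simp
    have "\<phi> t \<le> step M1 (compF r1 a1) \<phi> \<psi> t" for t
      using front_monoD[OF A.front_step[OF F1 pf] c0[of t]] limit_wave(1)[of t] by linarith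
    moreover have "\<psi> t \<le> step M2 (compG r2 a2) \<phi> \<psi> t" for t
      using front_monoD[OF B.front_step[OF F2 pf] c0[of t]] limit_wave(2)[of t] by linarith
    ultimately have "\<phi> 0 = A \<and> \<psi> 0 = B"
      by (rule subsolution_constant[OF pf _ _ A(1) B(1) A(2) B(2) AB AB0 AB1])
    then show False using limit_level \<theta>_fixpt[OF AB] by simp
  qed
  obtain S where S: "finite S" "\<And>A B. fixpt r1 r2 a1 a2 A B \<Longrightarrow> A + B \<in> S"
    by (rule fixpt_sums[OF r(1,3) a]) (rule that)
  \<comment> \<open>The level \<sigma> below is halfway between \<open>m\<close> and 2, so it
    exceeds \<theta> and the sum of every fixed point other than \<open>(1, 1)\<close>.\<close>
  define m where "m = Max (insert \<theta> (S \<inter> {..<2}))"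
  have m2: "m < 2" unfolding m_def using S \<theta> by (subst Max_less_iff) auto
  have m\<theta>: "\<theta> \<le> m" unfolding m_def using S by (intro Max_ge) auto
  define \<sigma> where "\<sigma> = (m + 2) / 2"
  have \<sigma>: "\<sigma> < 2" "\<theta> < \<sigma>" using m2 m\<theta> by (auto simp: \<sigma>_def)
  have fs: "A + B < \<sigma>" if "fixpt r1 r2 a1 a2 A B" "\<not> (A = 1 \<and> B = 1)" for A B
  proof -
    have "A + B < 2" using that by (auto simp: fixpt_def)
    then have "A + B \<le> m" unfolding m_def using S that by (intro Max_ge) auto
    then show ?thesis using m2 by (simp add: \<sigma>_def)
  qed
  define X where "X n = {t. f n t + g n t \<le> \<sigma>}" for n
  \<comment> \<open>The point where the \<open>n\<close>-th front passes \<sigma>, finite because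
    the sum is 2 beyond the right edge.\<close>
  define x where "x n = Sup (X n)" for n
  have X0: "0 \<in> X n" for n using level \<sigma> by (simp add: X_def)
  have Xw: "t \<le> w n" if "t \<in> X n" for t n 
  proof (rule ccontr)
    assume "\<not> t \<le> w n"
    then show False using right[of n t] that \<sigma> by (simp add: X_def)
  qed
  have Xb: "bdd_above (X n)" for n by (rule bdd_aboveI[of _ "w n"]) (rule Xw)
  have x0: "0 \<le> x n" for n unfolding x_def using X0 Xb by (rule cSup_upper)
  have xw: "x n \<le> w n" for n unfolding x_def by (rule cSup_least[OF _ Xw]) (use X0 in auto)
  have x_gt: "\<sigma> < f n t + g n t" if "x n < t" for n t
  proof (rule ccontr)
    assume "\<not> ?thesis"
    then have "t \<le> x n" unfolding x_def using Xb by (intro cSup_upper) (auto simp: X_def)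
    then show False using that by simp
  qed
  have x_lt: "f n t + g n t \<le> \<sigma>" if "t < x n" for n t
  proof -
    have "X n \<noteq> {}" using X0 by blast
    from less_cSup_iff[OF this Xb] obtain t' where "t' \<in> X n" "t < t'" using \<open>t < x n\<close> by (auto simp: x_def)
    then show ?thesis using front_monoD[OF fr(1), of t t' n] front_monoD[OF fr(2), of t t' n] by (simp add: X_def)
  qed
  \<comment> \<open>The limit wave never reaches \<sigma>, so the crossing points run off to
    infinity and leave any fixed point behind.\<close>
  have x_top: "\<forall>\<^sub>F n in sequentially. \<tau> \<le> x n" for \<tau>
  proof -
    have "\<phi> \<tau> + \<psi> \<tau> < \<sigma>" using fs[OF AB AB1] A(2)[of \<tau>] B(2)[of \<tau>] by simp
    then have "\<forall>\<^sub>F n in sequentially. f n \<tau> + g n \<tau> < \<sigma>"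
      using order_tendstoD(2)[OF tendsto_add[OF lim(1)[of \<tau>] lim(2)[of \<tau>]]] by blast
    then show ?thesis by eventually_elim (use Xb in \<open>auto simp: x_def X_def intro!: cSup_upper\<close>)
  qed
  define fx where "fx n t = f n (t + x n)" for n t
  define gx where "gx n t = g n (t + x n)" for n t
  have fxf: "front (fx n)" "front (gx n)" for n unfolding fx_def gx_def by (rule front_shift[OF fr(1)], rule front_shift[OF fr(2)])
  obtain s F G where s: "strict_mono (s::nat\<Rightarrow>nat)" and FG: "front F" "front G"
    "\<And>x. continuous (at_right x) F" "\<And>x. continuous (at_right x) G"
    and sl: "\<And>x. isCont F x \<Longrightarrow> (\<lambda>n. fx (s n) x) \<longlonglongrightarrow> F x"
    "\<And>x. isCont G x \<Longrightarrow> (\<lambda>n. gx (s n) x) \<longlonglongrightarrow> G x"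
    by (rule Helly_selection_front_pair[of fx gx, OF fxf]) (rule that)
  have tc: "(\<lambda>n. t - cn (s n)) \<longlonglongrightarrow> t - c" for t
    by (intro tendsto_intros LIMSEQ_subseq_LIMSEQ[OF cn s, unfolded o_def])
  have st1: "(\<lambda>n. step (K1 (s n)) (compF r1 a1) (f (s n)) (g (s n)) (t + x (s n) - cn (s n))) \<longlonglongrightarrow> step M1 (compF r1 a1) F G (t - c)" for t
    using A.step_kernel_tendsto[OF kernel_tendsto_subseq[OF K(3) s] F1 fxf(1) fxf(2) FG(1,2) sl tc[of t]]
    unfolding fx_def gx_def step_shift by (simp add: algebra_simps)
  have st2: "(\<lambda>n. step (K2 (s n)) (compG r2 a2) (f (s n)) (g (s n)) (t + x (s n) - cn (s n))) \<longlonglongrightarrow> step M2 (compG r2 a2) F G (t - c)" for t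
    using B.step_kernel_tendsto[OF kernel_tendsto_subseq[OF K(4) s] F2 fxf(1) fxf(2) FG(1,2) sl tc[of t]]
    unfolding fx_def gx_def step_shift by (simp add: algebra_simps)
  have evs: "\<forall>\<^sub>F n in sequentially. P (s n)" if "\<forall>\<^sub>F n in sequentially. P n" for P
    using that s by (rule eventually_subseq[rotated])
  have ev_w: "\<forall>\<^sub>F n in sequentially. - w (s n) < t + x (s n)" for t
  proof -
    have "\<forall>\<^sub>F n in sequentially. - t < w n" using w by (simp add: filterlim_at_top_dense)
    from evs[OF this] show ?thesis by eventually_elim (use x0 in \<open>smt (verit)\<close>)
  qed
  have superF: "step M1 (compF r1 a1) F G (t - c) \<le> F t" for t
  proof (rule right_continuous_front_ge[OF FG(1,3)])
    show "isCont (\<lambda>t. step M1 (compF r1 a1) F G (t - c)) x" for x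
      by (intro isCont_o2[OF _ A.step_isCont[OF F1 FG(1,2)]] continuous_intros)
    show "step M1 (compF r1 a1) F G (t - c) \<le> F t" if "isCont F t" for t
    proof (rule tendsto_le[OF _ sl(1)[OF that] st1])
      show "\<forall>\<^sub>F n in sequentially. step (K1 (s n)) (compF r1 a1) (f (s n)) (g (s n)) (t + x (s n) - cn (s n)) \<le> fx (s n) t"
        using ev_w[of t] by eventually_elim (auto simp: fx_def intro: super)
    qed simp
  qed
  have superG: "step M2 (compG r2 a2) F G (t - c) \<le> G t" for t
  proof (rule right_continuous_front_ge[OF FG(2,4)])
    show "isCont (\<lambda>t. step M2 (compG r2 a2) F G (t - c)) x" for x
      by (intro isCont_o2[OF _ B.step_isCont[OF F2 FG(1,2)]] continuous_intros)
    show "step M2 (compG r2 a2) F G (t - c) \<le> G t" if "isCont G t" for t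
    proof (rule tendsto_le[OF _ sl(2)[OF that] st2])
      show "\<forall>\<^sub>F n in sequentially. step (K2 (s n)) (compG r2 a2) (f (s n)) (g (s n)) (t + x (s n) - cn (s n)) \<le> gx (s n) t"
        using ev_w[of t] by eventually_elim (auto simp: gx_def intro: super)
    qed simp
  qed
  \<comment> \<open>In the recentred picture the left edge recedes, which gave supersolutions on the
    whole line. The right edge may stay at bounded distance, as only \<open>x n \<le> w n\<close> is
    known, so the subsolution property is available for negative \<open>t\<close> only.\<close>
  have xw': "t + x n < w n" if "t < 0" for t n using xw[of n] that by simp
  have subF: "F t \<le> step M1 (compF r1 a1) F G (t - c)" if "isCont F t" "t < 0" for t
    by (rule LIMSEQ_le[OF sl(1)[OF that(1)] st1]) (auto simp: fx_def intro!: sub xw' that)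
  have subG: "G t \<le> step M2 (compG r2 a2) F G (t - c)" if "isCont G t" "t < 0" for t
    by (rule LIMSEQ_le[OF sl(2)[OF that(1)] st2]) (auto simp: gx_def intro!: sub xw' that)
  obtain A2 where A2: "(F \<longlongrightarrow> A2) at_bot" "\<And>t. A2 \<le> F t" "0 \<le> A2"
    by (rule front_limit_at_bot[OF FG(1)]) (rule that)
  obtain B2 where B2: "(G \<longlongrightarrow> B2) at_bot" "\<And>t. B2 \<le> G t" "0 \<le> B2"
    by (rule front_limit_at_bot[OF FG(2)]) (rule that)
  have bot: "filterlim (\<lambda>t. t + d) at_bot at_bot" for d :: real
    unfolding filterlim_at_bot eventually_at_bot_linorder
  proof
    fix Z show "\<exists>N. \<forall>n\<le>N. n + d \<le> Z" by (intro exI[of _ "Z - d"]) auto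
  qed
  have lim1: "((\<lambda>t. step M1 (compF r1 a1) F G (t + d)) \<longlongrightarrow> compF r1 a1 A2 B2) at_bot" for d
    unfolding step_def
    by (rule filterlim_compose[OF A.conv_at_limit[OF front_reaction[OF F1 FG(1,2)] reaction_tendsto[OF F1 A2(1) B2(1)]] bot]) simp
  have lim2: "((\<lambda>t. step M2 (compG r2 a2) F G (t + d)) \<longlongrightarrow> compG r2 a2 A2 B2) at_bot" for d
    unfolding step_def
    by (rule filterlim_compose[OF B.conv_at_limit[OF front_reaction[OF F2 FG(1,2)] reaction_tendsto[OF F2 A2(1) B2(1)]] bot]) simp
  \<comment> \<open>The subsolution inequality holds at continuity points; going to one in
    \<open>(t, t + 1)\<close> costs a shift by 1 in the argument of \<open>step\<close>, harmless in
    the limit at minus infinity.\<close>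
  have upF: "F t \<le> step M1 (compF r1 a1) F G (t + (1 - c))" if t: "t \<le> - 1" for t
  proof -
    obtain t' where t': "t < t'" "t' < t + 1" "isCont F t'"
      using ex_isCont_between[OF front_mono[OF FG(1)] front_mono[OF FG(1)], of t "t + 1"] by auto
    have "F t \<le> F t'" using t' by (intro front_monoD[OF FG(1)]) simp
    also have "\<dots> \<le> step M1 (compF r1 a1) F G (t' - c)" using t' t by (intro subF) auto
    also have "\<dots> \<le> step M1 (compF r1 a1) F G (t + (1 - c))"
      using t' by (intro front_monoD[OF A.front_step[OF F1 FG(1,2)]]) simp
    finally show ?thesis .
  qed
  have upG: "G t \<le> step M2 (compG r2 a2) F G (t + (1 - c))" if t: "t \<le> - 1" for t
  proof -
    obtain t' where t': "t < t'" "t' < t + 1" "isCont G t'"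
      using ex_isCont_between[OF front_mono[OF FG(2)] front_mono[OF FG(2)], of t "t + 1"] by auto
    have "G t \<le> G t'" using t' by (intro front_monoD[OF FG(2)]) simp
    also have "\<dots> \<le> step M2 (compG r2 a2) F G (t' - c)" using t' t by (intro subG) auto
    also have "\<dots> \<le> step M2 (compG r2 a2) F G (t + (1 - c))"
      using t' by (intro front_monoD[OF B.front_step[OF F2 FG(1,2)]]) simp
    finally show ?thesis .
  qed
  have evb: "\<forall>\<^sub>F t in at_bot. t \<le> (- 1 :: real)" by (rule eventually_le_at_bot)
  have "compF r1 a1 A2 B2 \<le> A2"
    by (rule tendsto_le[OF _ A2(1) lim1[of "- c"]]) (use superF in auto)
  moreover have "A2 \<le> compF r1 a1 A2 B2"
    by (rule tendsto_le[OF _ lim1[of "1 - c"] A2(1) eventually_mono[OF evb upF]]) auto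
  moreover have "compG r2 a2 A2 B2 \<le> B2"
    by (rule tendsto_le[OF _ B2(1) lim2[of "- c"]]) (use superG in auto)
  moreover have "B2 \<le> compG r2 a2 A2 B2"
    by (rule tendsto_le[OF _ lim2[of "1 - c"] B2(1) eventually_mono[OF evb upG]]) auto
  ultimately have fix2: "fixpt r1 r2 a1 a2 A2 B2"
    using A2(3) B2(3) order_trans[OF A2(2)[of 0] front_le_1[OF FG(1)]] order_trans[OF B2(2)[of 0] front_le_1[OF FG(2)]]
    by (auto simp: fixpt_def)
  have not1: "\<not> (A2 = 1 \<and> B2 = 1)"
  proof -
    obtain t where t: "- 1 < t" "t < 0" "isCont F t" "isCont G t"
      by (rule ex_isCont_between[OF front_mono[OF FG(1)] front_mono[OF FG(2)], of "- 1" 0]) auto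
    have "F t + G t \<le> \<sigma>"
      by (rule LIMSEQ_le_const2[OF tendsto_add[OF sl(1)[OF t(3)] sl(2)[OF t(4)]]])
        (use t in \<open>auto simp: fx_def gx_def intro!: exI[of _ 0] x_lt\<close>)
    then show ?thesis using A2(2)[of t] B2(2)[of t] \<sigma> by auto
  qed
  \<comment> \<open>Every recentred point eventually lies right of 0 in the old coordinates. Hence
    the new limit dominates the old values at 0, whose sum is \<theta>, a positive number.\<close>
  have not0: "\<not> (A2 = 0 \<and> B2 = 0)"
  proof -
    have F\<phi>: "\<phi> 0 \<le> F t" if "isCont F t" for t
    proof (rule tendsto_le[OF _ sl(1)[OF that] LIMSEQ_subseq_LIMSEQ[OF lim(1)[of 0] s, unfolded o_def]])
      show "\<forall>\<^sub>F n in sequentially. f (s n) 0 \<le> fx (s n) t"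
        using evs[OF x_top[of "- t"]] by eventually_elim (auto simp: fx_def intro!: front_monoD[OF fr(1)])
    qed simp
    have G\<psi>: "\<psi> 0 \<le> G t" if "isCont G t" for t
    proof (rule tendsto_le[OF _ sl(2)[OF that] LIMSEQ_subseq_LIMSEQ[OF lim(2)[of 0] s, unfolded o_def]])
      show "\<forall>\<^sub>F n in sequentially. g (s n) 0 \<le> gx (s n) t"
        using evs[OF x_top[of "- t"]] by eventually_elim (auto simp: gx_def intro!: front_monoD[OF fr(2)])
    qed simp
    have "\<phi> 0 \<le> F t" for t
      by (rule right_continuous_front_ge[OF FG(1,3), of "\<lambda>_. \<phi> 0"]) (auto intro: F\<phi>)
    then have 1: "\<phi> 0 \<le> A2" by (intro tendsto_lowerbound[OF A2(1)]) auto
    have "\<psi> 0 \<le> G t" for t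
      by (rule right_continuous_front_ge[OF FG(2,4), of "\<lambda>_. \<psi> 0"]) (auto intro: G\<psi>)
    then have "\<psi> 0 \<le> B2" by (intro tendsto_lowerbound[OF B2(1)]) auto
    then show ?thesis using 1 limit_level \<theta> by auto
  qed
  \<comment> \<open>Because \<open>c < 0\<close>, dropping the shift only lowers
    \<open>step\<close>: the limit is a supersolution for speed 0, as the sign argument
    requires.\<close>
  have "step M1 (compF r1 a1) F G t \<le> F t" for t
    using superF[of t] front_monoD[OF A.front_step[OF F1 FG(1,2)], of t "t - c"] c by simp
  moreover have "step M2 (compG r2 a2) F G t \<le> G t" for t
    using superG[of t] front_monoD[OF B.front_step[OF F2 FG(1,2)], of t "t - c"] c by simp
  ultimately have const: "F t = A2 \<and> G t = B2" for t
    by (intro supersolution_constant[OF FG(1,2) _ _ A2(1) B2(1) A2(2) B2(2) fix2 not0 not1])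
  obtain t where t: "0 < t" "t < 1" "isCont F t" "isCont G t"
    by (rule ex_isCont_between[OF front_mono[OF FG(1)] front_mono[OF FG(2)], of 0 1]) auto
  \<comment> \<open>Just right of the crossing point the sum is at least \<sigma>, but the constant
    value is an intermediate fixed point, whose sum is below \<sigma>.\<close>
  have "\<sigma> \<le> F t + G t"
    by (rule LIMSEQ_le_const[OF tendsto_add[OF sl(1)[OF t(3)] sl(2)[OF t(4)]]])
      (use t in \<open>auto simp: fx_def gx_def intro!: exI[of _ 0] less_imp_le[OF x_gt]\<close>)
  then show False using const[of t] fs[OF fix2 not1] by simp
qed

lemma wave_limit_flip:
  "wave_limit M2 M1 r2 r1 a2 a1 K2 K1 (- c) (\<lambda>n. - cn n) w (\<lambda>n t. 1 - g n (- t)) (\<lambda>n t. 1 - f n (- t)) (2 - \<theta>)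
     (\<lambda>t. 1 - \<psi> (- t)) (\<lambda>t. 1 - \<phi> (- t))"
proof -
  interpret X: competition M2 M1 r2 r1 a2 a1 by (rule flip)
  have s1: "step (K2 n) (compF r2 a2) (\<lambda>t. 1 - g n (- t)) (\<lambda>t. 1 - f n (- t)) t = 1 - step (K2 n) (compG r2 a2) (f n) (g n) (- t)" for t n
    by (rule symmetric.step_flip[OF K(2) X.F1 compG_flip fr])
  have s2: "step (K1 n) (compG r1 a1) (\<lambda>t. 1 - g n (- t)) (\<lambda>t. 1 - f n (- t)) t = 1 - step (K1 n) (compF r1 a1) (f n) (g n) (- t)" for t n
    by (rule symmetric.step_flip[OF K(1) X.F2 compF_flip fr])
  show ?thesis
  proof (intro wave_limit.intro X.competition_axioms wave_limit_axioms.intro)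
    show "(\<lambda>n. 1 - g n (- t)) \<longlonglongrightarrow> 1 - \<psi> (- t)" "(\<lambda>n. 1 - f n (- t)) \<longlonglongrightarrow> 1 - \<phi> (- t)" for t
      by (intro tendsto_intros lim)+
    show "(\<lambda>n. - cn n) \<longlonglongrightarrow> - c" by (intro tendsto_intros cn)
    show "1 - g n (- 0) + (1 - f n (- 0)) = 2 - \<theta>" for n using level[of n] by simp
    show "A + B \<noteq> 2 - \<theta>" if "fixpt r2 r1 a2 a1 A B" for A B
      using \<theta>_fixpt[of "1 - B" "1 - A"] that fixpt_flip[of r2 r1 a2 a1 A B] by auto
    show "step (K2 n) (compF r2 a2) (\<lambda>t. 1 - g n (- t)) (\<lambda>t. 1 - f n (- t)) (t - - cn n) \<le> 1 - g n (- t)" if "- w n < t" for n t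
      unfolding s1 using sub(2)[of "- t" n] that by simp
    show "step (K1 n) (compG r1 a1) (\<lambda>t. 1 - g n (- t)) (\<lambda>t. 1 - f n (- t)) (t - - cn n) \<le> 1 - f n (- t)" if "- w n < t" for n t
      unfolding s2 using sub(1)[of "- t" n] that by simp
    show "1 - g n (- t) \<le> step (K2 n) (compF r2 a2) (\<lambda>t. 1 - g n (- t)) (\<lambda>t. 1 - f n (- t)) (t - - cn n)" if "t < w n" for n t
      unfolding s1 using super(2)[of n "- t"] that by simp
    show "1 - f n (- t) \<le> step (K1 n) (compG r1 a1) (\<lambda>t. 1 - g n (- t)) (\<lambda>t. 1 - f n (- t)) (t - - cn n)" if "t < w n" for n t
      unfolding s2 using super(1)[of n "- t"] that by simp
    show "1 - g n (- t) = 1 \<and> 1 - f n (- t) = 1" if "w n < t" for n t using left[of "- t" n] that by simp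
    show "1 - g n (- t) = 0 \<and> 1 - f n (- t) = 0" if "t < - w n" for n t using right[of n "- t"] that by simp
    show "front (\<lambda>t. 1 - g n (- t))" "front (\<lambda>t. 1 - f n (- t))" for n
      by (rule front_reflect[OF fr(2)], rule front_reflect[OF fr(1)])
  qed (use K w \<theta> in simp_all)
qed

lemma limit_at_bot: "(\<phi> \<longlongrightarrow> 0) at_bot \<and> (\<psi> \<longlongrightarrow> 0) at_bot"
proof -
  interpret X: wave_limit M2 M1 r2 r1 a2 a1 K2 K1 "- c" "\<lambda>n. - cn n" w "\<lambda>n t. 1 - g n (- t)" "\<lambda>n t. 1 - f n (- t)" "2 - \<theta>"
    "\<lambda>t. 1 - \<psi> (- t)" "\<lambda>t. 1 - \<phi> (- t)"
    by (rule wave_limit_flip)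
  have "((\<lambda>t. 1 - (1 - \<psi> (- t))) \<longlongrightarrow> 1 - 1) at_top" "((\<lambda>t. 1 - (1 - \<phi> (- t))) \<longlongrightarrow> 1 - 1) at_top"
    using X.limit_at_top by (intro tendsto_intros; simp)+
  then show ?thesis by (simp add: filterlim_at_bot_mirror)
qed

end

section \<open>Kernels given by densities\<close>

text \<open>Beyond \<open>m\<close> on either side the front varies by less than \<open>e\<close>;
  in between compactness applies. The middle interval is enlarged by 1, so two points closer than 1
  always share one of the three regions.\<close>

lemma front_uniformly_continuous:
  assumes f: "front f" and c: "\<And>x. isCont f x" and bot: "(f \<longlongrightarrow> 0) at_bot" and top: "(f \<longlongrightarrow> 1) at_top"
  shows "uniformly_continuous_on UNIV f"
  unfolding uniformly_continuous_on_def
proof (intro allI impI)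
  fix e :: real assume e: "0 < e"
  obtain a where a: "f a < e" using order_tendstoD(2)[OF bot e] by (auto simp: eventually_at_bot_linorder)
  obtain b where b: "1 - e < f b" using order_tendstoD(1)[OF top, of "1 - e"] e by (auto simp: eventually_at_top_linorder)
  define m where "m = max \<bar>a\<bar> \<bar>b\<bar>"
  have "continuous_on {- m - 1..m + 1} f" using c by (intro continuous_at_imp_continuous_on) auto
  then have "uniformly_continuous_on {- m - 1..m + 1} f" by (intro compact_uniformly_continuous) auto
  then obtain d where d: "0 < d"
    "\<And>x y. \<lbrakk>x \<in> {- m - 1..m + 1}; y \<in> {- m - 1..m + 1}; dist y x < d\<rbrakk> \<Longrightarrow> dist (f y) (f x) < e"
    using e unfolding uniformly_continuous_on_def by metis
  have "dist (f y) (f x) < e" if xy: "dist y x < min d 1" for x y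
  proof -
    consider "x \<in> {- m - 1..m + 1} \<and> y \<in> {- m - 1..m + 1}" | "m \<le> x \<and> m \<le> y" | "x \<le> - m \<and> y \<le> - m"
      using xy by (auto simp: dist_real_def abs_less_iff) linarith+
    then show ?thesis
    proof cases
      case 1
      then show ?thesis using d xy by auto
    next
      case 2
      then have "f b \<le> f x" "f b \<le> f y" by (auto intro!: front_monoD[OF f] simp: m_def)
      then show ?thesis using b front_le_1[OF f, of x] front_le_1[OF f, of y] by (simp add: dist_real_def abs_less_iff)
    next
      case 3
      then have "f x \<le> f a" "f y \<le> f a" by (auto intro!: front_monoD[OF f] simp: m_def)
      then show ?thesis using a front_nonneg[OF f, of x] front_nonneg[OF f, of y] by (simp add: dist_real_def abs_less_iff)
    qed
  qed
  then show "\<exists>d>0. \<forall>x\<in>UNIV. \<forall>y\<in>UNIV. dist y x < d \<longrightarrow> dist (f y) (f x) < e"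
    using d(1) by (intro exI[of _ "min d 1"]) auto
qed

lemma (in symmetric) ex_small_tails:
  assumes "0 < \<delta>"
  shows "\<exists>C0. \<forall>C\<ge>C0. measure M {..- C} < \<delta> \<and> measure M {C..} < \<delta>"
proof -
  have sym_tail: "measure M {C..} = measure M {..- C}" for C
  proof -
    have "(\<integral>y. indicator {C..} (- y) \<partial>M) = (\<integral>y. indicator {C..} y \<partial>M :: real)" by (rule sym) simp
    moreover have "(\<lambda>y. indicator {C..} (- y)) = (indicator {..- C} :: real \<Rightarrow> real)"
      by (auto simp: indicator_def fun_eq_iff)
    ultimately show ?thesis by simp
  qed
  have "\<forall>\<^sub>F x in at_bot. cdf M x < \<delta>" using order_tendstoD(2)[OF cdf_lim_at_bot assms] .
  then obtain a where a: "\<And>x. x \<le> a \<Longrightarrow> cdf M x < \<delta>" by (auto simp: eventually_at_bot_linorder)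
  have "measure M {..- C} < \<delta>" if "- a \<le> C" for C using a[of "- C"] that by (simp add: cdf_def)
  then show ?thesis unfolding sym_tail by blast
qed

text \<open>The densities are only Lebesgue measurable; pushing forward along the identity gives Borel measures.\<close>

definition kernel_measure :: "(real \<Rightarrow> real) \<Rightarrow> real measure" where
  "kernel_measure l = distr (density lebesgue (\<lambda>y. ennreal (l y))) borel (\<lambda>y. y)"

locale kernel =
  fixes l :: "real \<Rightarrow> real"
  assumes meas [measurable]: "l \<in> borel_measurable lebesgue" and int: "integrable lebesgue l"
    and one: "(\<integral>y. l y \<partial>lebesgue) = 1"
    and even: "l y = l (- y)" and nonneg: "0 \<le> l y"
begin

lemma borel_lebesgue [measurable (raw)]: "f \<in> borel_measurable borel \<Longrightarrow> f \<in> borel_measurable lebesgue"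
  by (simp add: measurable_completion)

lemma id_measurable: "(\<lambda>y. y) \<in> measurable (density lebesgue (\<lambda>y. ennreal (l y))) borel"
  by (simp add: measurable_completion)

lemma kernel_integral:
  fixes f :: "real \<Rightarrow> real"
  assumes f: "f \<in> borel_measurable borel"
  shows "(\<integral>y. f y \<partial>kernel_measure l) = (\<integral>y. l y * f y \<partial>lebesgue)"
  unfolding kernel_measure_def integral_distr[OF id_measurable f]
  by (subst integral_density) (auto simp: nonneg borel_lebesgue[OF f])

lemma kernel_integrable:
  fixes f :: "real \<Rightarrow> real"
  assumes f: "f \<in> borel_measurable borel"
  shows "integrable (kernel_measure l) f \<longleftrightarrow> integrable lebesgue (\<lambda>y. l y * f y)"
  unfolding kernel_measure_def integrable_distr_eq[OF id_measurable f]
  by (subst integrable_density) (auto simp: nonneg borel_lebesgue[OF f])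

lemma kernel_emeasure:
  assumes "X \<in> sets borel"
  shows "emeasure (kernel_measure l) X = (\<integral>\<^sup>+ y. ennreal (l y) * indicator X y \<partial>lebesgue)"
proof -
  have "X \<in> sets lebesgue" using assms by simp
  then show ?thesis
    unfolding kernel_measure_def using assms
    by (subst emeasure_distr[OF id_measurable]) (auto simp: emeasure_density)
qed

lemma kernel_symmetric: "symmetric (kernel_measure l)"
proof -
  have "emeasure (kernel_measure l) UNIV = 1"
    using int one nonneg by (subst kernel_emeasure) (auto simp: nn_integral_eq_integral)
  then interpret P: prob_space "kernel_measure l"
    by (intro prob_spaceI) (simp add: kernel_measure_def)
  show ?thesis
  proof unfold_locales
    show "sets (kernel_measure l) = sets borel" by (simp add: kernel_measure_def)
    show "emeasure (kernel_measure l) {x} = 0" for x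
      by (subst kernel_emeasure) (auto intro!: nn_integral_null_set)
    fix f :: "real \<Rightarrow> real" assume f: "f \<in> borel_measurable borel"
    have "(\<integral>y. f (- y) \<partial>kernel_measure l) = (\<integral>y. l y * f (- y) \<partial>lebesgue)"
      by (rule kernel_integral) (rule measurable_compose[OF _ f], simp)
    also have "\<dots> = (\<integral>y. l y * f y \<partial>lebesgue)"
      by (subst lebesgue_integral_real_affine[of "- 1" _ 0]) (simp_all add: even[symmetric])
    also have "\<dots> = (\<integral>y. f y \<partial>kernel_measure l)" by (rule kernel_integral[OF f, symmetric])
    finally show "(\<integral>y. f (- y) \<partial>kernel_measure l) = (\<integral>y. f y \<partial>kernel_measure l)" .
  qed
qed

text \<open>The exponential moments with exponents 1 and -1 dominate the first moment through
  \<open>\<bar>y\<bar> \<le> exp y + exp (- y)\<close>.\<close>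

lemma kernel_centered:
  assumes exp: "\<And>a. integrable lebesgue (\<lambda>y. l y * exp (a * y))"
  shows "centered (kernel_measure l)"
proof -
  interpret symmetric "kernel_measure l" by (rule kernel_symmetric)
  have "integrable lebesgue (\<lambda>y. l y * y)"
  proof (rule Bochner_Integration.integrable_bound)
    show "integrable lebesgue (\<lambda>y. l y * exp (1 * y) + l y * exp (- 1 * y))"
      by (intro Bochner_Integration.integrable_add exp)
    have "\<bar>y\<bar> \<le> exp y + exp (- y)" for y :: real
      using exp_ge_add_one_self[of y] exp_ge_add_one_self[of "- y"] exp_gt_zero[of y] exp_gt_zero[of "- y"] by linarith
    then have "l y * \<bar>y\<bar> \<le> l y * (exp y + exp (- y))" for y using nonneg by (intro mult_left_mono)
    then show "AE y in lebesgue. norm (l y * y) \<le> norm (l y * exp (1 * y) + l y * exp (- 1 * y))"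
      using nonneg by (auto simp: abs_mult distrib_left)
  qed measurable
  then show ?thesis
    by unfold_locales (simp add: kernel_integrable)
qed

lemma kernel_convolution:
  fixes h :: "real \<Rightarrow> real"
  assumes h: "h \<in> borel_measurable borel"
  shows "conv (kernel_measure l) h t = (\<integral>y. h y * l (t - y) \<partial>lebesgue)"
proof -
  have "conv (kernel_measure l) h t = (\<integral>y. l y * h (t - y) \<partial>lebesgue)"
    unfolding conv_def by (rule kernel_integral) (rule measurable_compose[OF _ h], simp)
  also have "\<dots> = (\<integral>y. h y * l (t - y) \<partial>lebesgue)"
    by (subst lebesgue_integral_real_affine[of "- 1" _ t]) (simp_all add: mult.commute)
  finally show ?thesis .
qed

lemma kernel_full_support:
  assumes pos: "\<And>y. 0 < l y" and ab: "a < b"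
  shows "0 < emeasure (kernel_measure l) {a<..<b}"
proof (rule ccontr)
  assume "\<not> ?thesis"
  then have "(\<integral>\<^sup>+ y. ennreal (l y) * indicator {a<..<b} y \<partial>lebesgue) = 0"
    by (subst (asm) kernel_emeasure) auto
  then have "AE y in lebesgue. ennreal (l y) * indicator {a<..<b} y = 0"
    by (subst (asm) nn_integral_0_iff_AE) auto
  then have "AE y in lebesgue. y \<notin> {a<..<b}"
    by eventually_elim (auto simp: indicator_def ennreal_eq_0_iff pos[folded not_le] split: if_splits)
  then have "{a<..<b} \<in> null_sets lebesgue" by (subst (asm) AE_iff_null_sets[symmetric]) auto
  then show False using ab by (auto simp: null_sets_def)
qed

end

text \<open>Mixing in a little Gaussian provides the full support needed by \<open>window_comparison\<close>.\<close>

definition smoothed :: "(real \<Rightarrow> real) \<Rightarrow> real \<Rightarrow> real \<Rightarrow> real" where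
  "smoothed l e y = (1 - e) * l y + e * std_normal_density y"

lemma gaussian_kernel: "kernel std_normal_density"
proof
  show "std_normal_density \<in> borel_measurable lebesgue" by (simp add: measurable_completion)
  show "integrable lebesgue std_normal_density" by (simp add: integrable_completion)
  show "(\<integral>y. std_normal_density y \<partial>lebesgue) = 1" by (simp add: integral_completion)
qed (auto simp: std_normal_density_def)

context kernel
begin

lemma smoothed_kernel:
  assumes "0 \<le> e" "e \<le> 1" shows "kernel (smoothed l e)"
proof -
  interpret G: kernel std_normal_density by (rule gaussian_kernel)
  show ?thesis
  proof
    show "smoothed l e \<in> borel_measurable lebesgue" unfolding smoothed_def using G.meas by measurable
    show "integrable lebesgue (smoothed l e)" unfolding smoothed_def using int G.int by simp
    show "(\<integral>y. smoothed l e y \<partial>lebesgue) = 1" unfolding smoothed_def using int G.int one G.one by simp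
    show "smoothed l e y = smoothed l e (- y)" for y unfolding smoothed_def using even[of y] G.even[of y] by simp
    show "0 \<le> smoothed l e y" for y unfolding smoothed_def using nonneg assms by simp
  qed
qed

lemma smoothed_integral:
  fixes f :: "real \<Rightarrow> real"
  assumes e: "0 \<le> e" "e \<le> 1" and f: "f \<in> borel_measurable borel" and bd: "\<And>x. \<bar>f x\<bar> \<le> 1"
  shows "(\<integral>y. f y \<partial>kernel_measure (smoothed l e)) =
    (1 - e) * (\<integral>y. f y \<partial>kernel_measure l) + e * (\<integral>y. f y \<partial>kernel_measure std_normal_density)"
proof -
  interpret G: kernel std_normal_density by (rule gaussian_kernel)
  interpret S: kernel "smoothed l e" by (rule smoothed_kernel[OF e])
  interpret MG: symmetric "kernel_measure std_normal_density" by (rule G.kernel_symmetric)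
  interpret M: symmetric "kernel_measure l" by (rule kernel_symmetric)
  have "integrable (kernel_measure l) f" using f bd by (intro M.integrable_const_bound[where B=1]) auto
  then have 1: "integrable lebesgue (\<lambda>y. l y * f y)" by (simp add: kernel_integrable[OF f])
  have "integrable (kernel_measure std_normal_density) f" using f bd by (intro MG.integrable_const_bound[where B=1]) auto
  then have 2: "integrable lebesgue (\<lambda>y. std_normal_density y * f y)" by (simp add: G.kernel_integrable[OF f])
  have "(\<integral>y. smoothed l e y * f y \<partial>lebesgue) = (\<integral>y. (1 - e) * (l y * f y) + e * (std_normal_density y * f y) \<partial>lebesgue)"
    by (simp add: smoothed_def algebra_simps)
  also have "\<dots> = (1 - e) * (\<integral>y. l y * f y \<partial>lebesgue) + e * (\<integral>y. std_normal_density y * f y \<partial>lebesgue)"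
    using 1 2 by simp
  finally show ?thesis by (simp only: kernel_integral[OF f] G.kernel_integral[OF f] S.kernel_integral[OF f])
qed

text \<open>The two integrals differ by \<open>e n * (z - x)\<close> with \<open>x\<close> and
  \<open>z\<close> bounded by 1, whatever the test function.\<close>

lemma smoothed_tendsto:
  assumes e: "\<And>n. 0 \<le> e n" "\<And>n. e n \<le> 1" "e \<longlonglongrightarrow> 0"
  shows "kernel_tendsto (\<lambda>n. kernel_measure (smoothed l (e n))) (kernel_measure l)"
  unfolding kernel_tendsto_def
proof (intro exI[of _ "\<lambda>n. 2 * e n"] conjI allI impI)
  show "(\<lambda>n. 2 * e n) \<longlonglongrightarrow> 0" using tendsto_mult_left[OF e(3), of 2] by simp
  fix n and h :: "real \<Rightarrow> real" assume h: "h \<in> borel_measurable borel \<and> (\<forall>x. \<bar>h x\<bar> \<le> 1)"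
  interpret G: kernel std_normal_density by (rule gaussian_kernel)
  have bound: "\<bar>\<integral>y. h y \<partial>M\<bar> \<le> 1" if "symmetric M" for M
  proof -
    interpret symmetric M by fact
    have i: "integrable M h" using h by (intro integrable_const_bound[where B=1]) auto
    have "h y \<le> 1" "- 1 \<le> h y" for y using h by (auto simp: abs_le_iff minus_le_iff)
    then have "(\<integral>y. h y \<partial>M) \<le> 1" "- 1 \<le> (\<integral>y. h y \<partial>M)" by (auto intro!: integral_le_const integral_ge_const i)
    then show ?thesis by simp
  qed
  define x where "x = (\<integral>y. h y \<partial>kernel_measure l)"
  define z where "z = (\<integral>y. h y \<partial>kernel_measure std_normal_density)"
  have xz: "\<bar>x\<bar> \<le> 1" "\<bar>z\<bar> \<le> 1" unfolding x_def z_def by (rule bound[OF kernel_symmetric], rule bound[OF G.kernel_symmetric])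
  have "(\<integral>y. h y \<partial>kernel_measure (smoothed l (e n))) = (1 - e n) * x + e n * z"
    unfolding x_def z_def using h by (intro smoothed_integral e) auto
  then have "(\<integral>y. h y \<partial>kernel_measure (smoothed l (e n))) - x = e n * (z - x)" by (simp add: algebra_simps)
  moreover have "\<bar>e n * (z - x)\<bar> \<le> e n * 2"
    unfolding abs_mult using e(1)[of n] xz by (intro mult_mono) auto
  ultimately show "\<bar>(\<integral>y. h y \<partial>kernel_measure (smoothed l (e n))) - (\<integral>y. h y \<partial>kernel_measure l)\<bar> \<le> 2 * e n"
    by (simp add: x_def mult.commute)
qed

text \<open>The tail of a mixture is a convex combination of two tails, so one threshold serves all
  mixing weights. This makes the bound on the speeds independent of \<open>n\<close>.\<close>

lemma smoothed_small_tails: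
  assumes d: "0 < \<delta>"
  shows "\<exists>C0. \<forall>C\<ge>C0. \<forall>e. 0 \<le> e \<and> e \<le> 1 \<longrightarrow>
    measure (kernel_measure (smoothed l e)) {..- C} < \<delta> \<and> measure (kernel_measure (smoothed l e)) {C..} < \<delta>"
proof -
  interpret G: kernel std_normal_density by (rule gaussian_kernel)
  obtain C1 where C1: "\<And>C. C1 \<le> C \<Longrightarrow> measure (kernel_measure l) {..- C} < \<delta> \<and> measure (kernel_measure l) {C..} < \<delta>"
    using symmetric.ex_small_tails[OF kernel_symmetric d] by blast
  obtain C2 where C2: "\<And>C. C2 \<le> C \<Longrightarrow> measure (kernel_measure std_normal_density) {..- C} < \<delta> \<and> measure (kernel_measure std_normal_density) {C..} < \<delta>"
    using symmetric.ex_small_tails[OF G.kernel_symmetric d] by blast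
  have sm: "measure (kernel_measure (smoothed l e)) X =
    (1 - e) * measure (kernel_measure l) X + e * measure (kernel_measure std_normal_density) X"
    if "0 \<le> e" "e \<le> 1" "X \<in> sets borel" for e X
    using smoothed_integral[OF that(1,2), of "indicator X"] that(3)
    by (simp add: kernel_measure_def)
  have convex: "(1 - e) * x + e * z < \<delta>" if "0 \<le> e" "e \<le> 1" "x < \<delta>" "z < \<delta>" for e x z :: real
    using convex_bound_lt[of x \<delta> z "1 - e" e] that by simp
  show ?thesis
    by (intro exI[of _ "max C1 C2"]) (auto simp: sm intro!: convex dest: C1 C2)
qed

end

text \<open>The first component decreases exactly when \<open>p > a1 * q\<close>, hence the
  direction \<open>(2 * a1, 1)\<close>. Along it the exponent of the second component tends to
  \<open>1 - a2\<close>, which is negative.\<close>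

lemma ex_small_superstate:
  assumes r: "0 < r1" "0 < r2" and a: "1 < a1" "1 < a2" and d: "0 < \<theta>"
  obtains p q where "0 \<le> p" "p \<le> 1" "0 \<le> q" "q \<le> 1" "compF r1 a1 p q < p" "compG r2 a2 p q < q" "p + q < \<theta>"
proof -
  \<comment> \<open>The three bounds make the second exponent negative, keep
    \<open>2 * a1 * s\<close> below 1, and keep the sum of the state below \<theta>.\<close>
  define s where "s = min (min ((a2 - 1) / (4 * a1 * a2)) (1 / (4 * a1))) (\<theta> / (4 * (1 + 2 * a1)))"
  have s: "0 < s" "s \<le> (a2 - 1) / (4 * a1 * a2)" "s \<le> 1 / (4 * a1)" "s \<le> \<theta> / (4 * (1 + 2 * a1))"
    using a d by (auto simp: s_def)
  have s1: "4 * a1 * a2 * s \<le> a2 - 1" "4 * a1 * s \<le> 1" "4 * (1 + 2 * a1) * s \<le> \<theta>"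
    using s a by (auto simp: field_simps)
  have "s \<le> a1 * s" using s a by simp
  then have q1: "s < 1" using s1(2) s(1) by linarith
  show thesis
  proof (rule that[of "2 * a1 * s" s])
    have pos: "0 < a1 * s" using s a by simp
    show "0 \<le> 2 * a1 * s" "2 * a1 * s \<le> 1" "0 \<le> s" "s \<le> 1" using s1 s pos q1 by auto
    have p1: "2 * a1 * s < 1" using s1(2) pos by linarith
    have "1 < exp (r1 * (2 * a1 * s - a1 * s))" using r pos by simp
    then have "(1 - 2 * a1 * s) * 1 < (1 - 2 * a1 * s) * exp (r1 * (2 * a1 * s - a1 * s))"
      using p1 by (intro mult_strict_left_mono) auto
    then show "compF r1 a1 (2 * a1 * s) s < 2 * a1 * s" by (simp add: compF_def)
    have "1 - a2 - s + a2 * (2 * a1 * s) < 0"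
    proof -
      have "a2 * (2 * a1 * s) = (4 * a1 * a2 * s) / 2" by simp
      also have "\<dots> \<le> (a2 - 1) / 2" using s1(1) by simp
      finally show ?thesis using s(1) a(2) by (simp add: field_simps)
    qed
    then have "exp (r2 * (1 - a2 - s + a2 * (2 * a1 * s))) < 1" using r by (simp add: mult_pos_neg)
    then have "s * exp (r2 * (1 - a2 - s + a2 * (2 * a1 * s))) < s * 1" using s(1) by (rule mult_strict_left_mono)
    then show "compG r2 a2 (2 * a1 * s) s < s" by (simp add: compG_def)
    have "2 * a1 * s + s = (4 * (1 + 2 * a1) * s) / 4" by (simp add: algebra_simps)
    also have "\<dots> \<le> \<theta> / 4" using s1(3) by simp
    finally show "2 * a1 * s + s < \<theta>" using d by simp
  qed
qed

theorem theorem1: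
  fixes r1 r2 a1 a2 :: real and l1 l2 :: "real \<Rightarrow> real"
  assumes r1: "0 < r1" "r1 < 1" and r2: "0 < r2" "r2 < 1"
    and a1: "1 < a1" and a2: "1 < a2"
    and l1_meas: "l1 \<in> borel_measurable lebesgue" and l1_int: "integrable lebesgue l1"
    and l1_one: "(\<integral>y. l1 y \<partial>lebesgue) = 1"
    and l1_exp: "\<And>lam::real. integrable lebesgue (\<lambda>y. l1 y * exp (lam * y))"
    and l1_sym: "\<And>y. l1 y = l1 (- y)" and l1_nonneg: "\<And>y. 0 \<le> l1 y"
    and l2_meas: "l2 \<in> borel_measurable lebesgue" and l2_int: "integrable lebesgue l2"
    and l2_one: "(\<integral>y. l2 y \<partial>lebesgue) = 1"
    and l2_exp: "\<And>lam::real. integrable lebesgue (\<lambda>y. l2 y * exp (lam * y))"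
    and l2_sym: "\<And>y. l2 y = l2 (- y)" and l2_nonneg: "\<And>y. 0 \<le> l2 y"
  shows "\<exists>(c::real) (\<phi>::real \<Rightarrow> real) (\<psi>::real \<Rightarrow> real).
           in_C01 \<phi> \<and> in_C01 \<psi> \<and>
           (\<forall>t. \<phi> (t + c) = 1 - (\<integral>y. (1 - \<phi> y) * exp (r1 * (\<phi> y - a1 * \<psi> y)) * l1 (t - y) \<partial>lebesgue)) \<and>
           (\<forall>t. \<psi> (t + c) = (\<integral>y. \<psi> y * exp (r2 * (1 - a2 - \<psi> y + a2 * \<phi> y)) * l2 (t - y) \<partial>lebesgue)) \<and>
           (\<phi> \<longlongrightarrow> 0) at_bot \<and> (\<psi> \<longlongrightarrow> 0) at_bot \<and>
           (\<phi> \<longlongrightarrow> 1) at_top \<and> (\<psi> \<longlongrightarrow> 1) at_top \<and>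
           mono \<phi> \<and> mono \<psi>"
proof -
  interpret k1: kernel l1 by (rule kernel.intro[OF l1_meas l1_int l1_one l1_sym l1_nonneg])
  interpret k2: kernel l2 by (rule kernel.intro[OF l2_meas l2_int l2_one l2_sym l2_nonneg])
  define M1 where "M1 = kernel_measure l1"
  define M2 where "M2 = kernel_measure l2"
  interpret competition M1 M2 r1 r2 a1 a2
    unfolding M1_def M2_def
    by (intro competition.intro competition_axioms.intro k1.kernel_centered k2.kernel_centered l1_exp l2_exp r1 r2 a1 a2)
  let ?F = "compF r1 a1" and ?G = "compG r2 a2"
  obtain S where S: "finite S" "\<And>A B. fixpt r1 r2 a1 a2 A B \<Longrightarrow> A + B \<in> S"
    by (rule fixpt_sums[OF r1(1) r2(1) a1 a2]) (rule that)
  have "infinite ({0<..<2} - S)" using S(1) by (intro Diff_infinite_finite) (auto simp: infinite_Ioo)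
  then have "{0<..<2} - S \<noteq> {}" by (rule infinite_imp_nonempty)
  then obtain \<theta> where "\<theta> \<in> {0<..<2} - S" by blast
  then have \<theta>: "0 < \<theta>" "\<theta> < 2" "\<theta> \<notin> S" by auto
  obtain p q where pq: "0 \<le> p" "p \<le> 1" "0 \<le> q" "q \<le> 1" "?F p q < p" "?G p q < q" "p + q < \<theta>"
    by (rule ex_small_superstate[OF r1(1) r2(1) a1 a2 \<theta>(1)]) (rule that)
  have \<theta>': "0 < 2 - \<theta>" using \<theta> by simp
  \<comment> \<open>A superstate of the system with exchanged species, at level
    \<open>2 - \<theta>\<close>, flips to a state near \<open>(1, 1)\<close> that the original map
    strictly raises and whose sum exceeds \<theta>.\<close>
  obtain q1 p1 where pq1: "0 \<le> q1" "q1 \<le> 1" "0 \<le> p1" "p1 \<le> 1" "compF r2 a2 q1 p1 < q1" "compG r1 a1 q1 p1 < p1" "q1 + p1 < 2 - \<theta>"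
    by (rule ex_small_superstate[OF r2(1) r1(1) a2 a1 \<theta>']) (rule that)
  define p' where "p' = 1 - p1"
  define q' where "q' = 1 - q1"
  have pq': "0 \<le> p'" "p' \<le> 1" "0 \<le> q'" "q' \<le> 1" "p' < ?F p' q'" "q' < ?G p' q'" "\<theta> < p' + q'"
    using pq1 compF_flip[of r1 a1 p' q'] compG_flip[of r2 a2 p' q'] by (auto simp: p'_def q'_def)
  \<comment> \<open>The smallest of the four margins; kernel tails below it satisfy the hypotheses
    of \<open>window_upper_bound\<close> and \<open>window_lower_bound\<close>.\<close>
  define \<delta> where "\<delta> = min (min (p - ?F p q) (q - ?G p q)) (min (?F p' q' - p') (?G p' q' - q'))"
  have \<delta>: "0 < \<delta>" "\<delta> \<le> p - ?F p q" "\<delta> \<le> q - ?G p q" "\<delta> \<le> ?F p' q' - p'" "\<delta> \<le> ?G p' q' - q'"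
    using pq pq' by (auto simp: \<delta>_def)
  obtain C1 where C1: "\<And>C e. C1 \<le> C \<Longrightarrow> 0 \<le> e \<Longrightarrow> e \<le> 1 \<Longrightarrow>
      measure (kernel_measure (smoothed l1 e)) {..- C} < \<delta> \<and> measure (kernel_measure (smoothed l1 e)) {C..} < \<delta>"
    using k1.smoothed_small_tails[OF \<delta>(1)] by blast
  obtain C2 where C2: "\<And>C e. C2 \<le> C \<Longrightarrow> 0 \<le> e \<Longrightarrow> e \<le> 1 \<Longrightarrow>
      measure (kernel_measure (smoothed l2 e)) {..- C} < \<delta> \<and> measure (kernel_measure (smoothed l2 e)) {C..} < \<delta>"
    using k2.smoothed_small_tails[OF \<delta>(1)] by blast
  define C where "C = max C1 C2"
  define e where "e n = 1 / real (Suc n)" for n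
  have e: "0 < e n" "0 \<le> e n" "e n \<le> 1" for n by (auto simp: e_def)
  have e0: "e \<longlonglongrightarrow> 0" unfolding e_def by (rule lim_1_over_n[THEN LIMSEQ_Suc])
  define L1 where "L1 n = kernel_measure (smoothed l1 (e n))" for n
  define L2 where "L2 n = kernel_measure (smoothed l2 (e n))" for n
  have Lsym: "symmetric (L1 n)" "symmetric (L2 n)" for n
    unfolding L1_def L2_def
    by (rule kernel.kernel_symmetric[OF k1.smoothed_kernel[OF e(2,3)]], rule kernel.kernel_symmetric[OF k2.smoothed_kernel[OF e(2,3)]])
  have Llim: "kernel_tendsto L1 M1" "kernel_tendsto L2 M2"
    unfolding L1_def L2_def M1_def M2_def
    by (rule k1.smoothed_tendsto[OF e(2,3) e0], rule k2.smoothed_tendsto[OF e(2,3) e0])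
  have coup: "coupled (L1 n) (L2 n) ?F ?G" for n
    using Lsym[of n] F1 F2 by (intro coupled.intro coupled_axioms.intro) (auto simp: symmetric_def)
  define w where "w n = real (Suc n)" for n
  have "\<exists>c f g. coupled.window (L1 n) (L2 n) ?F ?G (w n) c f g \<and> f 0 + g 0 = \<theta> \<and> \<bar>c\<bar> \<le> \<bar>C\<bar> + 1" for n
  proof -
    interpret W: coupled "L1 n" "L2 n" ?F ?G by (rule coup)
    have pos: "0 < smoothed l1 (e n) y" "0 < smoothed l2 (e n) y" for y
      unfolding smoothed_def using l1_nonneg[of y] l2_nonneg[of y] e[of n] normal_density_pos[of 1 0 y]
      by (auto intro!: add_nonneg_pos)
    have supp: "0 < emeasure (L1 n) {a<..<b}" "0 < emeasure (L2 n) {a<..<b}" if "a < b" for a b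
      unfolding L1_def L2_def
      by (rule kernel.kernel_full_support[OF k1.smoothed_kernel[OF e(2,3)] pos(1) that],
          rule kernel.kernel_full_support[OF k2.smoothed_kernel[OF e(2,3)] pos(2) that])
    have t1: "measure (L1 n) {..- C} < \<delta> \<and> measure (L1 n) {C..} < \<delta>"
      unfolding L1_def by (rule C1) (auto simp: C_def e)
    have t2: "measure (L2 n) {..- C} < \<delta> \<and> measure (L2 n) {C..} < \<delta>"
      unfolding L2_def by (rule C2) (auto simp: C_def e)
    have w0: "0 < w n" by (simp add: w_def)
    obtain c f g where "W.window (w n) c f g" "f 0 + g 0 = \<theta>" "\<bar>c\<bar> \<le> \<bar>C\<bar> + 1"
    proof (rule W.window_with_level[OF w0 supp pq(1-4) _ _ pq(7) pq'(1-4) _ _ pq'(7), of C])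
      show "?F p q + measure (L1 n) {..- C} \<le> p" "?G p q + measure (L2 n) {..- C} \<le> q"
        "p' \<le> ?F p' q' - measure (L1 n) {C..}" "q' \<le> ?G p' q' - measure (L2 n) {C..}"
        using t1 t2 \<delta> by auto
    qed auto
    then show ?thesis by blast
  qed
  then obtain cn f g where W: "\<And>n. coupled.window (L1 n) (L2 n) ?F ?G (w n) (cn n) (f n) (g n)"
    and level: "\<And>n. f n 0 + g n 0 = \<theta>" and cb: "\<And>n. \<bar>cn n\<bar> \<le> \<bar>C\<bar> + 1"
    by metis
  note fr = coupled.window_front[OF coup W]
  have "bounded (range cn)" using cb by (auto simp: bounded_iff)
  then obtain c r where r: "strict_mono (r :: nat \<Rightarrow> nat)" "(\<lambda>n. cn (r n)) \<longlonglongrightarrow> c"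
    using bounded_imp_convergent_subsequence[of cn] by (auto simp: o_def)
  obtain r' f' g' where r': "strict_mono (r' :: nat \<Rightarrow> nat)" and fg': "front f'" "front g'"
    and lim': "\<And>x. isCont f' x \<Longrightarrow> (\<lambda>n. f (r (r' n)) x) \<longlonglongrightarrow> f' x"
      "\<And>x. isCont g' x \<Longrightarrow> (\<lambda>n. g (r (r' n)) x) \<longlonglongrightarrow> g' x"
    by (rule Helly_selection_front_pair[of "\<lambda>n. f (r n)" "\<lambda>n. g (r n)", OF fr]) (rule that)
  define s where "s n = r (r' n)" for n
  have s: "strict_mono s" using r(1) r' by (simp add: s_def strict_mono_def)
  have cs: "(\<lambda>n. cn (s n)) \<longlonglongrightarrow> c" using LIMSEQ_subseq_LIMSEQ[OF r(2) r'] by (simp add: s_def o_def)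
  have ws: "filterlim (\<lambda>n. w (s n)) at_top sequentially"
  proof (rule filterlim_at_top_mono[OF filterlim_real_sequentially])
    have "real n \<le> w (s n)" for n using strict_mono_imp_increasing[OF s, of n] by (simp add: w_def)
    then show "\<forall>\<^sub>F n in sequentially. real n \<le> w (s n)" by simp
  qed
  note Wss = coupled.window_super_sub[OF coup W]
  \<comment> \<open>Applying the limit operator once to the Helly limits gives continuous functions
    to which the window fronts converge at every point, as \<open>wave_limit\<close>
    demands.\<close>
  define \<phi> where "\<phi> t = step M1 ?F f' g' (t - c)" for t
  define \<psi> where "\<psi> t = step M2 ?G f' g' (t - c)" for t
  have tc: "(\<lambda>n. t - cn (s n)) \<longlonglongrightarrow> t - c" for t by (intro tendsto_intros cs)
  have ev: "\<forall>\<^sub>F n in sequentially. \<bar>t\<bar> < w (s n)" for t using ws by (simp add: filterlim_at_top_dense)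
  have \<phi>_lim: "(\<lambda>n. f (s n) t) \<longlonglongrightarrow> \<phi> t" for t
  proof (rule Lim_transform_eventually)
    show "(\<lambda>n. step (L1 (s n)) ?F (f (s n)) (g (s n)) (t - cn (s n))) \<longlonglongrightarrow> \<phi> t"
      unfolding \<phi>_def by (rule A.step_kernel_tendsto[OF kernel_tendsto_subseq[OF Llim(1) s] F1 fr(1) fr(2) fg' lim'[folded s_def] tc])
    show "\<forall>\<^sub>F n in sequentially. step (L1 (s n)) ?F (f (s n)) (g (s n)) (t - cn (s n)) = f (s n) t"
      using ev[of t] by eventually_elim (use Wss(1,3) in \<open>force intro: antisym\<close>)
  qed
  have \<psi>_lim: "(\<lambda>n. g (s n) t) \<longlonglongrightarrow> \<psi> t" for t
  proof (rule Lim_transform_eventually)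
    show "(\<lambda>n. step (L2 (s n)) ?G (f (s n)) (g (s n)) (t - cn (s n))) \<longlonglongrightarrow> \<psi> t"
      unfolding \<psi>_def by (rule B.step_kernel_tendsto[OF kernel_tendsto_subseq[OF Llim(2) s] F2 fr(1) fr(2) fg' lim'[folded s_def] tc])
    show "\<forall>\<^sub>F n in sequentially. step (L2 (s n)) ?G (f (s n)) (g (s n)) (t - cn (s n)) = g (s n) t"
      using ev[of t] by eventually_elim (use Wss(2,4) in \<open>force intro: antisym\<close>)
  qed
  interpret wave_limit M1 M2 r1 r2 a1 a2 "\<lambda>n. L1 (s n)" "\<lambda>n. L2 (s n)" c "\<lambda>n. cn (s n)" "\<lambda>n. w (s n)"
    "\<lambda>n. f (s n)" "\<lambda>n. g (s n)" \<theta> \<phi> \<psi>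
  proof (intro wave_limit.intro competition_axioms wave_limit_axioms.intro)
    show "f (s n) t = 1 \<and> g (s n) t = 1" if "w (s n) < t" for n t
      using coupled.window_eq[OF coup W, of "s n" t] that by (simp add: w_def)
    show "f (s n) t = 0 \<and> g (s n) t = 0" if "t < - w (s n)" for n t
      using coupled.window_eq[OF coup W, of "s n" t] that by simp
    show "A + B \<noteq> \<theta>" if "fixpt r1 r2 a1 a2 A B" for A B using S(2)[OF that] \<theta>(3) by auto
  qed (fact Lsym kernel_tendsto_subseq[OF Llim(1) s] kernel_tendsto_subseq[OF Llim(2) s] fr Wss cs ws level \<theta>(1,2) \<phi>_lim \<psi>_lim)+
  note front = limit_front
  have cont: "isCont \<phi> x" "isCont \<psi> x" for x
    unfolding \<phi>_def \<psi>_def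
    by (intro isCont_o2[OF _ A.step_isCont[OF F1 fg']] isCont_o2[OF _ B.step_isCont[OF F2 fg']] continuous_intros)+
  have in_C: "in_C01 \<phi>" "in_C01 \<psi>"
    using front_uniformly_continuous[OF front(1) cont(1)] front_uniformly_continuous[OF front(2) cont(2)]
      limit_at_top limit_at_bot front_nonneg[OF front(1)] front_nonneg[OF front(2)] front_le_1[OF front(1)] front_le_1[OF front(2)]
    by (auto simp: in_C01_def bounded_iff intro!: exI[of _ 1])
  have [measurable]: "\<phi> \<in> borel_measurable borel" "\<psi> \<in> borel_measurable borel"
    by (rule front_measurable[OF front(1)], rule front_measurable[OF front(2)])
  have eq1: "\<phi> (t + c) = 1 - (\<integral>y. (1 - \<phi> y) * exp (r1 * (\<phi> y - a1 * \<psi> y)) * l1 (t - y) \<partial>lebesgue)" for t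
  proof -
    define h where "h y = (1 - \<phi> y) * exp (r1 * (\<phi> y - a1 * \<psi> y))" for y
    have h: "h \<in> borel_measurable borel" unfolding h_def by measurable
    have hF: "?F (\<phi> y) (\<psi> y) = 1 - h y" for y by (simp add: compF_def h_def)
    have i: "integrable M1 (\<lambda>y. ?F (\<phi> (t - y)) (\<psi> (t - y)))"
      by (rule A.front_integrable[OF front_reaction[OF F1 front]])
    have "\<phi> (t + c) = conv M1 (\<lambda>y. ?F (\<phi> y) (\<psi> y)) t"
      using limit_wave(1)[of "t + c"] by (simp add: step_def)
    also have "\<dots> = 1 - conv M1 h t"
    proof -
      have "conv M1 h t = (\<integral>y. 1 - ?F (\<phi> (t - y)) (\<psi> (t - y)) \<partial>M1)" unfolding conv_def hF by simp
      also have "\<dots> = 1 - conv M1 (\<lambda>y. ?F (\<phi> y) (\<psi> y)) t" using i A.prob_space by (simp add: conv_def)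
      finally show ?thesis by simp
    qed
    also have "conv M1 h t = (\<integral>y. h y * l1 (t - y) \<partial>lebesgue)" unfolding M1_def by (rule k1.kernel_convolution[OF h])
    finally show ?thesis by (simp add: h_def)
  qed
  have eq2: "\<psi> (t + c) = (\<integral>y. \<psi> y * exp (r2 * (1 - a2 - \<psi> y + a2 * \<phi> y)) * l2 (t - y) \<partial>lebesgue)" for t
  proof -
    have "(\<lambda>y. ?G (\<phi> y) (\<psi> y)) \<in> borel_measurable borel" by (rule front_measurable[OF front_reaction[OF F2 front]])
    then show ?thesis
      using limit_wave(2)[of "t + c"] k2.kernel_convolution[of "\<lambda>y. ?G (\<phi> y) (\<psi> y)" t] by (simp add: step_def compG_def M2_def)
  qed
  show ?thesis
    using in_C eq1 eq2 limit_at_bot limit_at_top front_mono[OF front(1)] front_mono[OF front(2)] by blast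
qed

end
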